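(* Let $(a_1,\dots,a_k)\in\mathcal{A}$. Let $L_n=\frac1n(\delta_{X_1}+\dots+\delta_{X_n})$ and $M_n=\max_{1\le i\le n}\frac{\phi_k(X_i)}{n}$. For any Borel set $A$ in $\mathcal{M}_1((0,\infty))\times[0,\infty)$, with interior $A^{\mathrm{o}}$ and closure $\bar A$, $$-\inf_{(\mu,z)\in A^{\mathrm{o}}}J^{max}(\mu,z)\le\liminf_{\delta\to0}\liminf_{n\to\infty}\frac1n\log\mathbb{P}\big((L_n,M_n)\in A^{\mathrm{o}}\,\big|\,C_n^\delta\big)$$ $$\le\limsup_{\delta\to0}\limsup_{n\to\infty}\frac1n\log\mathbb{P}\big((L_n,M_n)\in\bar A\,\big|\,C_n^\delta\big)\le-\inf_{(\mu,z)\in\bar A}J^{max}(\mu,z),$$ with rate function $$J^{max}(\mu,z)=\begin{cases}-h(\mu)-K(a_1,\dots,a_k)&\text{if }\int\phi_1d\mu=a_1,\dots,\int\phi_{k-1}d\mu=a_{k-1},\ \int\phi_kd\mu\le a_k-z,\\ \infty&\text{otherwise,}\end{cases}$$ where $$K(a_1,\dots,a_k)=\inf_{\mu\in\mathcal{M}_1((0,\infty))}\Big\{-h(\mu)\ \Big|\ \int\phi_1d\mu=a_1,\dots,\int\phi_{k-1}d\mu=a_{k-1},\ \int\phi_kd\mu\le a_k\Big\}.$$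
   Context: Fix an integer $k\ge2$ and functions $\phi_1,\dots,\phi_k:(0,\infty)\to(0,\infty)$ such that: (C1) each $\phi_i$ is $C^1$, increasing, and $\lim_{x\to\infty}\phi_i(x)=\infty$; (C2) for each $i$ and any $c>0$, $\int_0^\infty e^{-c\phi_i}dx<\infty$; (C3) there exists $\kappa>1$ such that for each $1\le i\le k-1$, $\phi_i(x)^\kappa<\phi_{i+1}(x)$ for all sufficiently large $x$; (C4) there exist $C,M>0$ such that $x>C$ implies $\frac1C\phi_i(x)^{-M}<\phi_i'(x)<C\phi_i(x)^M$ for each $i$. $\mathcal{M}_1((0,\infty))$ is the space of Borel probability measures on $(0,\infty)$ with the weak topology, and $\int$ means integration over $(0,\infty)$. Let $\lambda=\frac1Z e^{-\phi_1}dx$ be a probability measure on $(0,\infty)$. On $\Omega=(0,\infty)^{\mathbb{N}}$ with coordinate projections $X_i$, let $\mathbb{P}=\lambda^{\otimes\mathbb{N}}$. Put $S_n^i=\frac1n(\phi_i(X_1)+\dots+\phi_i(X_n))$ and $C_n^\delta=\bigcap_{i=1}^k\{|S_n^i-a_i|\le\delta\}$ for $\delta>0$. The differential entropy is $h(\mu)=-\int\frac{d\mu}{dx}\log\big(\frac{d\mu}{dx}\big)dx$ if $\mu\ll dx$ and $h(\mu)=-\infty$ otherwise. Let $\mathcal{A}_1$ be the interior of the set of $(v_1,\dots,v_{k-1})\in(0,\infty)^{k-1}$ for which there is $\mu\in\mathcal{M}_1((0,\infty))$ with $h(\mu)\ne-\infty$, $\int\phi_i\,d\mu=v_i$ for $1\le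 i\le k-1$, and $\int\phi_k\,d\mu<\infty$. For $(v_1,\dots,v_{k-1})\in\mathcal{A}_1$ let $g_1(v_1,\dots,v_{k-1})=\inf\{\int\phi_k\,d\mu : \mu\in\mathcal{M}_1((0,\infty)),\ h(\mu)\ne-\infty,\ \int\phi_i\,d\mu=v_i\ (1\le i\le k-1)\}$. It is assumed that $g_1:\mathcal{A}_1\to\mathbb{R}$ is continuous. The admissible set is $\mathcal{A}=\{(v_1,\dots,v_k): (v_1,\dots,v_{k-1})\in\mathcal{A}_1,\ v_k>g_1(v_1,\dots,v_{k-1})\}$. *)

theory Defs
  imports "HOL-Probability.Probability"
begin

definition leb_pos :: "real measure" where
  "leb_pos = restrict_space lborel {0<..}"

definition borel_pos :: "real measure" where
  "borel_pos = restrict_space borel {0<..}"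

definition prob_measures_pos :: "real measure set" where
  "prob_measures_pos = {\<mu>. prob_space \<mu> \<and> sets \<mu> = sets borel_pos}"

text \<open>The coarsest topology for which integration against every bounded continuous
  function on the positive half-line is continuous.\<close>

definition weak_topology_pos :: "real measure topology" where
  "weak_topology_pos = topology_generated_by
     {{\<mu> \<in> prob_measures_pos. (LINT x|\<mu>. f x) \<in> U} | (f :: real \<Rightarrow> real) U.
        continuous_on {0<..} f \<and> bounded (f ` {0<..}) \<and> open U}"

definition state_topology :: "(real measure \<times> real) topology" where
  "state_topology = prod_topology weak_topology_pos (top_of_set {0..})"

definition borel_sets_of :: "'a topology \<Rightarrow> 'a set set" where
  "borel_sets_of T = sigma_sets (topspace T) {U. openin T U}"

text \<open>The integral of a nonnegative function, possibly infinite.\<close>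

definition moment :: "(real \<Rightarrow> real) \<Rightarrow> real measure \<Rightarrow> ereal" where
  "moment f \<mu> = enn2ereal (\<integral>\<^sup>+x. ennreal (f x) \<partial>\<mu>)"

text \<open>The integral of \<open>- f * ln f\<close> is taken as the difference of the integrals of its positive
  and negative parts. The first of these is finite as soon as the first moment function
  \<open>\<phi> 1\<close> has finite \<open>\<mu>\<close>-integral, because \<open>exp (- c * \<phi> 1)\<close> is Lebesgue integrable; every use of
  the entropy below includes such a moment constraint, so the value of \<open>\<infinity> - \<infinity>\<close> is immaterial.\<close>

definition diff_entropy :: "real measure \<Rightarrow> ereal" where
  "diff_entropy \<mu> =
     (if absolutely_continuous leb_pos \<mu> then
        (let f = (\<lambda>x. enn2real (RN_deriv leb_pos \<mu> x)) in
           enn2ereal (\<integral>\<^sup>+x. ennreal (- (f x * ln (f x))) \<partial>leb_pos)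
         - enn2ereal (\<integral>\<^sup>+x. ennreal (f x * ln (f x)) \<partial>leb_pos))
      else - \<infinity>)"

definition gibbs :: "(nat \<Rightarrow> real \<Rightarrow> real) \<Rightarrow> real measure" where
  "gibbs \<phi> = density leb_pos
     (\<lambda>x. ennreal (exp (- \<phi> 1 x) / (LINT y|leb_pos. exp (- \<phi> 1 y))))"

text \<open>Samples are indexed by \<open>1, 2, \<dots>\<close>; the coordinate projection \<open>X\<^sub>i\<close> is \<open>\<lambda>\<omega>. \<omega> i\<close>.\<close>

definition sample_space :: "(nat \<Rightarrow> real \<Rightarrow> real) \<Rightarrow> (nat \<Rightarrow> real) measure" where
  "sample_space \<phi> = PiM {1..} (\<lambda>_. gibbs \<phi>)"

definition emp_mean :: "(real \<Rightarrow> real) \<Rightarrow> nat \<Rightarrow> (nat \<Rightarrow> real) \<Rightarrow> real" where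
  "emp_mean f n \<omega> = (\<Sum>j=1..n. f (\<omega> j)) / real n"

definition in_shell ::
  "nat \<Rightarrow> (nat \<Rightarrow> real \<Rightarrow> real) \<Rightarrow> (nat \<Rightarrow> real) \<Rightarrow> real \<Rightarrow> nat \<Rightarrow> (nat \<Rightarrow> real) \<Rightarrow> bool" where
  "in_shell k \<phi> a \<delta> n \<omega> \<longleftrightarrow> (\<forall>i\<in>{1..k}. \<bar>emp_mean (\<phi> i) n \<omega> - a i\<bar> \<le> \<delta>)"

definition emp_measure :: "nat \<Rightarrow> (nat \<Rightarrow> real) \<Rightarrow> real measure" where
  "emp_measure n \<omega> = measure_of (space borel_pos) (sets borel_pos)
     (\<lambda>B. (\<Sum>j=1..n. emeasure (return borel_pos (\<omega> j)) B) / of_nat n)"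

definition scaled_max :: "(real \<Rightarrow> real) \<Rightarrow> nat \<Rightarrow> (nat \<Rightarrow> real) \<Rightarrow> real" where
  "scaled_max f n \<omega> = Max ((\<lambda>j. f (\<omega> j) / real n) ` {1..n})"

text \<open>Real \<open>m\<close>-tuples are functions that are \<open>undefined\<close> outside \<open>{1..m}\<close>.\<close>

definition tuple_topology :: "nat \<Rightarrow> (nat \<Rightarrow> real) topology" where
  "tuple_topology m = product_topology (\<lambda>_. euclideanreal) {1..m}"

definition moments_match ::
  "nat \<Rightarrow> (nat \<Rightarrow> real \<Rightarrow> real) \<Rightarrow> (nat \<Rightarrow> real) \<Rightarrow> real measure \<Rightarrow> bool" where
  "moments_match k \<phi> v \<mu> \<longleftrightarrow> (\<forall>i\<in>{1..k-1}. moment (\<phi> i) \<mu> = ereal (v i))"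

definition adm1 :: "nat \<Rightarrow> (nat \<Rightarrow> real \<Rightarrow> real) \<Rightarrow> (nat \<Rightarrow> real) set" where
  "adm1 k \<phi> = tuple_topology (k - 1) interior_of
     {v \<in> PiE {1..k-1} (\<lambda>_. {0<..}).
        \<exists>\<mu>\<in>prob_measures_pos. diff_entropy \<mu> \<noteq> - \<infinity> \<and> moments_match k \<phi> v \<mu> \<and> moment (\<phi> k) \<mu> < \<infinity>}"

text \<open>On \<open>adm1 k \<phi>\<close> this infimum is a nonnegative real number.\<close>

definition g1 :: "nat \<Rightarrow> (nat \<Rightarrow> real \<Rightarrow> real) \<Rightarrow> (nat \<Rightarrow> real) \<Rightarrow> ereal" where
  "g1 k \<phi> v = (INF \<mu> \<in> {\<mu> \<in> prob_measures_pos. diff_entropy \<mu> \<noteq> - \<infinity> \<and> moments_match k \<phi> v \<mu>}.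
     moment (\<phi> k) \<mu>)"

definition admissible :: "nat \<Rightarrow> (nat \<Rightarrow> real \<Rightarrow> real) \<Rightarrow> (nat \<Rightarrow> real) set" where
  "admissible k \<phi> = {v \<in> PiE {1..k} (\<lambda>_. UNIV).
     restrict v {1..k-1} \<in> adm1 k \<phi> \<and> g1 k \<phi> (restrict v {1..k-1}) < ereal (v k)}"

definition K_val :: "nat \<Rightarrow> (nat \<Rightarrow> real \<Rightarrow> real) \<Rightarrow> (nat \<Rightarrow> real) \<Rightarrow> ereal" where
  "K_val k \<phi> a = (INF \<mu> \<in> {\<mu> \<in> prob_measures_pos.
     moments_match k \<phi> a \<mu> \<and> moment (\<phi> k) \<mu> \<le> ereal (a k)}. - diff_entropy \<mu>)"

definition J_max ::
  "nat \<Rightarrow> (nat \<Rightarrow> real \<Rightarrow> real) \<Rightarrow> (nat \<Rightarrow> real) \<Rightarrow> real measure \<Rightarrow> real \<Rightarrow> ereal" where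
  "J_max k \<phi> a \<mu> z =
     (if moments_match k \<phi> a \<mu> \<and> moment (\<phi> k) \<mu> \<le> ereal (a k - z)
      then - diff_entropy \<mu> - K_val k \<phi> a else \<infinity>)"

definition ereal_log :: "real \<Rightarrow> ereal" where
  "ereal_log p = (if p \<le> 0 then - \<infinity> else ereal (ln p))"

text \<open>\<open>(1/n) log P((L\<^sub>n, M\<^sub>n) \<in> B | C\<^sub>n\<^sup>\<delta>)\<close>\<close>

definition log_cond_prob ::
  "nat \<Rightarrow> (nat \<Rightarrow> real \<Rightarrow> real) \<Rightarrow> (nat \<Rightarrow> real) \<Rightarrow> (real measure \<times> real) set \<Rightarrow> real \<Rightarrow> nat \<Rightarrow> ereal" where
  "log_cond_prob k \<phi> a B \<delta> n = ereal (1 / real n) *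
     ereal_log (\<P>(\<omega> in sample_space \<phi>.
       (emp_measure n \<omega>, scaled_max (\<phi> k) n \<omega>) \<in> B \<bar> in_shell k \<phi> a \<delta> n \<omega>))"

end

theory Submission
  imports Defs "HOL-Real_Asymp.Real_Asymp"
begin

text \<open>Write \<open>L\<close> for the reference law \<open>gibbs \<phi>\<close>, with density \<open>exp (- \<phi> 1) / Z\<close>. A probability measure \<open>\<mu>\<close> with
\<open>\<integral> \<phi> 1 d\<mu> = a 1\<close> has relative entropy \<open>- h(\<mu>) + a 1 + ln Z\<close> with respect to \<open>L\<close>. Hence, by Sanov-type
estimates, the unconditioned probability that the state (empirical measure, scaled maximum) lies in a
set and that the shell event holds decays with rate \<open>a 1 + ln Z\<close> plus the infimum of \<open>- h\<close> over the
pairs \<open>(\<mu>, z)\<close> in the set that are \<^emph>\<open>feasible\<close>: \<open>\<mu>\<close> has the moments \<open>a 1, \<dots>, a (k - 1)\<close>, and its last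
moment is at most \<open>a k - z\<close>. Dividing by the probability of the shell itself cancels \<open>a 1 + ln Z\<close> and
subtracts \<open>K\<close>. So everything reduces to an upper bound (\<open>joint_upper_bound\<close>) and a lower bound
(\<open>joint_lower_bound\<close>) for joint probabilities, each of which is applied once to the set in question
and once to the whole space.

Upper bound. A feasible pair has a neighbourhood of the right probability by Chernoff's inequality,
because relative entropy is a supremum of \<open>\<integral> g d\<mu> - ln (\<integral> exp g dL)\<close> over bounded continuous \<open>g\<close>
(\<open>variational_entropy_bound\<close>). An infeasible pair has a neighbourhood that the state cannot enter on a
thin shell (\<open>infeasible_nbhd\<close>): for \<open>i < k\<close> the function \<open>\<phi> i\<close> is at most a power of \<open>\<phi> k\<close> with
exponent less than one, so the bound on the mean of \<open>\<phi> k\<close> makes \<open>\<phi> i\<close> uniformly integrable and its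
moment passes to the limit; the last moment may lose mass, but at least the amount \<open>z\<close> carried by the
largest term. Finitely many of these neighbourhoods suffice, up to an event of negligible
probability, by a Prokhorov argument (\<open>coercive_finite_subcover\<close>): the constraint on \<open>\<phi> 1\<close> prevents
escape to infinity and \<open>exponential_tightness\<close> prevents escape to zero.

Lower bound. Let most coordinates be samples of \<open>\<mu>\<close>, conditioned on a set where all relevant
functions are bounded. The missing amount \<open>a k - \<integral> \<phi> k d\<mu>\<close> of the last moment is carried by one
coordinate with \<open>\<phi> k\<close> about \<open>n z\<close> and by a fixed number of coordinates with \<open>\<phi> k\<close> a small multiple of
\<open>n\<close>. Such jumps are almost free (\<open>jump_probability\<close>) and invisible in the other moments
(\<open>jump_small_moments\<close>), since \<open>\<phi> k\<close> of order \<open>n\<close> forces \<open>\<phi> i\<close> to be of smaller order than \<open>n\<close> for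
\<open>i < k\<close>. A change of measure (\<open>change_of_measure_product\<close>) together with Hoeffding's inequality for the
bulk gives the bound.\<close>

section \<open>The weak topology on the half-line\<close>

lemma space_borel_pos [simp]: "space borel_pos = {0<..}"
  by (simp add: borel_pos_def space_restrict_space)

lemma prob_measures_posD:
  assumes "\<mu> \<in> prob_measures_pos"
  shows "prob_space \<mu>" "sets \<mu> = sets borel_pos" "space \<mu> = {0<..}"
proof -
  show 1: "prob_space \<mu>" "sets \<mu> = sets borel_pos"
    using assms by (auto simp: prob_measures_pos_def)
  from sets_eq_imp_space_eq[OF 1(2)] show "space \<mu> = {0<..}" by simp
qed

definition bdd_cont_pos :: "(real \<Rightarrow> real) \<Rightarrow> bool" where
  "bdd_cont_pos f \<longleftrightarrow> continuous_on {0<..} f \<and> bounded (f ` {0<..})"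

lemma bdd_cont_pos_measurable:
  assumes "bdd_cont_pos f" shows "f \<in> borel_measurable borel_pos"
  using assms unfolding bdd_cont_pos_def borel_pos_def
  by (auto intro: borel_measurable_continuous_on_restrict)

lemma measurable_pos_cong:
  assumes "\<mu> \<in> prob_measures_pos"
  shows "f \<in> measurable \<mu> N \<longleftrightarrow> f \<in> measurable borel_pos N"
  using measurable_cong_sets[OF prob_measures_posD(2)[OF assms] refl] by blast

lemma bdd_cont_pos_bound:
  assumes "bdd_cont_pos f" obtains B where "B > 0" "\<And>x. x > 0 \<Longrightarrow> \<bar>f x\<bar> \<le> B"
proof -
  obtain B where B: "\<forall>x\<in>f ` {0<..}. norm x \<le> B"
    using assms unfolding bdd_cont_pos_def bounded_iff by auto
  have "\<bar>f x\<bar> \<le> max B 1" if "x > 0" for x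
    using B[rule_format, of "f x"] that by (simp add: le_max_iff_disj)
  then show ?thesis using that[of "max B 1"] by auto
qed

lemma bdd_cont_pos_integrable:
  assumes "\<mu> \<in> prob_measures_pos" "bdd_cont_pos f"
  shows "integrable \<mu> f"
proof -
  interpret prob_space \<mu> using assms prob_measures_posD by auto
  obtain B where "B > 0" "\<And>x. x > 0 \<Longrightarrow> \<bar>f x\<bar> \<le> B"
    using bdd_cont_pos_bound[OF assms(2)] by blast
  then show ?thesis
    using assms bdd_cont_pos_measurable measurable_pos_cong[OF assms(1)] prob_measures_posD(3)[OF assms(1)]
    by (intro integrable_const_bound[where B=B]) (auto intro!: AE_I2)
qed

lemma topspace_weak_topology_pos [simp]: "topspace weak_topology_pos = prob_measures_pos"
proof -
  have "prob_measures_pos \<in> {{\<mu> \<in> prob_measures_pos. (LINT x|\<mu>. f x) \<in> U} | (f :: real \<Rightarrow> real) U.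
        continuous_on {0<..} f \<and> bounded (f ` {0<..}) \<and> open U}"
    by (rule CollectI, rule exI[of _ "\<lambda>_. 0"], rule exI[of _ UNIV]) (auto simp: bounded_iff)
  then show ?thesis
    unfolding weak_topology_pos_def topology_generated_by_topspace by blast
qed

lemma topspace_state_topology [simp]: "topspace state_topology = prob_measures_pos \<times> {0..}"
  by (simp add: state_topology_def)

text \<open>The generating sets are described by one test function each, and finite intersections by finitely
many; this is the only consequence of the definition of the topology that is used to enter an open
set.\<close>

lemma weak_topology_nbhd:
  assumes "openin weak_topology_pos U" "\<mu> \<in> U"
  shows "\<exists>F e. finite F \<and> e > 0 \<and> (\<forall>f\<in>F. bdd_cont_pos f) \<and>
    (\<forall>\<nu>\<in>prob_measures_pos. (\<forall>f\<in>F. \<bar>(LINT x|\<nu>. f x) - (LINT x|\<mu>. f x)\<bar> < e) \<longrightarrow> \<nu> \<in> U)"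
proof -
  have "generate_topology_on {{\<mu> \<in> prob_measures_pos. (LINT x|\<mu>. f x) \<in> U} | (f :: real \<Rightarrow> real) U.
        continuous_on {0<..} f \<and> bounded (f ` {0<..}) \<and> open U} U"
    using assms(1) unfolding weak_topology_pos_def by (rule openin_topology_generated_by)
  then show ?thesis using assms(2)
  proof induction
    case Empty
    then show ?case by simp
  next
    case (Int a b)
    obtain F1 e1 where 1: "finite F1" "e1 > 0" "\<forall>f\<in>F1. bdd_cont_pos f"
      "\<forall>\<nu>\<in>prob_measures_pos. (\<forall>f\<in>F1. \<bar>(LINT x|\<nu>. f x) - (LINT x|\<mu>. f x)\<bar> < e1) \<longrightarrow> \<nu> \<in> a"
      using Int by blast
    obtain F2 e2 where 2: "finite F2" "e2 > 0" "\<forall>f\<in>F2. bdd_cont_pos f"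
      "\<forall>\<nu>\<in>prob_measures_pos. (\<forall>f\<in>F2. \<bar>(LINT x|\<nu>. f x) - (LINT x|\<mu>. f x)\<bar> < e2) \<longrightarrow> \<nu> \<in> b"
      using Int by blast
    have "\<nu> \<in> a \<inter> b" if "\<nu> \<in> prob_measures_pos"
      "\<forall>f\<in>F1 \<union> F2. \<bar>(LINT x|\<nu>. f x) - (LINT x|\<mu>. f x)\<bar> < min e1 e2" for \<nu>
      using that 1(4) 2(4) by simp
    then show ?case
      using 1(1-3) 2(1-3) by (intro exI[of _ "F1 \<union> F2"] exI[of _ "min e1 e2"]) auto
  next
    case (UN K)
    then obtain k where k: "k \<in> K" "\<mu> \<in> k" by auto
    from UN.IH[OF this] k(1) show ?case by blast
  next
    case (Basis s)
    then obtain f :: "real \<Rightarrow> real" and V where s: "s = {\<mu> \<in> prob_measures_pos. (LINT x|\<mu>. f x) \<in> V}"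
      and f: "continuous_on {0<..} f" "bounded (f ` {0<..})" and "open V" by auto
    with Basis obtain e where "e > 0" "\<forall>y. dist y (LINT x|\<mu>. f x) < e \<longrightarrow> y \<in> V"
      by (auto simp: open_dist)
    then show ?case
      using f by (intro exI[of _ "{f}"] exI[of _ e]) (auto simp: s bdd_cont_pos_def dist_real_def)
  qed
qed

lemma state_topology_nbhd:
  assumes "openin state_topology U" "(\<mu>, z) \<in> U"
  obtains F e where "finite F" "e > 0" "\<And>f. f \<in> F \<Longrightarrow> bdd_cont_pos f"
    "\<And>\<nu> w. \<nu> \<in> prob_measures_pos \<Longrightarrow> w \<ge> 0 \<Longrightarrow>
       (\<And>f. f \<in> F \<Longrightarrow> \<bar>(LINT x|\<nu>. f x) - (LINT x|\<mu>. f x)\<bar> < e) \<Longrightarrow> \<bar>w - z\<bar> < e \<Longrightarrow> (\<nu>, w) \<in> U"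
proof -
  obtain A B where AB: "openin weak_topology_pos A" "openin (top_of_set {0..}) B" "\<mu> \<in> A" "z \<in> B" "A \<times> B \<subseteq> U"
    using assms(1)[unfolded state_topology_def openin_prod_topology_alt, rule_format, OF assms(2)]
    by (elim exE conjE) (rule that)
  obtain F e where F: "finite F" "e > 0" "\<forall>f\<in>F. bdd_cont_pos f"
    "\<forall>\<nu>\<in>prob_measures_pos. (\<forall>f\<in>F. \<bar>(LINT x|\<nu>. f x) - (LINT x|\<mu>. f x)\<bar> < e) \<longrightarrow> \<nu> \<in> A"
    using weak_topology_nbhd[OF AB(1,3)] by blast
  obtain d where d: "d > 0" "\<And>w. w \<ge> 0 \<Longrightarrow> \<bar>w - z\<bar> < d \<Longrightarrow> w \<in> B"
    using AB(2,4) unfolding openin_euclidean_subtopology_iff by (auto simp: dist_real_def)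
  show ?thesis
    by (rule that[of F "min e d"]) (use F d AB(5) in auto)
qed

section \<open>Countably many coordinates for the state space\<close>

text \<open>A countable family of test functions that determines weak convergence, to be evaluated at \<open>ln x\<close>: the
logarithm turns the half-line into the line, where distribution functions and Helly's theorem are
available. Codes of pairs that are out of order give the zero function, which keeps every member
continuous.\<close>

definition ramp :: "nat \<Rightarrow> real \<Rightarrow> real" where
  "ramp m = (let (q, r) = from_nat m :: rat \<times> rat in
     if q < r then cts_step (of_rat q) (of_rat r) else (\<lambda>_. 0))"

lemma continuous_cts_step: "a < b \<Longrightarrow> continuous_on UNIV (cts_step a b)"
  by (intro uniformly_continuous_imp_continuous cts_step_uniformly_continuous)

lemma continuous_ramp: "continuous_on UNIV (ramp m)"
  by (auto simp: ramp_def of_rat_less Let_def split: prod.splits intro: continuous_cts_step)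

lemma ramp_bounds: "0 \<le> ramp m x" "ramp m x \<le> 1"
  by (auto simp: ramp_def cts_step_def of_rat_less Let_def field_simps split: prod.splits)

lemma bdd_cont_pos_ramp: "bdd_cont_pos (\<lambda>x. ramp m (ln x))"
proof -
  have "continuous_on {0<..} (\<lambda>x::real. ramp m (ln x))"
    by (rule continuous_on_compose2[OF continuous_ramp]) (auto intro!: continuous_intros)
  moreover have "bounded ((\<lambda>x. ramp m (ln x)) ` {0<..})"
    using ramp_bounds[of m] by (auto simp: bounded_iff intro!: exI[of _ 1])
  ultimately show ?thesis by (simp add: bdd_cont_pos_def)
qed

lemma ramp_surj:
  assumes "q \<in> \<rat>" "r \<in> \<rat>" "q < r" obtains m where "ramp m = cts_step q r"
proof -
  obtain q' r' where "q = of_rat q'" "r = of_rat r'" using assms by (auto elim!: Rats_cases)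
  then have "ramp (to_nat (q', r')) = cts_step q r"
    using assms by (simp add: ramp_def of_rat_less)
  with that show ?thesis by blast
qed

text \<open>Coordinates of the state space in \<open>nat \<Rightarrow> real\<close>. Through them the weak topology inherits countability
and measurability properties from a Polish space.\<close>

definition coords :: "real measure \<times> real \<Rightarrow> nat \<Rightarrow> real" where
  "coords p i = (case i of 0 \<Rightarrow> snd p | Suc m \<Rightarrow> (LINT x|fst p. ramp m (ln x)))"

lemma coords_simps [simp]: "coords (\<mu>, z) 0 = z" "coords (\<mu>, z) (Suc m) = (LINT x|\<mu>. ramp m (ln x))"
  by (simp_all add: coords_def)

definition log_image :: "real measure \<Rightarrow> real measure" where
  "log_image \<mu> = distr \<mu> borel ln"

lemma ln_measurable_pos: "ln \<in> borel_measurable borel_pos"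
  unfolding borel_pos_def
  by (intro borel_measurable_continuous_on_restrict) (auto intro!: continuous_intros)

lemma real_distribution_log_image:
  assumes "\<mu> \<in> prob_measures_pos" shows "real_distribution (log_image \<mu>)"
proof -
  interpret prob_space \<mu> using assms prob_measures_posD by auto
  show ?thesis unfolding log_image_def
    using ln_measurable_pos measurable_pos_cong[OF assms] by auto
qed

lemma integral_log_image:
  fixes f :: "real \<Rightarrow> real"
  assumes "\<mu> \<in> prob_measures_pos" "f \<in> borel_measurable borel"
  shows "(LINT y|log_image \<mu>. f y) = (LINT x|\<mu>. f (ln x))"
  unfolding log_image_def
  using ln_measurable_pos measurable_pos_cong[OF assms(1)] assms(2) by (intro integral_distr) auto

text \<open>A ramp from \<open>q\<close> to \<open>r\<close> lies between the indicators of \<open>{..q}\<close> and \<open>{..r}\<close>, so at a continuity point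
of the limit the distribution functions are squeezed by ramps with rational nodes nearby.\<close>

lemma weak_conv_of_ramps:
  assumes N: "\<And>n. real_distribution (N n)" and M: "real_distribution M"
    and ramps: "\<And>m. (\<lambda>n. LINT y|N n. ramp m y) \<longlonglongrightarrow> (LINT y|M. ramp m y)"
  shows "weak_conv_m N M"
  unfolding weak_conv_m_def weak_conv_def
proof (intro allI impI order_tendstoI)
  interpret M: real_distribution M by fact
  interpret N: real_distribution "N n" for n by fact
  fix x u assume cont: "isCont (cdf M) x" and u: "u < cdf M x"
  have "eventually (\<lambda>y. u < cdf M y) (at_left x)"
    using cont u by (intro order_tendstoD(1)[of _ "cdf M x"]) (auto simp: isCont_def filterlim_at_split)
  then obtain y where y: "y < x" "u < cdf M y"
    unfolding eventually_at_left_field by (meson dense)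
  obtain q where q: "q \<in> \<rat>" "y < q" "q < x" using Rats_dense_in_real[OF y(1)] by blast
  obtain r where r: "r \<in> \<rat>" "q < r" "r < x" using Rats_dense_in_real[OF q(3)] by blast
  obtain m where m: "ramp m = cts_step q r" using ramp_surj q r by metis
  have "u < (LINT y|M. ramp m y)"
    using y q r M.cdf_nondecreasing[of y q] M.cdf_cts_step(1)[of q r] by (simp add: m)
  from order_tendstoD(1)[OF ramps this]
  show "eventually (\<lambda>n. u < cdf (N n) x) sequentially"
  proof eventually_elim
    case (elim n)
    then show ?case using q r N.cdf_nondecreasing[of r x n] N.cdf_cts_step(2)[of q r n] by (simp add: m)
  qed
next
  interpret M: real_distribution M by fact
  interpret N: real_distribution "N n" for n by fact
  fix x u assume cont: "isCont (cdf M) x" and u: "cdf M x < u"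
  have "eventually (\<lambda>y. cdf M y < u) (at_right x)"
    using cont u by (intro order_tendstoD(2)[of _ "cdf M x"]) (auto simp: isCont_def filterlim_at_split)
  then obtain y where y: "x < y" "cdf M y < u"
    unfolding eventually_at_right_field by (meson dense)
  obtain r where r: "r \<in> \<rat>" "x < r" "r < y" using Rats_dense_in_real[OF y(1)] by blast
  obtain q where q: "q \<in> \<rat>" "x < q" "q < r" using Rats_dense_in_real[OF r(2)] by blast
  obtain m where m: "ramp m = cts_step q r" using ramp_surj q r by metis
  have "(LINT y|M. ramp m y) < u"
    using y q r M.cdf_nondecreasing[of r y] M.cdf_cts_step(2)[of q r] by (simp add: m)
  from order_tendstoD(2)[OF ramps this]
  show "eventually (\<lambda>n. cdf (N n) x < u) sequentially"
  proof eventually_elim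
    case (elim n)
    then show ?case using q r N.cdf_nondecreasing[of x q n] N.cdf_cts_step(1)[of q r n] by (simp add: m)
  qed
qed

lemma ramps_determine_weak_limits:
  assumes N: "\<And>n. N n \<in> prob_measures_pos" and M: "M \<in> prob_measures_pos"
    and ramps: "\<And>m. (\<lambda>n. LINT x|N n. ramp m (ln x)) \<longlonglongrightarrow> (LINT x|M. ramp m (ln x))"
    and f: "bdd_cont_pos f"
  shows "(\<lambda>n. LINT x|N n. f x) \<longlonglongrightarrow> (LINT x|M. f x)"
proof -
  have [measurable]: "ramp m \<in> borel_measurable borel" for m
    using continuous_ramp by (rule borel_measurable_continuous_onI)
  have wc: "weak_conv_m (\<lambda>n. log_image (N n)) (log_image M)"
    using ramps by (intro weak_conv_of_ramps)
      (simp_all add: real_distribution_log_image N M integral_log_image)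
  obtain B where B: "B > 0" "\<And>x. x > 0 \<Longrightarrow> \<bar>f x\<bar> \<le> B"
    using bdd_cont_pos_bound[OF f] by blast
  have cont: "continuous_on UNIV (\<lambda>y. f (exp y))"
  proof (rule continuous_on_compose2[of "{0<..}" f])
    show "continuous_on {0<..} f" using f by (simp add: bdd_cont_pos_def)
    show "continuous_on UNIV (exp :: real \<Rightarrow> real)" by (intro continuous_intros)
  qed auto
  have "(\<lambda>n. LINT y|log_image (N n). f (exp y)) \<longlonglongrightarrow> (LINT y|log_image M. f (exp y))"
    using B(2)[OF exp_gt_zero] cont
    by (intro weak_conv_imp_integral_bdd_continuous_conv[OF _ _ wc, where B=B])
      (auto simp: real_distribution_log_image N M continuous_on_eq_continuous_at)
  moreover have "(LINT y|log_image \<mu>. f (exp y)) = (LINT x|\<mu>. f x)" if "\<mu> \<in> prob_measures_pos" for \<mu>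
    unfolding integral_log_image[OF that borel_measurable_continuous_onI[OF cont]]
    using prob_measures_posD(3)[OF that] by (intro Bochner_Integration.integral_cong) simp_all
  ultimately show ?thesis using N M by simp
qed

text \<open>Convergence of all coordinates is convergence in the state topology, since an open set is entered
through finitely many test functions.\<close>

lemma eventually_in_open_of_coords:
  assumes U: "openin state_topology U" "p \<in> U" and q: "\<And>n. q n \<in> topspace state_topology"
    and lim: "\<And>i. (\<lambda>n. coords (q n) i) \<longlonglongrightarrow> coords p i"
  shows "eventually (\<lambda>n. q n \<in> U) sequentially"
proof -
  obtain \<mu> z where p: "p = (\<mu>, z)" by (cases p)
  have pU: "(\<mu>, z) \<in> U" and \<mu>: "\<mu> \<in> prob_measures_pos"
    using U p openin_subset[OF U(1)] by auto
  obtain F e where F: "finite F" "e > 0" "\<And>f. f \<in> F \<Longrightarrow> bdd_cont_pos f"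
    "\<And>\<nu> w. \<nu> \<in> prob_measures_pos \<Longrightarrow> w \<ge> 0 \<Longrightarrow>
       (\<And>f. f \<in> F \<Longrightarrow> \<bar>(LINT x|\<nu>. f x) - (LINT x|\<mu>. f x)\<bar> < e) \<Longrightarrow> \<bar>w - z\<bar> < e \<Longrightarrow> (\<nu>, w) \<in> U"
    using state_topology_nbhd[OF U(1) pU] by blast
  have q1: "fst (q n) \<in> prob_measures_pos" "snd (q n) \<ge> 0" for n
    using q[of n] by auto
  have "(\<lambda>n. LINT x|fst (q n). f x) \<longlonglongrightarrow> (LINT x|\<mu>. f x)" if "f \<in> F" for f
  proof (rule ramps_determine_weak_limits[OF q1(1) \<mu> _ F(3)[OF that]])
    show "(\<lambda>n. LINT x|fst (q n). ramp m (ln x)) \<longlonglongrightarrow> (LINT x|\<mu>. ramp m (ln x))" for m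
      using lim[of "Suc m"] by (simp add: coords_def p)
  qed
  then have "eventually (\<lambda>n. \<forall>f\<in>F. \<bar>(LINT x|fst (q n). f x) - (LINT x|\<mu>. f x)\<bar> < e) sequentially"
    using F(1,2) by (intro eventually_ball_finite) (simp_all add: tendsto_iff dist_real_def)
  moreover have "eventually (\<lambda>n. \<bar>snd (q n) - z\<bar> < e) sequentially"
    using tendstoD[OF lim[of 0] F(2)] by (simp add: p dist_real_def coords_def)
  ultimately show ?thesis
  proof eventually_elim
    case (elim n)
    then show ?case using F(4)[of "fst (q n)" "snd (q n)"] q1[of n] by auto
  qed
qed

text \<open>The coordinate map is an embedding. If some point of \<open>U\<close> had no coordinate neighbourhood inside \<open>U\<close>,
points outside \<open>U\<close> could be chosen from a countable neighbourhood base, and their coordinates would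
converge, contradicting the previous lemma.\<close>

lemma open_state_eq_coords_vimage:
  assumes U: "openin state_topology U"
  obtains V where "open V" "U = {p \<in> topspace state_topology. coords p \<in> V}"
proof -
  define \<W> where "\<W> = {W. open W \<and> {p \<in> topspace state_topology. coords p \<in> W} \<subseteq> U}"
  have ex: "\<exists>W\<in>\<W>. coords p \<in> W" if "p \<in> U" for p
  proof (rule ccontr)
    assume no: "\<not> ?thesis"
    obtain A where A: "\<And>n. open (A n)" "\<And>n. coords p \<in> A n"
      "\<And>S. open S \<Longrightarrow> coords p \<in> S \<Longrightarrow> eventually (\<lambda>n. A n \<subseteq> S) sequentially"
      using countable_basis_at_decseq[of "coords p"] by metis
    have "\<exists>q. q \<in> topspace state_topology \<and> coords q \<in> A n \<and> q \<notin> U" for n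
      using no A(1,2)[of n] unfolding \<W>_def by blast
    then obtain q where q: "\<And>n. q n \<in> topspace state_topology" "\<And>n. coords (q n) \<in> A n" "\<And>n. q n \<notin> U"
      by metis
    have "(\<lambda>n. coords (q n)) \<longlonglongrightarrow> coords p"
    proof (rule topological_tendstoI)
      fix S assume "open S" "coords p \<in> S"
      from A(3)[OF this] show "eventually (\<lambda>n. coords (q n) \<in> S) sequentially"
        by eventually_elim (use q(2) in auto)
    qed
    moreover have "isCont (\<lambda>x :: nat \<Rightarrow> real. x i) (coords p)" for i
      by (rule continuous_on_interior[OF continuous_on_product_coordinates]) simp
    ultimately have "(\<lambda>n. coords (q n) i) \<longlonglongrightarrow> coords p i" for i
      by (rule isCont_tendsto_compose[rotated])
    from eventually_in_open_of_coords[OF U that q(1) this] q(3) show False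
      by (simp add: eventually_sequentially)
  qed
  show ?thesis
  proof (rule that[of "\<Union>\<W>"])
    show "open (\<Union>\<W>)" by (auto simp: \<W>_def)
    show "U = {p \<in> topspace state_topology. coords p \<in> \<Union>\<W>}"
      using ex openin_subset[OF U] unfolding \<W>_def by blast
  qed
qed

section \<open>Compactness\<close>

text \<open>A weight that is large near both ends of the half-line; bounding its integral forces tightness.\<close>

definition coercive_pos :: "(real \<Rightarrow> real) \<Rightarrow> bool" where
  "coercive_pos w \<longleftrightarrow> (\<forall>x>0. w x \<ge> 0) \<and> w \<in> borel_measurable borel_pos \<and>
     (\<forall>T. \<exists>s t. 0 < s \<and> s < t \<and> (\<forall>x>0. x \<le> s \<or> x > t \<longrightarrow> w x \<ge> T))"

lemma coercive_tail_bound: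
  assumes w: "coercive_pos w" and R: "R > 0" and e: "e > 0"
  obtains s t where "0 < s" "s < t"
    "\<And>\<nu>. \<nu> \<in> prob_measures_pos \<Longrightarrow> (\<integral>\<^sup>+x. ennreal (w x) \<partial>\<nu>) \<le> ennreal R \<Longrightarrow> measure \<nu> {s<..t} > 1 - e"
proof -
  define T where "T = 2 * R / e"
  have T: "T > 0" using R e by (simp add: T_def)
  obtain s t where st: "0 < s" "s < t" "\<forall>x>0. x \<le> s \<or> x > t \<longrightarrow> w x \<ge> T"
    using w unfolding coercive_pos_def by blast
  show ?thesis
  proof (rule that[OF st(1,2)])
    fix \<nu> assume \<nu>: "\<nu> \<in> prob_measures_pos" and le: "(\<integral>\<^sup>+x. ennreal (w x) \<partial>\<nu>) \<le> ennreal R"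
    interpret prob_space \<nu> using prob_measures_posD[OF \<nu>] by auto
    have wm[measurable]: "w \<in> borel_measurable \<nu>"
      using w measurable_pos_cong[OF \<nu>] by (auto simp: coercive_pos_def)
    have S: "{s<..t} \<in> sets \<nu>" using st prob_measures_posD[OF \<nu>]
      by (auto simp: borel_pos_def sets_restrict_space_iff)
    let ?B = "space \<nu> - {s<..t}"
    have "ennreal T * emeasure \<nu> ?B = (\<integral>\<^sup>+x. ennreal T * indicator ?B x \<partial>\<nu>)"
      using S by (subst nn_integral_cmult_indicator) auto
    also have "\<dots> \<le> (\<integral>\<^sup>+x. ennreal (w x) \<partial>\<nu>)"
    proof (rule nn_integral_mono)
      fix x assume "x \<in> space \<nu>"
      then have "x > 0" using prob_measures_posD(3)[OF \<nu>] by simp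
      then have "T \<le> w x" if "x \<in> ?B" using st(3) that by auto
      then show "ennreal T * indicator ?B x \<le> ennreal (w x)"
        by (cases "x \<in> ?B") (simp_all add: ennreal_leI)
    qed
    also have "\<dots> \<le> ennreal R" by fact
    finally have "T * measure \<nu> ?B \<le> R"
      using T R by (simp add: emeasure_eq_measure ennreal_mult[symmetric])
    then have "measure \<nu> ?B \<le> e / 2" using R e by (simp add: T_def field_simps)
    moreover have "measure \<nu> ?B = 1 - measure \<nu> {s<..t}" using S by (rule prob_compl)
    ultimately show "measure \<nu> {s<..t} > 1 - e" using e by simp
  qed
qed

lemma sets_borel_pos: "A \<in> sets borel_pos \<longleftrightarrow> A \<subseteq> {0<..} \<and> A \<in> sets borel"
  by (auto simp: borel_pos_def sets_restrict_space_iff)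

text \<open>The images under the logarithm form a tight sequence on the line, to which Helly's selection theorem
applies; the limit is transported back by the exponential.\<close>

lemma Prokhorov_sequence:
  assumes w: "coercive_pos w" and N: "\<And>n. N n \<in> prob_measures_pos"
    and le: "\<And>n. (\<integral>\<^sup>+x. ennreal (w x) \<partial>N n) \<le> ennreal R"
  obtains r M where "strict_mono (r :: nat \<Rightarrow> nat)" "M \<in> prob_measures_pos"
    "\<And>m. (\<lambda>n. LINT x|N (r n). ramp m (ln x)) \<longlonglongrightarrow> (LINT x|M. ramp m (ln x))"
proof -
  define R' where "R' = max R 1"
  have le': "(\<integral>\<^sup>+x. ennreal (w x) \<partial>N n) \<le> ennreal R'" for n
    using le[of n] by (rule order_trans) (auto simp: R'_def intro: ennreal_leI)
  have R': "R' > 0" by (simp add: R'_def)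
  have "tight (\<lambda>n. log_image (N n))"
    unfolding tight_def
  proof (intro conjI allI impI)
    show "real_distribution (log_image (N n))" for n using N by (rule real_distribution_log_image)
    fix e :: real assume e: "e > 0"
    obtain s t where st: "0 < s" "s < t"
      "\<And>\<nu>. \<nu> \<in> prob_measures_pos \<Longrightarrow> (\<integral>\<^sup>+x. ennreal (w x) \<partial>\<nu>) \<le> ennreal R' \<Longrightarrow> measure \<nu> {s<..t} > 1 - e"
      using coercive_tail_bound[OF w R' e] by blast
    have "measure (log_image (N n)) {ln s<..ln t} = measure (N n) {s<..t}" for n
      unfolding log_image_def using ln_measurable_pos measurable_pos_cong[OF N] prob_measures_posD(3)[OF N[of n]] st
      by (subst measure_distr) (auto intro!: arg_cong[where f="measure (N n)"])
    then show "\<exists>a b. a < b \<and> (\<forall>n. 1 - e < measure (log_image (N n)) {a<..b})"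
      using st(1,2) st(3)[OF N le'] by (intro exI[of _ "ln s"] exI[of _ "ln t"]) auto
  qed
  from tight_imp_convergent_subsubsequence[OF this strict_mono_id]
  obtain r M where r: "strict_mono (r :: nat \<Rightarrow> nat)" "real_distribution M"
    and wc: "weak_conv_m ((\<lambda>n. log_image (N n)) \<circ> id \<circ> r) M" by auto
  interpret M: real_distribution M by fact
  have [measurable]: "exp \<in> measurable M borel_pos"
    unfolding borel_pos_def by (intro measurable_restrict_space2) auto
  define M' where "M' = distr M borel_pos exp"
  have M': "M' \<in> prob_measures_pos"
    unfolding prob_measures_pos_def M'_def by (auto intro!: M.prob_space_distr)
  have [measurable]: "ramp m \<in> borel_measurable borel" for m
    using continuous_ramp by (rule borel_measurable_continuous_onI)
  show ?thesis
  proof (rule that[OF r(1) M'])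
    fix m
    have "(\<lambda>n. LINT y|log_image (N (r n)). ramp m y) \<longlonglongrightarrow> (LINT y|M. ramp m y)"
      using wc ramp_bounds[of m] continuous_ramp[of m] r(2)
      by (intro weak_conv_imp_integral_bdd_continuous_conv[where B=1])
        (auto simp: real_distribution_log_image N continuous_on_eq_continuous_at comp_def)
    moreover have "(LINT x|M'. ramp m (ln x)) = (LINT y|M. ramp m y)"
      unfolding M'_def using bdd_cont_pos_measurable[OF bdd_cont_pos_ramp[of m]]
      by (subst integral_distr) auto
    ultimately show "(\<lambda>n. LINT x|N (r n). ramp m (ln x)) \<longlonglongrightarrow> (LINT x|M'. ramp m (ln x))"
      by (simp add: integral_log_image N)
  qed
qed

text \<open>Relative compactness of the sets where a coercive weight has bounded integral. The coordinate map
makes the state space second countable, so a countable subfamily covers. If no finite part of it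
sufficed, a sequence of uncovered points would have a limit point that is covered.\<close>

lemma coercive_finite_subcover:
  assumes w: "coercive_pos w" and \<U>: "\<And>U. U \<in> \<U> \<Longrightarrow> openin state_topology U"
    and cover: "topspace state_topology \<subseteq> \<Union>\<U>"
  obtains \<F> where "finite \<F>" "\<F> \<subseteq> \<U>"
    "\<And>\<nu> z. \<nu> \<in> prob_measures_pos \<Longrightarrow> (\<integral>\<^sup>+x. ennreal (w x) \<partial>\<nu>) \<le> ennreal R \<Longrightarrow> 0 \<le> z \<Longrightarrow> z \<le> Z \<Longrightarrow>
       (\<nu>, z) \<in> \<Union>\<F>"
proof -
  have "\<exists>V. open V \<and> U = {p \<in> topspace state_topology. coords p \<in> V}" if "U \<in> \<U>" for U
    using open_state_eq_coords_vimage[OF \<U>[OF that]] by (metis (no_types))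
  then obtain V where V: "\<And>U. U \<in> \<U> \<Longrightarrow> open (V U)"
    "\<And>U. U \<in> \<U> \<Longrightarrow> U = {p \<in> topspace state_topology. coords p \<in> V U}"
    by metis
  obtain \<V> where \<V>: "\<V> \<subseteq> V ` \<U>" "countable \<V>" "\<Union>\<V> = \<Union>(V ` \<U>)"
    using Lindelof[of "V ` \<U>"] V(1) by blast
  obtain \<C> where \<C>: "\<C> \<subseteq> \<U>" "countable \<C>" "\<V> = V ` \<C>"
    using \<V>(1,2) by (meson countable_subset_image)
  have cov: "topspace state_topology \<subseteq> \<Union>\<C>"
  proof
    fix p assume p: "p \<in> topspace state_topology"
    with cover obtain U where "U \<in> \<U>" "p \<in> U" by auto
    then have "coords p \<in> \<Union>\<V>" using V(2) \<V>(3) by blast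
    then obtain U' where "U' \<in> \<C>" "coords p \<in> V U'" using \<C>(3) by auto
    then show "p \<in> \<Union>\<C>" using V(2)[of U'] \<C>(1) p by auto
  qed
  show ?thesis
  proof (cases "\<C> = {}")
    case True
    with cov have "topspace state_topology = {}" by auto
    then show ?thesis using that[of "{}"] by auto
  next
    case False
    define U where "U = from_nat_into \<C>"
    have ran: "range U = \<C>" unfolding U_def using range_from_nat_into[OF False \<C>(2)] .
    have "\<exists>k. \<forall>\<nu> z. \<nu> \<in> prob_measures_pos \<and> (\<integral>\<^sup>+x. ennreal (w x) \<partial>\<nu>) \<le> ennreal R \<and> 0 \<le> z \<and> z \<le> Z \<longrightarrow> (\<nu>, z) \<in> (\<Union>j\<le>k. U j)"
    proof (rule ccontr)
      assume "\<not> ?thesis"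
      then have "\<forall>k. \<exists>\<nu> z. \<nu> \<in> prob_measures_pos \<and> (\<integral>\<^sup>+x. ennreal (w x) \<partial>\<nu>) \<le> ennreal R \<and> 0 \<le> z \<and> z \<le> Z \<and> (\<nu>, z) \<notin> (\<Union>j\<le>k. U j)"
        by blast
      then obtain N z where N: "\<And>k. N k \<in> prob_measures_pos" "\<And>k. (\<integral>\<^sup>+x. ennreal (w x) \<partial>N k) \<le> ennreal R"
        and z: "\<And>k. 0 \<le> z k" "\<And>k. z k \<le> Z" and no: "\<And>k. (N k, z k) \<notin> (\<Union>j\<le>k. U j)"
        by metis
      obtain r M where r: "strict_mono (r :: nat \<Rightarrow> nat)" "M \<in> prob_measures_pos"
        "\<And>m. (\<lambda>n. LINT x|N (r n). ramp m (ln x)) \<longlonglongrightarrow> (LINT x|M. ramp m (ln x))"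
        by (rule Prokhorov_sequence[of w N R, OF w N]) (rule that)
      have "seq_compact {0..Z}" using compact_Icc by (simp add: compact_eq_seq_compact_metric)
      then obtain l s where s: "l \<in> {0..Z}" "strict_mono (s :: nat \<Rightarrow> nat)" "(z \<circ> r \<circ> s) \<longlonglongrightarrow> l"
        using z by (elim seq_compactE[where f="z \<circ> r"]) auto
      define q where "q n = (N (r (s n)), z (r (s n)))" for n
      have "(M, l) \<in> topspace state_topology" using r(2) s(1) by auto
      then obtain j where j: "(M, l) \<in> U j" using cov ran by blast
      have "openin state_topology (U j)" using ran \<C>(1) \<U> by blast
      moreover have "(\<lambda>n. coords (q n) i) \<longlonglongrightarrow> coords (M, l) i" for i
        using s(3) LIMSEQ_subseq_LIMSEQ[OF r(3) s(2)]
        by (cases i) (auto simp: q_def coords_def comp_def)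
      ultimately have "eventually (\<lambda>n. q n \<in> U j) sequentially"
        using N(1) z(1) j by (intro eventually_in_open_of_coords[of "U j" "(M, l)"]) (auto simp: q_def)
      moreover have "eventually (\<lambda>n. n \<ge> j) sequentially" by (rule eventually_ge_at_top)
      ultimately have "eventually (\<lambda>n. False) sequentially"
      proof eventually_elim
        case (elim n)
        have "j \<le> r (s n)" using elim(2) seq_suble[OF strict_mono_o[OF r(1) s(2)], of n] by simp
        then show ?case using elim(1) no[of "r (s n)"] by (auto simp: q_def)
      qed
      then show False by simp
    qed
    then obtain k where k: "\<And>\<nu> z. \<nu> \<in> prob_measures_pos \<Longrightarrow> (\<integral>\<^sup>+x. ennreal (w x) \<partial>\<nu>) \<le> ennreal R \<Longrightarrow> 0 \<le> z \<Longrightarrow> z \<le> Z \<Longrightarrow> (\<nu>, z) \<in> (\<Union>j\<le>k. U j)"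
      by blast
    show ?thesis
      by (rule that[of "U ` {..k}"]) (use ran \<C>(1) k in auto)
  qed
qed

(* keeps \<phi> 1 from being rewritten to \<phi> (Suc 0) *)
declare One_nat_def [simp del]

section \<open>Approximation by continuous test functions\<close>

lemma space_leb_pos [simp]: "space leb_pos = {0<..}"
  by (simp add: leb_pos_def space_restrict_space)

lemma sets_leb_pos [measurable_cong]: "sets leb_pos = sets borel_pos"
  by (simp add: leb_pos_def borel_pos_def sets_restrict_space)

lemma measurable_leb_pos: "f \<in> measurable leb_pos N \<longleftrightarrow> f \<in> measurable borel_pos N"
  using measurable_cong_sets[OF sets_leb_pos refl] by blast

lemma emeasure_leb_pos: "A \<in> sets borel_pos \<Longrightarrow> emeasure leb_pos A = emeasure lborel A"
  by (simp add: leb_pos_def emeasure_restrict_space sets_borel_pos)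

lemma sigma_finite_leb_pos: "sigma_finite_measure leb_pos"
  unfolding leb_pos_def
  by (rule sigma_finite_measure_restrict_space) (auto intro: sigma_finite_lborel)

lemma AE_leb_pos_of_negligible:
  assumes "negligible N" "\<And>x. x > 0 \<Longrightarrow> x \<notin> N \<Longrightarrow> P x"
  shows "AE x in leb_pos. P x"
proof -
  obtain N' where "N' \<in> null_sets lborel" "N \<subseteq> N'"
    using assms(1) unfolding negligible_iff_null_sets null_sets_completion_iff2 by blast
  then have "AE x in lborel. x \<notin> N" by (intro AE_I') auto
  then show ?thesis unfolding leb_pos_def
    by (subst AE_restrict_space_iff) (auto elim!: eventually_mono intro: assms(2))
qed

lemma AE_of_AE_leb_pos:
  assumes "absolutely_continuous leb_pos \<mu>" "\<mu> \<in> prob_measures_pos" "AE x in leb_pos. P x"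
  shows "AE x in \<mu>. P x"
  using absolutely_continuous_AE[OF _ assms(1,3)] prob_measures_posD(2)[OF assms(2)] sets_leb_pos by auto

lemma bounded_measurable_integrable:
  fixes T :: "real \<Rightarrow> real"
  assumes "\<mu> \<in> prob_measures_pos" "T \<in> borel_measurable borel_pos" "\<And>x. x > 0 \<Longrightarrow> \<bar>T x\<bar> \<le> B"
  shows "integrable \<mu> T"
proof -
  interpret prob_space \<mu> using assms prob_measures_posD by auto
  show ?thesis
    using assms(2,3) prob_measures_posD(3)[OF assms(1)]
    by (intro integrable_const_bound[where B=B])
      (auto intro!: AE_I2 simp: measurable_pos_cong[OF assms(1)])
qed

lemma exp_bounded_integral:
  fixes g :: "real \<Rightarrow> real"
  assumes \<mu>: "\<mu> \<in> prob_measures_pos" and g: "g \<in> borel_measurable borel_pos"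
    and B: "\<And>x. x > 0 \<Longrightarrow> \<bar>g x\<bar> \<le> B"
  shows "integrable \<mu> (\<lambda>x. exp (g x))" "(LINT x|\<mu>. exp (g x)) > 0"
proof -
  interpret prob_space \<mu> using \<mu> prob_measures_posD by auto
  show int: "integrable \<mu> (\<lambda>x. exp (g x))"
  proof (rule bounded_measurable_integrable[OF \<mu>])
    show "(\<lambda>x. exp (g x)) \<in> borel_measurable borel_pos" using g by measurable
    show "\<bar>exp (g x)\<bar> \<le> exp B" if "x > 0" for x using B[OF that] by simp
  qed
  have "(LINT x|\<mu>. exp (- B)) \<le> (LINT x|\<mu>. exp (g x))"
    using int B prob_measures_posD(3)[OF \<mu>] by (intro integral_mono) (auto simp: abs_le_iff minus_le_iff)
  then have "exp (- B) \<le> (LINT x|\<mu>. exp (g x))" by (simp add: prob_space)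
  then show "(LINT x|\<mu>. exp (g x)) > 0" using exp_gt_zero[of "- B"] by linarith
qed

lemma nn_integral_truncation_SUP:
  fixes l :: "'a \<Rightarrow> real"
  assumes [measurable]: "l \<in> borel_measurable M"
  shows "(SUP n. \<integral>\<^sup>+x. ennreal (min (real n) (l x)) \<partial>M) = (\<integral>\<^sup>+x. ennreal (l x) \<partial>M)"
proof -
  have "(SUP n. \<integral>\<^sup>+x. ennreal (min (real n) (l x)) \<partial>M) = (\<integral>\<^sup>+x. (SUP n. ennreal (min (real n) (l x))) \<partial>M)"
    by (rule nn_integral_monotone_convergence_SUP[symmetric])
      (auto simp: incseq_def le_fun_def intro!: ennreal_leI)
  also have "(\<lambda>x. SUP n. ennreal (min (real n) (l x))) = (\<lambda>x. ennreal (l x))"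
  proof
    fix x
    obtain n :: nat where n: "l x \<le> real n" using real_arch_simple by blast
    show "(SUP n. ennreal (min (real n) (l x))) = ennreal (l x)"
    proof (rule antisym)
      show "(SUP n. ennreal (min (real n) (l x))) \<le> ennreal (l x)" by (intro SUP_least ennreal_leI) auto
      have "ennreal (l x) = ennreal (min (real n) (l x))" using n by (simp add: min_def)
      also have "\<dots> \<le> (SUP n. ennreal (min (real n) (l x)))" by (rule SUP_upper) simp
      finally show "ennreal (l x) \<le> (SUP n. ennreal (min (real n) (l x)))" .
    qed
  qed
  finally show ?thesis .
qed

lemma bounded_convergence:
  fixes T :: "real \<Rightarrow> real"
  assumes \<mu>: "\<mu> \<in> prob_measures_pos"
    and T: "T \<in> borel_measurable borel_pos" "\<And>j. g j \<in> borel_measurable borel_pos"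
    and bd: "\<And>j x. x > 0 \<Longrightarrow> \<bar>g j x\<bar> \<le> B"
    and lim: "AE x in \<mu>. (\<lambda>j. g j x) \<longlonglongrightarrow> T x"
  shows "(\<lambda>j. LINT x|\<mu>. g j x) \<longlonglongrightarrow> (LINT x|\<mu>. T x)"
proof -
  interpret prob_space \<mu> using \<mu> prob_measures_posD by auto
  show ?thesis
    using T bd lim prob_measures_posD(3)[OF \<mu>]
    by (intro integral_dominated_convergence[where w="\<lambda>_. B"])
      (auto intro!: AE_I2 simp: measurable_pos_cong[OF \<mu>])
qed

text \<open>A Lebesgue measurable function is an almost everywhere limit of continuous ones. Clipping these at
the bound of \<open>T\<close> allows dominated convergence under both absolutely continuous measures at once.\<close>

lemma bounded_measurable_approx:
  assumes \<mu>: "\<mu> \<in> prob_measures_pos" "absolutely_continuous leb_pos \<mu>"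
    and \<rho>: "\<rho> \<in> prob_measures_pos" "absolutely_continuous leb_pos \<rho>"
    and T: "T \<in> borel_measurable borel_pos" "\<And>x. x > 0 \<Longrightarrow> \<bar>T x\<bar> \<le> R"
  obtains g where "\<And>j. bdd_cont_pos (g j)" "(\<lambda>j. LINT x|\<mu>. g j x) \<longlonglongrightarrow> (LINT x|\<mu>. T x)"
    "(\<lambda>j. LINT x|\<rho>. exp (g j x)) \<longlonglongrightarrow> (LINT x|\<rho>. exp (T x))"
proof -
  define T' where "T' x = indicator {0<..} x * T x" for x
  have "T' \<in> borel_measurable borel"
    using T(1) unfolding borel_pos_def T'_def
    by (subst (asm) borel_measurable_restrict_space_iff) (auto simp: mult.commute)
  then have "T' \<in> borel_measurable lebesgue"
    by (auto intro: measurable_completion)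
  then have "T' measurable_on UNIV"
    by (intro lebesgue_measurable_imp_measurable_on) auto
  then obtain N h where N: "negligible N" "\<And>j. continuous_on UNIV (h j)"
    "\<And>x. x \<notin> N \<Longrightarrow> (\<lambda>j. h j x) \<longlonglongrightarrow> T' x"
    unfolding measurable_on_def by auto
  define g where "g j x = max (- R) (min R (h j x))" for j :: nat and x
  have R: "R \<ge> 0" using T(2)[of 1] by auto
  have gcont: "continuous_on UNIV (g j)" for j
    unfolding g_def using N(2) by (intro continuous_intros)
  have gbd: "\<bar>g j x\<bar> \<le> R" for j x using R by (auto simp: g_def)
  have lim: "AE x in leb_pos. (\<lambda>j. g j x) \<longlonglongrightarrow> T x"
  proof (rule AE_leb_pos_of_negligible[OF N(1)])
    fix x :: real assume x: "x > 0" "x \<notin> N"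
    have "(\<lambda>j. g j x) \<longlonglongrightarrow> max (- R) (min R (T' x))"
      unfolding g_def by (intro tendsto_intros N(3) x)
    moreover have "max (- R) (min R (T' x)) = T x"
      using T(2)[OF x(1)] x by (auto simp: T'_def)
    ultimately show "(\<lambda>j. g j x) \<longlonglongrightarrow> T x" by simp
  qed
  have gb: "bdd_cont_pos (g j)" for j
    using gcont[of j] gbd[of j] unfolding bdd_cont_pos_def bounded_iff
    by (auto intro: continuous_on_subset)
  note gm = bdd_cont_pos_measurable[OF gb]
  show ?thesis
  proof (rule that[OF gb])
    show "(\<lambda>j. LINT x|\<mu>. g j x) \<longlonglongrightarrow> (LINT x|\<mu>. T x)"
      by (rule bounded_convergence[OF \<mu>(1) T(1) gm gbd AE_of_AE_leb_pos[OF \<mu>(2,1) lim]])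
    show "(\<lambda>j. LINT x|\<rho>. exp (g j x)) \<longlonglongrightarrow> (LINT x|\<rho>. exp (T x))"
    proof (rule bounded_convergence[OF \<rho>(1)])
      show "(\<lambda>x. exp (T x)) \<in> borel_measurable borel_pos" "(\<lambda>x. exp (g j x)) \<in> borel_measurable borel_pos" for j
        using T(1) gm[of j] by measurable
      show "\<bar>exp (g j x)\<bar> \<le> exp R" for j x using gbd[of j x] by simp
      show "AE x in \<rho>. (\<lambda>j. exp (g j x)) \<longlonglongrightarrow> exp (T x)"
        using AE_of_AE_leb_pos[OF \<rho>(2,1) lim] by eventually_elim (rule tendsto_exp)
    qed
  qed
qed

text \<open>If \<open>\<mu>\<close> charges a \<open>\<rho>\<close>-null set, it charges a compact one \<open>K\<close> by inner regularity. A steep continuous bump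
of height \<open>t\<close> on \<open>K\<close> has \<open>\<mu>\<close>-integral at least \<open>t * \<mu> K\<close>, while its exponential has \<open>\<rho>\<close>-integral close to
one, so the variational functional is unbounded.\<close>

lemma variational_singular:
  assumes \<mu>: "\<mu> \<in> prob_measures_pos" and \<rho>: "\<rho> \<in> prob_measures_pos"
    and N: "N \<in> null_sets \<rho>" "N \<notin> null_sets \<mu>"
  obtains g where "bdd_cont_pos g" "(LINT x|\<mu>. g x) - ln (LINT x|\<rho>. exp (g x)) > r"
proof -
  interpret M: prob_space \<mu> using \<mu> prob_measures_posD by auto
  interpret L: prob_space \<rho> using \<rho> prob_measures_posD by auto
  have Ns: "N \<in> sets borel_pos" using N(1) prob_measures_posD(2)[OF \<rho>] by auto
  then have Npos: "emeasure \<mu> N > 0"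
    using N(2) prob_measures_posD(2)[OF \<mu>] by (auto simp: null_sets_def zero_less_iff_neq_zero)
  have idm: "(\<lambda>x. x) \<in> borel_measurable \<mu>"
    unfolding measurable_pos_cong[OF \<mu>] borel_pos_def by (intro measurable_restrict_space1) simp
  define D where "D = distr \<mu> borel (\<lambda>x. x)"
  have D: "emeasure D B = emeasure \<mu> (B \<inter> {0<..})" if "B \<in> sets borel" for B
    unfolding D_def using idm that prob_measures_posD(3)[OF \<mu>]
    by (subst emeasure_distr) (auto intro!: arg_cong[where f="emeasure \<mu>"])
  have DN: "emeasure D N = emeasure \<mu> N"
    using D[of N] Ns by (auto simp: sets_borel_pos Int_absorb2)
  have "emeasure D N = (SUP K\<in>{K. K \<subseteq> N \<and> compact K}. emeasure D K)"
  proof (rule inner_regular)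
    show "sets D = sets borel" by (simp add: D_def)
    show "emeasure D (space D) \<noteq> \<infinity>" using M.emeasure_finite D[of UNIV] by (simp add: D_def)
    show "N \<in> sets borel" using Ns by (simp add: sets_borel_pos)
  qed
  then obtain K where K: "K \<subseteq> N" "compact K" "emeasure D K > 0"
    using Npos unfolding DN by (auto simp: less_SUP_iff)
  have Ksub: "K \<subseteq> {0<..}" using K(1) Ns by (auto simp: sets_borel_pos)
  have Kb: "K \<in> sets borel" using K(2) by (simp add: compact_imp_closed borel_closed)
  then have Ks: "K \<in> sets borel_pos" using Ksub by (simp add: sets_borel_pos)
  have K\<mu>: "measure \<mu> K > 0"
    using K(3) D[OF Kb] Ksub by (simp add: Int_absorb2 M.emeasure_eq_measure)
  have Kne: "K \<noteq> {}" using K(3) by auto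
  have K\<rho>: "AE x in \<rho>. x \<notin> K"
    using N(1) K(1) by (intro AE_I'[of N]) auto
  \<comment> \<open>makes \<open>t * \<mu> K\<close> exceed \<open>r\<close> by at least one\<close>
  define t where "t = (\<bar>r\<bar> + 1) / measure \<mu> K"
  have t: "t > 0" using K\<mu> by (simp add: t_def)
  define g where "g j x = t * max 0 (1 - real j * infdist x K)" for j :: nat and x
  have gcont: "continuous_on UNIV (g j)" for j
    unfolding g_def by (intro continuous_intros)
  have gbd: "\<bar>g j x\<bar> \<le> t" for j x
    using t infdist_nonneg[of x K] by (auto simp: g_def abs_mult)
  have gb: "bdd_cont_pos (g j)" for j
    using gcont[of j] gbd[of j] unfolding bdd_cont_pos_def bounded_iff
    by (auto intro: continuous_on_subset)
  have "(\<lambda>j. LINT x|\<rho>. exp (g j x)) \<longlonglongrightarrow> (LINT x|\<rho>. (1::real))"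
  proof (rule bounded_convergence[OF \<rho>])
    show "(\<lambda>x. exp (g j x)) \<in> borel_measurable borel_pos" for j
      using bdd_cont_pos_measurable[OF gb[of j]] by measurable
    show "\<bar>exp (g j x)\<bar> \<le> exp t" for j x using gbd[of j x] by simp
    show "AE x in \<rho>. (\<lambda>j. exp (g j x)) \<longlonglongrightarrow> 1"
      using K\<rho>
    proof eventually_elim
      case (elim x)
      then have d: "infdist x K > 0"
        using in_closed_iff_infdist_zero[OF compact_imp_closed[OF K(2)] Kne] infdist_nonneg[of x K]
        by (metis order_le_less)
      obtain j0 :: nat where j0: "1 / infdist x K < real j0" using reals_Archimedean2 by blast
      have "eventually (\<lambda>j. exp (g j x) = 1) sequentially"
        using eventually_ge_at_top[of j0]
      proof eventually_elim
        case (elim j)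
        then have "1 / infdist x K < real j" using j0 by linarith
        then have "1 - real j * infdist x K \<le> 0" using d by (simp add: field_simps)
        then show ?case by (simp add: g_def)
      qed
      then show ?case by (rule tendsto_eventually)
    qed
  qed simp
  then have "(\<lambda>j. ln (LINT x|\<rho>. exp (g j x))) \<longlonglongrightarrow> ln 1"
    by (intro tendsto_ln) (simp_all add: L.prob_space)
  then have "eventually (\<lambda>j. ln (LINT x|\<rho>. exp (g j x)) < 1) sequentially"
    by (rule order_tendstoD) simp
  then obtain j where j: "ln (LINT x|\<rho>. exp (g j x)) < 1"
    unfolding eventually_sequentially by blast
  have "\<bar>r\<bar> + 1 = t * measure \<mu> K" using K\<mu> by (simp add: t_def)
  also have "\<dots> = (LINT x|\<mu>. t * indicator K x)"
    using Ks prob_measures_posD(2)[OF \<mu>] Ksub prob_measures_posD(3)[OF \<mu>] by (simp add: Int_absorb2)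
  also have "\<dots> \<le> (LINT x|\<mu>. g j x)"
  proof (rule integral_mono)
    show "integrable \<mu> (\<lambda>x. t * indicator K x)"
      using Ks prob_measures_posD(2)[OF \<mu>] by (simp add: M.emeasure_eq_measure less_top[symmetric])
    show "integrable \<mu> (g j)" by (rule bdd_cont_pos_integrable[OF \<mu> gb])
    show "t * indicator K x \<le> g j x" for x
      using t by (auto simp: g_def split: split_indicator)
  qed
  finally show ?thesis using that[OF gb[of j]] j by linarith
qed

section \<open>Lebesgue densities and entropy\<close>

definition lebd :: "real measure \<Rightarrow> real \<Rightarrow> real" where
  "lebd \<mu> x = enn2real (RN_deriv leb_pos \<mu> x)"

lemma lebd_nonneg [simp]: "lebd \<mu> x \<ge> 0" by (simp add: lebd_def)

lemma lebd_measurable [measurable]: "lebd \<mu> \<in> borel_measurable leb_pos"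
  unfolding lebd_def by measurable

lemma density_lebd:
  assumes "\<mu> \<in> prob_measures_pos" "absolutely_continuous leb_pos \<mu>"
  shows "density leb_pos (\<lambda>x. ennreal (lebd \<mu> x)) = \<mu>"
proof -
  interpret sigma_finite_measure leb_pos by (rule sigma_finite_leb_pos)
  interpret M: prob_space \<mu> using assms prob_measures_posD by auto
  have s: "sets \<mu> = sets leb_pos" using prob_measures_posD(2)[OF assms(1)] sets_leb_pos by simp
  have "AE x in leb_pos. RN_deriv leb_pos \<mu> x \<noteq> \<infinity>"
    using RN_deriv_finite[OF _ assms(2) s] M.sigma_finite_measure_axioms by auto
  then have "AE x in leb_pos. ennreal (lebd \<mu> x) = RN_deriv leb_pos \<mu> x"
    by eventually_elim (simp add: lebd_def less_top[symmetric])
  then have "density leb_pos (\<lambda>x. ennreal (lebd \<mu> x)) = density leb_pos (RN_deriv leb_pos \<mu>)"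
    by (intro density_cong) auto
  also have "\<dots> = \<mu>" by (rule density_RN_deriv[OF assms(2) s])
  finally show ?thesis .
qed

lemma lebd_pos_AE:
  assumes "\<mu> \<in> prob_measures_pos" "absolutely_continuous leb_pos \<mu>"
  shows "AE x in \<mu>. lebd \<mu> x > 0"
proof -
  have "AE x in density leb_pos (\<lambda>x. ennreal (lebd \<mu> x)). lebd \<mu> x > 0"
    by (subst AE_density) auto
  then show ?thesis unfolding density_lebd[OF assms] .
qed

lemma nn_integral_lebd:
  assumes "\<mu> \<in> prob_measures_pos" "absolutely_continuous leb_pos \<mu>" "f \<in> borel_measurable leb_pos"
  shows "(\<integral>\<^sup>+x. f x \<partial>\<mu>) = (\<integral>\<^sup>+x. ennreal (lebd \<mu> x) * f x \<partial>leb_pos)"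
  using assms(3) by (subst density_lebd[OF assms(1,2), symmetric]) (simp add: nn_integral_density)

lemma diff_entropy_eq:
  assumes "\<mu> \<in> prob_measures_pos" "absolutely_continuous leb_pos \<mu>"
  shows "diff_entropy \<mu> = enn2ereal (\<integral>\<^sup>+x. ennreal (- ln (lebd \<mu> x)) \<partial>\<mu>)
    - enn2ereal (\<integral>\<^sup>+x. ennreal (ln (lebd \<mu> x)) \<partial>\<mu>)"
  unfolding diff_entropy_def Let_def lebd_def[symmetric]
  using assms by (simp add: nn_integral_lebd ennreal_mult'[symmetric])

text \<open>The function \<open>t \<mapsto> - t ln t - c t\<close> is maximal at \<open>t = exp (- c - 1)\<close>. With \<open>c = \<phi> 1 x\<close> this controls the
entropy integral from above.\<close>

lemma neg_xlnx_le:
  fixes t c :: real assumes "t \<ge> 0" "c \<ge> 0"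
  shows "- (t * ln t) \<le> t * c + exp (- c)"
proof (cases "t = 0")
  case False
  then have t: "t > 0" using assms by simp
  have "ln (exp (- c) / t) \<le> exp (- c) / t - 1"
    using t by (intro ln_le_minus_one) simp
  then have "- c - ln t \<le> exp (- c) / t - 1" using t by (simp add: ln_div)
  then have "t * (- c - ln t) \<le> t * (exp (- c) / t - 1)" using t by (intro mult_left_mono) auto
  then show ?thesis using t by (simp add: algebra_simps)
qed auto

locale moment_functions =
  fixes k :: nat and \<phi> :: "nat \<Rightarrow> real \<Rightarrow> real"
  assumes k: "k \<ge> 2"
    and pos: "\<And>i x. i \<in> {1..k} \<Longrightarrow> x > 0 \<Longrightarrow> \<phi> i x > 0"
    and diff: "\<And>i x. i \<in> {1..k} \<Longrightarrow> x > 0 \<Longrightarrow> \<phi> i differentiable (at x)"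
    and mono: "\<And>i. i \<in> {1..k} \<Longrightarrow> mono_on {0<..} (\<phi> i)"
    and lim: "\<And>i. i \<in> {1..k} \<Longrightarrow> filterlim (\<phi> i) at_top at_top"
    and C2: "\<And>i c. i \<in> {1..k} \<Longrightarrow> c > 0 \<Longrightarrow>
      set_integrable lborel {0<..} (\<lambda>x. exp (- c * \<phi> i x))"
    and C3: "\<exists>\<kappa>>1. \<forall>i\<in>{1..k-1}. eventually (\<lambda>x. \<phi> i x powr \<kappa> < \<phi> (i + 1) x) at_top"
    and C4: "\<exists>C>0. \<exists>M>0. \<forall>x>C. \<forall>i\<in>{1..k}.
      1 / C * \<phi> i x powr (- M) < deriv (\<phi> i) x \<and> deriv (\<phi> i) x < C * \<phi> i x powr M"
begin

lemma one_in: "1 \<in> {1..k}" and k_in: "k \<in> {1..k}" using k by auto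

lemma cont: "i \<in> {1..k} \<Longrightarrow> continuous_on {0<..} (\<phi> i)"
  using diff by (intro continuous_at_imp_continuous_on) (auto intro: differentiable_imp_continuous_within)

lemma phi_measurable: "i \<in> {1..k} \<Longrightarrow> \<phi> i \<in> borel_measurable borel_pos"
  unfolding borel_pos_def by (intro borel_measurable_continuous_on_restrict cont)

lemma phi1_measurable [measurable]: "\<phi> 1 \<in> borel_measurable leb_pos"
  using phi_measurable[OF one_in] by (simp only: measurable_leb_pos)

definition Z :: real where "Z = (LINT y|leb_pos. exp (- \<phi> 1 y))"

lemma exp_phi1_integrable: "integrable leb_pos (\<lambda>x. exp (- \<phi> 1 x))"
  using C2[OF one_in, of 1] unfolding leb_pos_def set_integrable_def
  by (subst integrable_restrict_space) auto

lemma Z_pos: "Z > 0"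
proof -
  have "Z \<ge> 0" unfolding Z_def by (intro integral_nonneg_AE) auto
  moreover have "Z \<noteq> 0"
  proof
    assume "Z = 0"
    then have "AE x in leb_pos. exp (- \<phi> 1 x) = 0"
      unfolding Z_def using exp_phi1_integrable by (subst (asm) integral_nonneg_eq_0_iff_AE) auto
    then have "AE x in leb_pos. False" by simp
    then have "emeasure leb_pos (space leb_pos) = 0"
      using AE_iff_measurable[OF sets.top, of leb_pos "\<lambda>_. False"] by (simp add: greaterThan_def)
    moreover have "emeasure leb_pos {0<..<1} = 1"
      by (subst emeasure_leb_pos) (auto simp: sets_borel_pos)
    moreover have "emeasure leb_pos {0<..<1} \<le> emeasure leb_pos (space leb_pos)"
      by (rule emeasure_space)
    ultimately show False by simp
  qed
  ultimately show ?thesis by simp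
qed

lemma nn_integral_exp_phi1: "(\<integral>\<^sup>+x. ennreal (exp (- \<phi> 1 x)) \<partial>leb_pos) = ennreal Z"
  unfolding Z_def by (rule nn_integral_eq_integral[OF exp_phi1_integrable]) auto

lemma gibbs_eq: "gibbs \<phi> = density leb_pos (\<lambda>x. ennreal (exp (- \<phi> 1 x) / Z))"
  by (simp add: gibbs_def Z_def)

lemma nn_integral_gibbs:
  assumes "f \<in> borel_measurable leb_pos"
  shows "(\<integral>\<^sup>+x. f x \<partial>gibbs \<phi>) = (\<integral>\<^sup>+x. ennreal (exp (- \<phi> 1 x) / Z) * f x \<partial>leb_pos)"
  unfolding gibbs_eq using assms by (subst nn_integral_density) auto

lemma gibbs_prob: "gibbs \<phi> \<in> prob_measures_pos"
proof -
  have "emeasure (gibbs \<phi>) (space (gibbs \<phi>)) = (\<integral>\<^sup>+x. 1 \<partial>gibbs \<phi>)" by simp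
  also have "\<dots> = (\<integral>\<^sup>+x. ennreal (1 / Z) * ennreal (exp (- \<phi> 1 x)) \<partial>leb_pos)"
    using Z_pos by (subst nn_integral_gibbs) (auto simp: ennreal_mult[symmetric] intro!: nn_integral_cong)
  also have "\<dots> = ennreal (1 / Z) * ennreal Z"
    by (subst nn_integral_cmult) (auto simp: nn_integral_exp_phi1[simplified])
  also have "\<dots> = 1" using Z_pos by (simp add: ennreal_mult[symmetric])
  finally have "prob_space (gibbs \<phi>)" by (rule prob_spaceI)
  then show ?thesis
    by (simp add: prob_measures_pos_def gibbs_eq sets_leb_pos)
qed

lemma gibbs_ac: "absolutely_continuous leb_pos (gibbs \<phi>)"
  unfolding gibbs_eq by (intro absolutely_continuousI_density) measurable

lemma moment_finite:
  assumes \<mu>: "\<mu> \<in> prob_measures_pos" and i: "i \<in> {1..k}" and m: "moment (\<phi> i) \<mu> = ereal m"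
  shows "integrable \<mu> (\<phi> i)" "(LINT x|\<mu>. \<phi> i x) = m" "m \<ge> 0"
    "(\<integral>\<^sup>+x. ennreal (\<phi> i x) \<partial>\<mu>) = ennreal m"
proof -
  have "ereal m \<ge> 0" unfolding m[symmetric] moment_def by simp
  then show 1: "m \<ge> 0" by simp
  show 2: "(\<integral>\<^sup>+x. ennreal (\<phi> i x) \<partial>\<mu>) = ennreal m"
    using m 1 unfolding moment_def by (metis e2ennreal_enn2ereal e2ennreal_ereal ennreal_def e2ennreal_def ereal_max_0 max_def)
  have meas: "\<phi> i \<in> borel_measurable \<mu>"
    using phi_measurable[OF i] by (simp add: measurable_pos_cong[OF \<mu>])
  have nn: "AE x in \<mu>. 0 \<le> \<phi> i x"
    using pos[OF i] prob_measures_posD(3)[OF \<mu>] by (auto intro!: AE_I2 less_imp_le)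
  show "integrable \<mu> (\<phi> i)" using meas nn 2 by (intro integrableI_nonneg) auto
  show "(LINT x|\<mu>. \<phi> i x) = m"
    using 1 2 by (subst integral_eq_nn_integral[OF meas nn]) simp
qed

lemma neg_part_finite:
  assumes \<mu>: "\<mu> \<in> prob_measures_pos" "absolutely_continuous leb_pos \<mu>" and m: "moment (\<phi> 1) \<mu> = ereal m"
  shows "(\<integral>\<^sup>+x. ennreal (- ln (lebd \<mu> x)) \<partial>\<mu>) \<le> ennreal (m + Z)"
proof -
  have "(\<integral>\<^sup>+x. ennreal (- ln (lebd \<mu> x)) \<partial>\<mu>) = (\<integral>\<^sup>+x. ennreal (- (lebd \<mu> x * ln (lebd \<mu> x))) \<partial>leb_pos)"
    by (simp add: nn_integral_lebd[OF \<mu>] ennreal_mult'[symmetric])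
  also have "\<dots> \<le> (\<integral>\<^sup>+x. ennreal (lebd \<mu> x) * ennreal (\<phi> 1 x) + ennreal (exp (- \<phi> 1 x)) \<partial>leb_pos)"
  proof (rule nn_integral_mono)
    fix x assume "x \<in> space leb_pos"
    then have p: "\<phi> 1 x > 0" using pos[OF one_in] by simp
    have "ennreal (- (lebd \<mu> x * ln (lebd \<mu> x))) \<le> ennreal (lebd \<mu> x * \<phi> 1 x + exp (- \<phi> 1 x))"
      using neg_xlnx_le[of "lebd \<mu> x" "\<phi> 1 x"] p by (intro ennreal_leI) simp
    also have "\<dots> = ennreal (lebd \<mu> x) * ennreal (\<phi> 1 x) + ennreal (exp (- \<phi> 1 x))"
      using p by (simp add: ennreal_plus ennreal_mult)
    finally show "ennreal (- (lebd \<mu> x * ln (lebd \<mu> x))) \<le> ennreal (lebd \<mu> x) * ennreal (\<phi> 1 x) + ennreal (exp (- \<phi> 1 x))" .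
  qed
  also have "\<dots> = (\<integral>\<^sup>+x. ennreal (\<phi> 1 x) \<partial>\<mu>) + ennreal Z"
    by (subst nn_integral_add) (auto simp: nn_integral_lebd[OF \<mu>] nn_integral_exp_phi1[simplified])
  also have "\<dots> = ennreal (m + Z)"
    using moment_finite[OF \<mu>(1) one_in m] Z_pos by (simp add: ennreal_plus)
  finally show ?thesis .
qed

lemma finite_entropy:
  assumes \<mu>: "\<mu> \<in> prob_measures_pos" and m: "moment (\<phi> 1) \<mu> = ereal m" and h: "diff_entropy \<mu> \<noteq> - \<infinity>"
  shows "absolutely_continuous leb_pos \<mu>" "integrable \<mu> (\<lambda>x. ln (lebd \<mu> x))"
    "diff_entropy \<mu> = ereal (- (LINT x|\<mu>. ln (lebd \<mu> x)))" "diff_entropy \<mu> \<le> ereal (m + Z)"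
proof -
  show ac: "absolutely_continuous leb_pos \<mu>"
    using h by (auto simp: diff_entropy_def split: if_splits)
  define N where "N = (\<integral>\<^sup>+x. ennreal (- ln (lebd \<mu> x)) \<partial>\<mu>)"
  define P where "P = (\<integral>\<^sup>+x. ennreal (ln (lebd \<mu> x)) \<partial>\<mu>)"
  have heq: "diff_entropy \<mu> = enn2ereal N - enn2ereal P"
    unfolding N_def P_def by (rule diff_entropy_eq[OF \<mu> ac])
  have mm: "m \<ge> 0" using moment_finite[OF \<mu> one_in m] by simp
  have N: "N \<le> ennreal (m + Z)"
    unfolding N_def by (rule neg_part_finite[OF \<mu> ac m])
  then have Nfin: "N < \<top>" using le_less_trans ennreal_less_top by blast
  have Pfin: "P < \<top>"
  proof (rule ccontr)
    assume "\<not> P < \<top>"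
    then have "P = \<top>" by (simp add: less_top[symmetric])
    then show False using h heq Nfin by (cases N) auto
  qed
  have meas: "(\<lambda>x. ln (lebd \<mu> x)) \<in> borel_measurable \<mu>"
    unfolding measurable_pos_cong[OF \<mu>] measurable_leb_pos[symmetric] by measurable
  show int: "integrable \<mu> (\<lambda>x. ln (lebd \<mu> x))"
    unfolding real_integrable_def using meas Nfin Pfin by (auto simp: N_def P_def)
  obtain n p where np: "N = ennreal n" "n \<ge> 0" "P = ennreal p" "p \<ge> 0"
    using Nfin Pfin by (cases N; cases P) auto
  have "(LINT x|\<mu>. ln (lebd \<mu> x)) = p - n"
    using np unfolding real_lebesgue_integral_def[OF int] N_def[symmetric] P_def[symmetric] by simp
  then show "diff_entropy \<mu> = ereal (- (LINT x|\<mu>. ln (lebd \<mu> x)))"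
    by (simp add: heq np)
  have "n \<le> m + Z" using N np mm Z_pos by (simp del: ennreal_plus)
  then show "diff_entropy \<mu> \<le> ereal (m + Z)" using np by (simp add: heq)
qed

section \<open>The variational lower bound for relative entropy\<close>

text \<open>The logarithm of the density of \<open>\<mu>\<close> with respect to the reference law, clipped to \<open>[- n, n]\<close>; a zero
of the density needs its own case because \<open>ln 0 = 0\<close> by convention. These are the nearly optimal test
functions in the variational formula for relative entropy.\<close>

definition clip_ld :: "real measure \<Rightarrow> nat \<Rightarrow> real \<Rightarrow> real" where
  "clip_ld \<mu> n x = (if lebd \<mu> x = 0 then - real n
     else max (- real n) (min (real n) (ln (lebd \<mu> x) + \<phi> 1 x + ln Z)))"

lemma clip_ld_measurable: "clip_ld \<mu> n \<in> borel_measurable borel_pos"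
  unfolding measurable_leb_pos[symmetric] clip_ld_def by measurable

lemma clip_ld_bound: "\<bar>clip_ld \<mu> n x\<bar> \<le> real n"
  by (auto simp: clip_ld_def)

text \<open>The exponential exceeds the density by at most \<open>exp (- n)\<close>, and a density integrates to one.\<close>

lemma exp_clip_ld:
  assumes \<mu>: "\<mu> \<in> prob_measures_pos" "absolutely_continuous leb_pos \<mu>"
  shows "(LINT x|gibbs \<phi>. exp (clip_ld \<mu> n x)) \<le> 1 + exp (- real n)"
proof -
  interpret M: prob_space \<mu> using \<mu> prob_measures_posD by auto
  interpret G: prob_space "gibbs \<phi>" using gibbs_prob prob_measures_posD by auto
  have [measurable]: "clip_ld \<mu> n \<in> borel_measurable leb_pos"
    unfolding measurable_leb_pos by (rule clip_ld_measurable)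
  have le: "exp (clip_ld \<mu> n x) \<le> Z * exp (\<phi> 1 x) * lebd \<mu> x + exp (- real n)" for x
  proof (cases "lebd \<mu> x = 0")
    case False
    then have l: "lebd \<mu> x > 0" using lebd_nonneg[of \<mu> x] by linarith
    have e: "exp (ln (lebd \<mu> x) + \<phi> 1 x + ln Z) = Z * exp (\<phi> 1 x) * lebd \<mu> x"
      using l Z_pos by (simp add: exp_add)
    have "clip_ld \<mu> n x \<le> ln (lebd \<mu> x) + \<phi> 1 x + ln Z \<or> clip_ld \<mu> n x \<le> - real n"
      using False by (auto simp: clip_ld_def)
    then have "exp (clip_ld \<mu> n x) \<le> Z * exp (\<phi> 1 x) * lebd \<mu> x \<or> exp (clip_ld \<mu> n x) \<le> exp (- real n)"
      unfolding e[symmetric] by simp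
    moreover have "Z * exp (\<phi> 1 x) * lebd \<mu> x \<ge> 0" using Z_pos by simp
    ultimately show ?thesis using exp_gt_zero[of "- real n"] by linarith
  qed (simp add: clip_ld_def)
  have "(\<integral>\<^sup>+x. ennreal (exp (clip_ld \<mu> n x)) \<partial>gibbs \<phi>)
      \<le> (\<integral>\<^sup>+x. ennreal (Z * exp (\<phi> 1 x) * lebd \<mu> x) + ennreal (exp (- real n)) \<partial>gibbs \<phi>)"
  proof (rule nn_integral_mono)
    fix x
    have "ennreal (exp (clip_ld \<mu> n x)) \<le> ennreal (Z * exp (\<phi> 1 x) * lebd \<mu> x + exp (- real n))"
      by (rule ennreal_leI[OF le])
    also have "\<dots> = ennreal (Z * exp (\<phi> 1 x) * lebd \<mu> x) + ennreal (exp (- real n))"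
      using Z_pos by (simp add: ennreal_plus)
    finally show "ennreal (exp (clip_ld \<mu> n x)) \<le> ennreal (Z * exp (\<phi> 1 x) * lebd \<mu> x) + ennreal (exp (- real n))" .
  qed
  also have "\<dots> = (\<integral>\<^sup>+x. ennreal (Z * exp (\<phi> 1 x) * lebd \<mu> x) \<partial>gibbs \<phi>) + ennreal (exp (- real n))"
  proof (subst nn_integral_add)
    show "(\<lambda>x. ennreal (Z * exp (\<phi> 1 x) * lebd \<mu> x)) \<in> borel_measurable (gibbs \<phi>)"
      unfolding gibbs_eq by measurable
  qed (auto simp: G.emeasure_space_1)
  also have "(\<integral>\<^sup>+x. ennreal (Z * exp (\<phi> 1 x) * lebd \<mu> x) \<partial>gibbs \<phi>) = (\<integral>\<^sup>+x. ennreal (lebd \<mu> x) * 1 \<partial>leb_pos)"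
    using Z_pos by (subst nn_integral_gibbs)
      (auto simp: ennreal_mult[symmetric] exp_minus intro!: nn_integral_cong)
  also have "\<dots> = (\<integral>\<^sup>+x. 1 \<partial>\<mu>)" by (rule nn_integral_lebd[OF \<mu>, symmetric]) simp
  also have "\<dots> = 1" by (simp add: M.emeasure_space_1)
  finally have *: "(\<integral>\<^sup>+x. ennreal (exp (clip_ld \<mu> n x)) \<partial>gibbs \<phi>) \<le> ennreal (1 + exp (- real n))"
    by (subst ennreal_plus) (simp_all del: ennreal_plus)
  have "integrable (gibbs \<phi>) (\<lambda>x. exp (clip_ld \<mu> n x))"
    by (rule exp_bounded_integral(1)[OF gibbs_prob clip_ld_measurable clip_ld_bound])
  from nn_integral_eq_integral[OF this] * show ?thesis by (simp del: ennreal_plus)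
qed

text \<open>For finite entropy this is dominated convergence. Otherwise the positive part of the logarithm of the
density has infinite integral, the negative part a finite one, and the clipped positive parts
increase to infinity by monotone convergence.\<close>

lemma clip_ld_integral_large:
  assumes \<mu>: "\<mu> \<in> prob_measures_pos" "absolutely_continuous leb_pos \<mu>" and m: "moment (\<phi> 1) \<mu> = ereal m"
    and r: "ereal r < - diff_entropy \<mu> + ereal (m + ln Z)"
  shows "eventually (\<lambda>n. (LINT x|\<mu>. clip_ld \<mu> n x) > r) sequentially"
proof (cases "diff_entropy \<mu> = - \<infinity>")
  case False
  note fe = finite_entropy[OF \<mu>(1) m False]
  note mf = moment_finite[OF \<mu>(1) one_in m]
  interpret M: prob_space \<mu> using \<mu> prob_measures_posD by auto
  let ?G = "\<lambda>x. ln (lebd \<mu> x) + \<phi> 1 x + ln Z"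
  have G: "integrable \<mu> ?G" using fe(2) mf(1) by simp
  have "(\<lambda>n. LINT x|\<mu>. clip_ld \<mu> n x) \<longlonglongrightarrow> (LINT x|\<mu>. ?G x)"
  proof (rule integral_dominated_convergence[where w="\<lambda>x. \<bar>?G x\<bar>"])
    show "?G \<in> borel_measurable \<mu>" using G by auto
    show "clip_ld \<mu> n \<in> borel_measurable \<mu>" for n
      using clip_ld_measurable by (simp add: measurable_pos_cong[OF \<mu>(1)])
    show "integrable \<mu> (\<lambda>x. \<bar>?G x\<bar>)" using G by (rule integrable_abs)
    show "AE x in \<mu>. norm (clip_ld \<mu> n x) \<le> \<bar>?G x\<bar>" for n
      using lebd_pos_AE[OF \<mu>] by eventually_elim (auto simp: clip_ld_def)
    show "AE x in \<mu>. (\<lambda>n. clip_ld \<mu> n x) \<longlonglongrightarrow> ?G x"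
      using lebd_pos_AE[OF \<mu>]
    proof eventually_elim
      case (elim x)
      obtain n0 :: nat where n0: "\<bar>?G x\<bar> < real n0" using reals_Archimedean2 by blast
      have "eventually (\<lambda>n. clip_ld \<mu> n x = ?G x) sequentially"
        using eventually_ge_at_top[of n0]
      proof eventually_elim
        case (elim n)
        then have "\<bar>?G x\<bar> < real n" using n0 by linarith
        then show ?case using \<open>0 < lebd \<mu> x\<close> by (auto simp: clip_ld_def)
      qed
      then show ?case by (rule tendsto_eventually)
    qed
  qed
  moreover have "(LINT x|\<mu>. ?G x) = (LINT x|\<mu>. ln (lebd \<mu> x)) + m + ln Z"
    using fe(2) mf by (simp add: M.prob_space)
  moreover have "r < (LINT x|\<mu>. ln (lebd \<mu> x)) + m + ln Z"
    using r by (simp add: fe(3))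
  ultimately show ?thesis by (metis order_tendstoD(1))
next
  case True
  interpret M: prob_space \<mu> using \<mu> prob_measures_posD by auto
  define l where "l x = ln (lebd \<mu> x)" for x
  have [measurable]: "l \<in> borel_measurable \<mu>"
    unfolding measurable_pos_cong[OF \<mu>(1)] measurable_leb_pos[symmetric] l_def by measurable
  have N: "(\<integral>\<^sup>+x. ennreal (- l x) \<partial>\<mu>) \<le> ennreal (m + Z)"
    unfolding l_def by (rule neg_part_finite[OF \<mu> m])
  have mm: "m \<ge> 0" using moment_finite[OF \<mu>(1) one_in m] by simp
  have P: "(\<integral>\<^sup>+x. ennreal (l x) \<partial>\<mu>) = \<infinity>"
  proof (rule ccontr)
    assume "\<not> ?thesis"
    moreover have "(\<integral>\<^sup>+x. ennreal (- l x) \<partial>\<mu>) \<noteq> \<infinity>" using N by (auto simp: top_unique)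
    ultimately show False
      using True diff_entropy_eq[OF \<mu>] unfolding l_def[symmetric]
      by (cases "(\<integral>\<^sup>+x. ennreal (l x) \<partial>\<mu>)"; cases "(\<integral>\<^sup>+x. ennreal (- l x) \<partial>\<mu>)") auto
  qed
  then have SUP: "(SUP n. \<integral>\<^sup>+x. ennreal (min (real n) (l x)) \<partial>\<mu>) = \<infinity>"
    by (subst nn_integral_truncation_SUP) auto
  define B where "B = \<bar>r\<bar> + 1 + m + Z + \<bar>ln Z\<bar>"
  obtain n0 where n0: "ennreal B < (\<integral>\<^sup>+x. ennreal (min (real n0) (l x)) \<partial>\<mu>)"
    using less_SUP_iff[of "ennreal B" "\<lambda>n. \<integral>\<^sup>+x. ennreal (min (real n) (l x)) \<partial>\<mu>" UNIV]
    unfolding SUP by (auto simp del: ennreal_plus simp: less_top[symmetric])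
  have negint: "integrable \<mu> (\<lambda>x. max 0 (- l x))"
    using N by (intro integrableI_nonneg) (auto simp: ennreal_max_0 le_less_trans)
  have negle: "(LINT x|\<mu>. max 0 (- l x)) \<le> m + Z"
  proof -
    have "ennreal (LINT x|\<mu>. max 0 (- l x)) = (\<integral>\<^sup>+x. ennreal (max 0 (- l x)) \<partial>\<mu>)"
      by (rule nn_integral_eq_integral[symmetric, OF negint]) auto
    also have "\<dots> \<le> ennreal (m + Z)" using N by (simp add: ennreal_max_0)
    finally show ?thesis using mm Z_pos by (simp del: ennreal_plus)
  qed
  show ?thesis
    using eventually_ge_at_top[of n0]
  proof eventually_elim
    case (elim n)
    have posint: "integrable \<mu> (\<lambda>x. max 0 (min (real n) (l x)))"
      by (rule M.integrable_const_bound[where B="real n"]) auto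
    have "ennreal B < (\<integral>\<^sup>+x. ennreal (min (real n0) (l x)) \<partial>\<mu>)" by fact
    also have "\<dots> \<le> (\<integral>\<^sup>+x. ennreal (max 0 (min (real n) (l x))) \<partial>\<mu>)"
      using elim by (intro nn_integral_mono) (auto simp: ennreal_max_0 intro!: ennreal_leI)
    also have "\<dots> = ennreal (LINT x|\<mu>. max 0 (min (real n) (l x)))"
      by (rule nn_integral_eq_integral[OF posint]) auto
    finally have Blt: "B < (LINT x|\<mu>. max 0 (min (real n) (l x)))"
      using mm Z_pos by (subst (asm) ennreal_less_iff) (auto simp: B_def)
    have "r < (LINT x|\<mu>. max 0 (min (real n) (l x))) - (LINT x|\<mu>. max 0 (- l x)) - \<bar>ln Z\<bar>"
      using Blt negle by (simp add: B_def)
    also have "\<dots> = (LINT x|\<mu>. max 0 (min (real n) (l x)) - max 0 (- l x) - \<bar>ln Z\<bar>)"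
      using posint negint by (simp add: M.prob_space)
    also have "\<dots> \<le> (LINT x|\<mu>. clip_ld \<mu> n x)"
    proof (rule integral_mono_AE)
      show "integrable \<mu> (\<lambda>x. max 0 (min (real n) (l x)) - max 0 (- l x) - \<bar>ln Z\<bar>)"
        using posint negint by simp
      show "integrable \<mu> (clip_ld \<mu> n)"
        using clip_ld_measurable clip_ld_bound by (rule bounded_measurable_integrable[OF \<mu>(1)])
      have "AE x in \<mu>. x > 0" using prob_measures_posD(3)[OF \<mu>(1)] by (auto intro!: AE_I2)
      with lebd_pos_AE[OF \<mu>]
      show "AE x in \<mu>. max 0 (min (real n) (l x)) - max 0 (- l x) - \<bar>ln Z\<bar> \<le> clip_ld \<mu> n x"
      proof eventually_elim
        case (elim x)
        have p: "\<phi> 1 x > 0" using pos[OF one_in elim(2)] .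
        have c: "clip_ld \<mu> n x = max (- real n) (min (real n) (l x + \<phi> 1 x + ln Z))"
          using elim by (simp add: clip_ld_def l_def)
        show ?case unfolding c using p by (auto simp: max_def min_def abs_if)
      qed
    qed
    finally show ?case .
  qed
qed

text \<open>The hard half of the Donsker--Varadhan variational formula: relative entropy with respect to the
reference law is almost attained by bounded continuous test functions.\<close>

lemma variational_entropy_bound:
  assumes \<mu>: "\<mu> \<in> prob_measures_pos" and m: "moment (\<phi> 1) \<mu> = ereal m"
    and r: "ereal r < - diff_entropy \<mu> + ereal (m + ln Z)"
  obtains g where "bdd_cont_pos g" "(LINT x|\<mu>. g x) - ln (LINT x|gibbs \<phi>. exp (g x)) > r"
proof (cases "absolutely_continuous leb_pos \<mu>")
  case False
  then obtain N where N: "N \<in> null_sets leb_pos" "N \<notin> null_sets \<mu>"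
    unfolding absolutely_continuous_def by blast
  then have "N \<in> null_sets (gibbs \<phi>)" using gibbs_ac unfolding absolutely_continuous_def by blast
  from variational_singular[OF \<mu> gibbs_prob this N(2)] that show ?thesis by blast
next
  case ac: True
  obtain r' where r': "r < r'" "ereal r' < - diff_entropy \<mu> + ereal (m + ln Z)"
    using ereal_dense2[OF r] by auto
  have "(\<lambda>n. exp (- real n)) \<longlonglongrightarrow> 0" by real_asymp
  then have "eventually (\<lambda>n. exp (- real n) < r' - r) sequentially"
    using r'(1) by (intro order_tendstoD) auto
  with clip_ld_integral_large[OF \<mu> ac m r'(2)]
  have "eventually (\<lambda>n. (LINT x|\<mu>. clip_ld \<mu> n x) > r' \<and> exp (- real n) < r' - r) sequentially"
    by eventually_elim simp
  then obtain n where n: "(LINT x|\<mu>. clip_ld \<mu> n x) > r'" "exp (- real n) < r' - r"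
    unfolding eventually_sequentially by blast
  let ?T = "clip_ld \<mu> n"
  have Epos: "(LINT x|gibbs \<phi>. exp (?T x)) > 0"
    by (rule exp_bounded_integral(2)[OF gibbs_prob clip_ld_measurable clip_ld_bound])
  have "ln (LINT x|gibbs \<phi>. exp (?T x)) \<le> (LINT x|gibbs \<phi>. exp (?T x)) - 1"
    using Epos by (rule ln_le_minus_one)
  also have "\<dots> \<le> exp (- real n)" using exp_clip_ld[OF \<mu> ac, of n] by simp
  finally have lim: "r < (LINT x|\<mu>. ?T x) - ln (LINT x|gibbs \<phi>. exp (?T x))" using n by linarith
  obtain g where g: "\<And>j. bdd_cont_pos (g j)" "(\<lambda>j. LINT x|\<mu>. g j x) \<longlonglongrightarrow> (LINT x|\<mu>. ?T x)"
    "(\<lambda>j. LINT x|gibbs \<phi>. exp (g j x)) \<longlonglongrightarrow> (LINT x|gibbs \<phi>. exp (?T x))"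
    using bounded_measurable_approx[OF \<mu> ac gibbs_prob gibbs_ac clip_ld_measurable clip_ld_bound] by blast
  have "(\<lambda>j. (LINT x|\<mu>. g j x) - ln (LINT x|gibbs \<phi>. exp (g j x)))
      \<longlonglongrightarrow> (LINT x|\<mu>. ?T x) - ln (LINT x|gibbs \<phi>. exp (?T x))"
    using g Epos by (intro tendsto_intros) auto
  from order_tendstoD(1)[OF this lim] obtain j where
    "r < (LINT x|\<mu>. g j x) - ln (LINT x|gibbs \<phi>. exp (g j x))"
    unfolding eventually_sequentially by blast
  with that[OF g(1)] show ?thesis .
qed

end

section \<open>Empirical measures and sampling\<close>

text \<open>Writing the empirical measure as an image measure makes its integrals sample means.\<close>

lemma emp_measure_eq:
  assumes n: "n \<ge> 1" and \<omega>: "\<And>j. j \<in> {1..n} \<Longrightarrow> \<omega> j > 0"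
  shows "emp_measure n \<omega> = distr (uniform_count_measure {1..n}) borel_pos \<omega>"
proof -
  let ?D = "distr (uniform_count_measure {1..n}) borel_pos \<omega>"
  have mo: "\<omega> \<in> measurable (uniform_count_measure {1..n}) borel_pos"
    using \<omega> by (auto simp: measurable_def sets_uniform_count_measure space_uniform_count_measure)
  have "(\<Sum>j=1..n. emeasure (return borel_pos (\<omega> j)) B) / of_nat n = emeasure ?D B" if B: "B \<in> sets borel_pos" for B
  proof -
    have "(\<Sum>j=1..n. emeasure (return borel_pos (\<omega> j)) B) = (\<Sum>j=1..n. ennreal (indicator B (\<omega> j)))"
      using B by (intro sum.cong) (auto split: split_indicator)
    also have "\<dots> = ennreal (\<Sum>j=1..n. indicator B (\<omega> j))" by simp
    also have "(\<Sum>j=1..n. indicator B (\<omega> j)) = real (card {j\<in>{1..n}. \<omega> j \<in> B})"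
      by (simp add: indicator_def sum.If_cases Int_def)
    finally have 1: "(\<Sum>j=1..n. emeasure (return borel_pos (\<omega> j)) B) / of_nat n
        = ennreal (real (card {j\<in>{1..n}. \<omega> j \<in> B}) / real n)"
      using n by (simp add: divide_ennreal ennreal_of_nat_eq_real_of_nat)
    have "emeasure ?D B = emeasure (uniform_count_measure {1..n}) {j\<in>{1..n}. \<omega> j \<in> B}"
      using mo B by (subst emeasure_distr)
        (auto simp: space_uniform_count_measure intro!: arg_cong[where f="emeasure (uniform_count_measure {1..n})"])
    also have "\<dots> = ennreal (real (card {j\<in>{1..n}. \<omega> j \<in> B}) / real n)"
      by (subst emeasure_uniform_count_measure) auto
    finally show ?thesis using 1 by simp
  qed
  then have "emp_measure n \<omega> = measure_of (space borel_pos) (sets borel_pos) (emeasure ?D)"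
    unfolding emp_measure_def using sets.space_closed[of borel_pos] sets.sigma_sets_eq[of borel_pos]
    by (intro measure_of_eq) auto
  also have "\<dots> = ?D"
    using measure_of_of_measure[of ?D] by simp
  finally show ?thesis .
qed

lemma emp_measure_integral:
  assumes n: "n \<ge> 1" and \<omega>: "\<And>j. j \<in> {1..n} \<Longrightarrow> \<omega> j > 0"
  shows "emp_measure n \<omega> \<in> prob_measures_pos"
    and "f \<in> borel_measurable borel_pos \<Longrightarrow> (LINT x|emp_measure n \<omega>. f x) = emp_mean f n \<omega>"
    and "f \<in> borel_measurable borel_pos \<Longrightarrow> (\<And>x. x > 0 \<Longrightarrow> f x \<ge> 0) \<Longrightarrow>
      (\<integral>\<^sup>+x. ennreal (f x) \<partial>emp_measure n \<omega>) = ennreal (emp_mean f n \<omega>)"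
proof -
  let ?U = "uniform_count_measure {1..n}"
  interpret U: prob_space ?U using n by (intro prob_space_uniform_count_measure) auto
  have mo: "\<omega> \<in> measurable ?U borel_pos"
    using \<omega> by (auto simp: measurable_def sets_uniform_count_measure space_uniform_count_measure)
  have eq: "emp_measure n \<omega> = distr ?U borel_pos \<omega>"
    by (rule emp_measure_eq) (use n \<omega> in auto)
  show "emp_measure n \<omega> \<in> prob_measures_pos"
    unfolding eq prob_measures_pos_def using mo by (auto intro!: U.prob_space_distr)
  show "(LINT x|emp_measure n \<omega>. f x) = emp_mean f n \<omega>" if f: "f \<in> borel_measurable borel_pos" for f
    unfolding eq using n mo f
    by (simp add: integral_distr integral_uniform_count_measure emp_mean_def)
  have intU: "integrable ?U g" for g :: "nat \<Rightarrow> real"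
    unfolding uniform_count_measure_def by (rule integrable_point_measure_finite) simp
  show "(\<integral>\<^sup>+x. ennreal (f x) \<partial>emp_measure n \<omega>) = ennreal (emp_mean f n \<omega>)"
    if f: "f \<in> borel_measurable borel_pos" and nn: "\<And>x. x > 0 \<Longrightarrow> f x \<ge> 0" for f
  proof -
    have "(\<integral>\<^sup>+x. ennreal (f x) \<partial>emp_measure n \<omega>) = (\<integral>\<^sup>+j. ennreal (f (\<omega> j)) \<partial>?U)"
      unfolding eq using mo f by (simp add: nn_integral_distr)
    also have "\<dots> = ennreal (LINT j|?U. f (\<omega> j))"
      using nn \<omega> by (intro nn_integral_eq_integral intU AE_I2) (auto simp: space_uniform_count_measure)
    also have "(LINT j|?U. f (\<omega> j)) = emp_mean f n \<omega>"
      using n by (simp add: integral_uniform_count_measure emp_mean_def)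
    finally show ?thesis .
  qed
qed

lemma emp_mean_restrict [simp]: "emp_mean f n (restrict \<omega> {1..n}) = emp_mean f n \<omega>"
  unfolding emp_mean_def by (intro arg_cong2[where f="(/)"] sum.cong) auto

lemma emp_measure_restrict [simp]: "emp_measure n (restrict \<omega> {1..n}) = emp_measure n \<omega>"
  unfolding emp_measure_def
  by (intro arg_cong2[where f="measure_of (space borel_pos)"] refl ext arg_cong2[where f="(/)"] sum.cong) auto

lemma scaled_max_restrict [simp]: "scaled_max f n (restrict \<omega> {1..n}) = scaled_max f n \<omega>"
  unfolding scaled_max_def by (intro arg_cong[where f=Max] image_cong) auto

lemma scaled_max_le_iff: "n \<ge> 1 \<Longrightarrow> scaled_max f n \<omega> \<le> t \<longleftrightarrow> (\<forall>j\<in>{1..n}. f (\<omega> j) / real n \<le> t)"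
  unfolding scaled_max_def by (subst Max_le_iff) auto

lemma scaled_max_ge: "j \<in> {1..n} \<Longrightarrow> f (\<omega> j) / real n \<le> scaled_max f n \<omega>"
  unfolding scaled_max_def by (intro Max_ge) auto

lemma scaled_max_attained:
  assumes "n \<ge> 1" obtains j where "j \<in> {1..n}" "scaled_max f n \<omega> = f (\<omega> j) / real n"
proof -
  have "scaled_max f n \<omega> \<in> (\<lambda>j. f (\<omega> j) / real n) ` {1..n}"
    unfolding scaled_max_def using assms by (intro Max_in) auto
  then show ?thesis using that by auto
qed

context moment_functions
begin

definition samples :: "nat set \<Rightarrow> (nat \<Rightarrow> real) measure" where
  "samples I = PiM I (\<lambda>_. gibbs \<phi>)"

lemma space_gibbs [simp]: "space (gibbs \<phi>) = {0<..}"
  using prob_measures_posD(3)[OF gibbs_prob] .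

lemma sets_gibbs [measurable_cong]: "sets (gibbs \<phi>) = sets borel_pos"
  using prob_measures_posD(2)[OF gibbs_prob] .

sublocale G: prob_space "gibbs \<phi>"
  using prob_measures_posD(1)[OF gibbs_prob] .

sublocale GP: product_prob_space "\<lambda>_. gibbs \<phi>" I for I
  by standard

lemma prob_space_samples: "prob_space (samples I)"
  unfolding samples_def by (rule prob_space_PiM) (rule G.prob_space_axioms)

lemma space_samples: "\<omega> \<in> space (samples I) \<Longrightarrow> j \<in> I \<Longrightarrow> \<omega> j > 0"
  unfolding samples_def space_PiM by (auto simp: PiE_iff)

lemma coordinate_measurable:
  assumes "f \<in> borel_measurable borel_pos" "j \<in> I"
  shows "(\<lambda>\<omega>. f (\<omega> j)) \<in> borel_measurable (samples I)"
proof -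
  have "(\<lambda>\<omega>. \<omega> j) \<in> measurable (samples I) borel_pos"
    unfolding samples_def using assms(2) measurable_component_singleton[of j I "\<lambda>_. gibbs \<phi>"]
      measurable_cong_sets[OF refl sets_gibbs] by blast
  from measurable_compose[OF this assms(1)] show ?thesis .
qed

lemma coordinate_event:
  assumes "A \<in> sets borel_pos" "j \<in> I"
  shows "{\<omega> \<in> space (samples I). \<omega> j \<in> A} \<in> sets (samples I)"
proof -
  have "(\<lambda>\<omega>. \<omega> j) \<in> measurable (samples I) (gibbs \<phi>)"
    unfolding samples_def using assms(2) by (rule measurable_component_singleton)
  from measurable_sets[OF this, of A] show ?thesis
    using assms(1) sets_gibbs by (simp add: vimage_def Int_def conj_commute)
qed

lemma emp_mean_measurable:
  assumes "f \<in> borel_measurable borel_pos" "{1..n} \<subseteq> I"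
  shows "emp_mean f n \<in> borel_measurable (samples I)"
proof -
  have "(\<lambda>\<omega>. f (\<omega> j)) \<in> borel_measurable (samples I)" if "j \<in> {1..n}" for j
    using that assms(2) by (intro coordinate_measurable[OF assms(1)]) auto
  then show ?thesis
    unfolding emp_mean_def by (intro borel_measurable_divide borel_measurable_sum) auto
qed

definition state :: "nat \<Rightarrow> (nat \<Rightarrow> real) \<Rightarrow> real measure \<times> real" where
  "state n \<omega> = (emp_measure n \<omega>, scaled_max (\<phi> k) n \<omega>)"

lemma state_in_topspace:
  assumes "n \<ge> 1" "\<And>j. j \<in> {1..n} \<Longrightarrow> \<omega> j > 0"
  shows "state n \<omega> \<in> topspace state_topology"
proof -
  obtain j where j: "j \<in> {1..n}" "scaled_max (\<phi> k) n \<omega> = \<phi> k (\<omega> j) / real n"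
    using scaled_max_attained[OF assms(1)] by blast
  then have "scaled_max (\<phi> k) n \<omega> \<ge> 0" using pos[OF k_in assms(2)[OF j(1)]] by simp
  then show ?thesis using emp_measure_integral(1)[OF assms] by (simp add: state_def)
qed

text \<open>Each coordinate is a sample mean or a maximum of finitely many measurable functions. Measurability of
the events in the theorem then follows through the coordinate embedding.\<close>

lemma coords_state_measurable:
  assumes n: "n \<ge> 1" and I: "{1..n} \<subseteq> I"
  shows "(\<lambda>\<omega>. coords (state n \<omega>)) \<in> borel_measurable (samples I)"
proof (rule measurable_coordinatewise_then_product)
  fix i
  show "(\<lambda>\<omega>. coords (state n \<omega>) i) \<in> borel_measurable (samples I)"
  proof (cases i)
    case 0
    have "(\<lambda>\<omega>. scaled_max (\<phi> k) n \<omega>) \<in> borel_measurable (samples I)"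
      unfolding scaled_max_def using I
      by (intro borel_measurable_Max borel_measurable_divide coordinate_measurable phi_measurable[OF k_in]) auto
    then show ?thesis by (simp add: 0 state_def)
  next
    case (Suc m)
    note rm = bdd_cont_pos_measurable[OF bdd_cont_pos_ramp[of m]]
    have "coords (state n \<omega>) i = emp_mean (\<lambda>x. ramp m (ln x)) n \<omega>" if "\<omega> \<in> space (samples I)" for \<omega>
    proof -
      have "\<omega> j > 0" if "j \<in> {1..n}" for j
        using that I space_samples[OF \<open>\<omega> \<in> space (samples I)\<close>] by blast
      from emp_measure_integral(2)[OF n this rm] show ?thesis by (simp add: Suc state_def)
    qed
    then show ?thesis
      using emp_mean_measurable[OF rm I] by (simp cong: measurable_cong)
  qed
qed

lemma open_event_measurable:
  assumes "openin state_topology U" "n \<ge> 1" "{1..n} \<subseteq> I"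
  shows "{\<omega> \<in> space (samples I). state n \<omega> \<in> U} \<in> sets (samples I)"
proof -
  obtain V where V: "open V" "U = {p \<in> topspace state_topology. coords p \<in> V}"
    using open_state_eq_coords_vimage[OF assms(1)] by blast
  have "{\<omega> \<in> space (samples I). state n \<omega> \<in> U} = (\<lambda>\<omega>. coords (state n \<omega>)) -` V \<inter> space (samples I)"
    using state_in_topspace[OF assms(2)] space_samples assms(3) unfolding V(2) by blast
  also have "\<dots> \<in> sets (samples I)"
    using coords_state_measurable[OF assms(2,3)] V(1) by (intro measurable_sets) auto
  finally show ?thesis .
qed

lemma closed_event_measurable:
  assumes "closedin state_topology F" "n \<ge> 1" "{1..n} \<subseteq> I"
  shows "{\<omega> \<in> space (samples I). state n \<omega> \<in> F} \<in> sets (samples I)"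
proof -
  have "{\<omega> \<in> space (samples I). state n \<omega> \<in> F} =
      space (samples I) - {\<omega> \<in> space (samples I). state n \<omega> \<in> topspace state_topology - F}"
    using state_in_topspace[OF assms(2)] space_samples assms(3) by blast
  also have "\<dots> \<in> sets (samples I)"
    using assms(1) by (intro sets.Diff sets.top open_event_measurable assms(2,3)) (simp add: closedin_def)
  finally show ?thesis .
qed

lemma shell_measurable:
  assumes "{1..n} \<subseteq> I"
  shows "{\<omega> \<in> space (samples I). in_shell k \<phi> a \<delta> n \<omega>} \<in> sets (samples I)"
proof -
  have "{\<omega> \<in> space (samples I). \<bar>emp_mean (\<phi> i) n \<omega> - a i\<bar> \<le> \<delta>} \<in> sets (samples I)" if "i \<in> {1..k}" for i
  proof -
    have [measurable]: "emp_mean (\<phi> i) n \<in> borel_measurable (samples I)"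
      by (rule emp_mean_measurable[OF phi_measurable[OF that] assms])
    show ?thesis by measurable
  qed
  then show ?thesis unfolding in_shell_def by (intro sets.sets_Collect_finite_All) auto
qed

text \<open>The index set is a parameter, so that the same event can be read on the infinite product, where the
theorem lives, and on the product of the first \<open>n\<close> factors, where measures are changed.\<close>

definition event :: "(nat \<Rightarrow> real) \<Rightarrow> (real measure \<times> real) set \<Rightarrow> real \<Rightarrow> nat \<Rightarrow> nat set \<Rightarrow> (nat \<Rightarrow> real) set" where
  "event a E \<delta> n I = {\<omega> \<in> space (samples I). state n \<omega> \<in> E \<and> in_shell k \<phi> a \<delta> n \<omega>}"

lemma event_measurable:
  assumes "openin state_topology E \<or> closedin state_topology E" "n \<ge> 1" "{1..n} \<subseteq> I"
  shows "event a E \<delta> n I \<in> sets (samples I)"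
proof -
  have "event a E \<delta> n I = {\<omega> \<in> space (samples I). state n \<omega> \<in> E} \<inter> {\<omega> \<in> space (samples I). in_shell k \<phi> a \<delta> n \<omega>}"
    by (auto simp: event_def)
  then show ?thesis
    using open_event_measurable[OF _ assms(2,3)] closed_event_measurable[OF _ assms(2,3)]
      shell_measurable[OF assms(3)] assms(1) by auto
qed

definition joint_prob :: "(nat \<Rightarrow> real) \<Rightarrow> (real measure \<times> real) set \<Rightarrow> real \<Rightarrow> nat \<Rightarrow> real" where
  "joint_prob a E \<delta> n = measure (samples {1..}) (event a E \<delta> n {1..})"

lemma joint_prob_finite:
  assumes "openin state_topology E \<or> closedin state_topology E" "n \<ge> 1"
  shows "joint_prob a E \<delta> n = measure (samples {1..n}) (event a E \<delta> n {1..n})"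
proof -
  have eq: "samples {1..n} = distr (samples {1..}) (samples {1..n}) (\<lambda>\<omega>. restrict \<omega> {1..n})"
    unfolding samples_def by (rule GP.distr_PiM_restrict_finite[symmetric]) auto
  have r: "(\<lambda>\<omega>. restrict \<omega> {1..n}) \<in> measurable (samples {1..}) (samples {1..n})"
    unfolding samples_def by (rule measurable_restrict_subset) auto
  have "event a E \<delta> n {1..} = (\<lambda>\<omega>. restrict \<omega> {1..n}) -` event a E \<delta> n {1..n} \<inter> space (samples {1..})"
    using measurable_space[OF r] by (auto simp: event_def state_def in_shell_def)
  then show ?thesis
    unfolding joint_prob_def
    by (subst eq) (simp add: measure_distr[OF r event_measurable[OF assms]])
qed

lemma joint_prob_mono:
  assumes "openin state_topology F \<or> closedin state_topology F" "n \<ge> 1" "E \<subseteq> F"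
  shows "joint_prob a E \<delta> n \<le> joint_prob a F \<delta> n"
proof -
  interpret prob_space "samples {1..}" by (rule prob_space_samples)
  show ?thesis unfolding joint_prob_def
    using assms(3) by (intro finite_measure_mono event_measurable assms) (auto simp: event_def)
qed

lemma log_cond_prob_eq:
  assumes "n \<ge> 1"
  shows "log_cond_prob k \<phi> a E \<delta> n = ereal (1 / real n) *
     ereal_log (joint_prob a E \<delta> n / joint_prob a (topspace state_topology) \<delta> n)"
proof -
  have s: "sample_space \<phi> = samples {1..}" by (simp add: sample_space_def samples_def)
  have "{\<omega> \<in> space (samples {1..}). in_shell k \<phi> a \<delta> n \<omega>} = event a (topspace state_topology) \<delta> n {1..}"
    using state_in_topspace[OF assms] space_samples by (auto simp: event_def)
  then show ?thesis
    unfolding log_cond_prob_def cond_prob_def s joint_prob_def event_def state_def by simp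
qed

lemma Chernoff_bound:
  assumes f: "f \<in> borel_measurable borel_pos" and c: "(\<integral>\<^sup>+x. ennreal (exp (f x)) \<partial>gibbs \<phi>) \<le> ennreal c" "c \<ge> 0"
    and n: "n \<ge> 1"
  shows "measure (samples {1..}) {\<omega> \<in> space (samples {1..}). emp_mean f n \<omega> \<ge> t} \<le> (exp (- t) * c) ^ n"
proof -
  let ?P = "samples {1..}"
  interpret prob_space ?P by (rule prob_space_samples)
  let ?Y = "\<lambda>\<omega>. \<Prod>j\<in>{1..n}. ennreal (exp (f (\<omega> j)))"
  have fe: "(\<lambda>x. ennreal (exp (f x))) \<in> borel_measurable (gibbs \<phi>)"
  proof -
    have [measurable]: "f \<in> borel_measurable (gibbs \<phi>)"
      using f by (simp add: measurable_pos_cong[OF gibbs_prob])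
    show ?thesis by measurable
  qed
  have Ym: "?Y \<in> borel_measurable (samples {1..n})"
    unfolding samples_def using fe by measurable
  have r: "(\<lambda>\<omega>. restrict \<omega> {1..n}) \<in> measurable ?P (samples {1..n})"
    unfolding samples_def by (rule measurable_restrict_subset) auto
  have eq: "samples {1..n} = distr ?P (samples {1..n}) (\<lambda>\<omega>. restrict \<omega> {1..n})"
    unfolding samples_def by (rule GP.distr_PiM_restrict_finite[symmetric]) auto
  have Ym': "?Y \<in> borel_measurable ?P"
  proof -
    have "(\<lambda>\<omega>. ?Y (restrict \<omega> {1..n})) \<in> borel_measurable ?P" by (rule measurable_compose[OF r Ym])
    moreover have "(\<lambda>\<omega>. ?Y (restrict \<omega> {1..n})) = ?Y" by (intro ext prod.cong) auto
    ultimately show ?thesis by simp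
  qed
  have "(\<integral>\<^sup>+\<omega>. ?Y \<omega> \<partial>?P) = (\<integral>\<^sup>+\<omega>. ?Y (restrict \<omega> {1..n}) \<partial>?P)"
    by (intro nn_integral_cong prod.cong) auto
  also have "\<dots> = (\<integral>\<^sup>+\<omega>. ?Y \<omega> \<partial>samples {1..n})"
    by (subst eq, rule nn_integral_distr[OF r, symmetric]) (simp add: Ym)
  also have "\<dots> = (\<Prod>j\<in>{1..n}. \<integral>\<^sup>+x. ennreal (exp (f x)) \<partial>gibbs \<phi>)"
    unfolding samples_def by (rule GP.product_nn_integral_prod) (use fe in auto)
  also have "\<dots> \<le> ennreal (c ^ n)"
  proof -
    obtain d where d: "(\<integral>\<^sup>+x. ennreal (exp (f x)) \<partial>gibbs \<phi>) = ennreal d" "d \<ge> 0"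
      using c by (cases "\<integral>\<^sup>+x. ennreal (exp (f x)) \<partial>gibbs \<phi>") (auto simp: top_unique)
    then have "d \<le> c" using c by simp
    then show ?thesis using d by (simp add: ennreal_power ennreal_leI power_mono)
  qed
  finally have I: "(\<integral>\<^sup>+\<omega>. ?Y \<omega> \<partial>?P) \<le> ennreal (c ^ n)" .
  let ?A = "{\<omega> \<in> space ?P. emp_mean f n \<omega> \<ge> t}"
  let ?c = "ennreal (exp (- (real n * t)))"
  have sub: "?A \<subseteq> {\<omega> \<in> space ?P. 1 \<le> ?c * ?Y \<omega>}"
  proof safe
    fix \<omega> assume "t \<le> emp_mean f n \<omega>"
    then have "real n * t \<le> (\<Sum>j=1..n. f (\<omega> j))" using n by (simp add: emp_mean_def field_simps)
    then have "1 \<le> exp (- (real n * t)) * (\<Prod>j\<in>{1..n}. exp (f (\<omega> j)))"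
      by (simp add: exp_sum[symmetric] exp_add[symmetric] mult_exp_exp)
    then have "ennreal 1 \<le> ennreal (exp (- (real n * t)) * (\<Prod>j\<in>{1..n}. exp (f (\<omega> j))))"
      by (rule ennreal_leI)
    then show "1 \<le> ?c * ?Y \<omega>" by (simp add: ennreal_mult prod_ennreal prod_nonneg)
  qed
  have "emeasure ?P ?A \<le> emeasure ?P {\<omega> \<in> space ?P. 1 \<le> ?c * ?Y \<omega>}"
    using sub Ym' by (intro emeasure_mono) auto
  also have "\<dots> \<le> ?c * (\<integral>\<^sup>+\<omega>. ?Y \<omega> * indicator (space ?P) \<omega> \<partial>?P)"
    using Ym' by (intro nn_integral_Markov_inequality) auto
  also have "(\<integral>\<^sup>+\<omega>. ?Y \<omega> * indicator (space ?P) \<omega> \<partial>?P) = (\<integral>\<^sup>+\<omega>. ?Y \<omega> \<partial>?P)"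
    by (intro nn_integral_cong) simp
  also have "?c * \<dots> \<le> ?c * ennreal (c ^ n)" by (intro mult_left_mono I) simp
  also have "\<dots> = ennreal ((exp (- t) * c) ^ n)"
    using c by (simp add: ennreal_mult[symmetric] power_mult_distrib exp_of_nat_mult[symmetric])
  finally show ?thesis using c by (simp add: emeasure_eq_measure)
qed

end

section \<open>Neighbourhoods for the upper bound\<close>

lemma openin_state_box:
  assumes "bdd_cont_pos f" "open V" "open W"
  shows "openin state_topology ({\<nu> \<in> prob_measures_pos. (LINT x|\<nu>. f x) \<in> V} \<times> ({0..} \<inter> W))"
proof -
  have "openin weak_topology_pos {\<nu> \<in> prob_measures_pos. (LINT x|\<nu>. f x) \<in> V}"
    unfolding weak_topology_pos_def
    by (rule topology_generated_by_Basis) (use assms in \<open>auto simp: bdd_cont_pos_def\<close>)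
  then show ?thesis
    unfolding state_topology_def openin_prod_Times_iff using assms(3) by (auto simp: openin_open_Int)
qed

lemma emp_mean_mono:
  assumes "\<And>j. j \<in> {1..n} \<Longrightarrow> f (\<omega> j) \<le> g (\<omega> j)"
  shows "emp_mean f n \<omega> \<le> emp_mean g n \<omega>"
  unfolding emp_mean_def by (intro divide_right_mono sum_mono assms) auto

lemma emp_mean_linear: "emp_mean (\<lambda>x. f x + c * g x) n \<omega> = emp_mean f n \<omega> + c * emp_mean g n \<omega>"
  by (simp add: emp_mean_def sum.distrib sum_distrib_left add_divide_distrib)

context moment_functions
begin

text \<open>The set where the rate function has its finite branch.\<close>

definition feasible :: "(nat \<Rightarrow> real) \<Rightarrow> real measure \<Rightarrow> real \<Rightarrow> bool" where
  "feasible a \<mu> z \<longleftrightarrow> moments_match k \<phi> a \<mu> \<and> moment (\<phi> k) \<mu> \<le> ereal (a k - z)"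

lemma feasible_moment1: "feasible a \<mu> z \<Longrightarrow> moment (\<phi> 1) \<mu> = ereal (a 1)"
  using k unfolding feasible_def moments_match_def by auto

text \<open>Iterating the domination hypothesis: once all the functions exceed one, they are increasing in the
index, so raising \<open>\<phi> i\<close> to the power \<open>\<kappa>\<close> keeps it below \<open>\<phi> (i + 1)\<close>, which is below \<open>\<phi> k\<close>.\<close>

lemma dominated_by_last:
  obtains \<kappa> X where "\<kappa> > 1" "X > 0"
    "\<And>i x. i \<in> {1..k-1} \<Longrightarrow> x \<ge> X \<Longrightarrow> \<phi> i x \<ge> 1 \<and> \<phi> i x powr \<kappa> \<le> \<phi> k x"
proof -
  obtain \<kappa> where \<kappa>: "\<kappa> > 1" "\<forall>i\<in>{1..k-1}. eventually (\<lambda>x. \<phi> i x powr \<kappa> < \<phi> (i + 1) x) at_top"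
    using C3 by blast
  have "eventually (\<lambda>x. \<forall>i\<in>{1..k-1}. \<phi> i x powr \<kappa> < \<phi> (i + 1) x) at_top"
    using \<kappa>(2) by (intro eventually_ball_finite) auto
  moreover have "eventually (\<lambda>x. \<forall>i\<in>{1..k}. \<phi> i x \<ge> 1) at_top"
    using lim by (intro eventually_ball_finite) (auto simp: filterlim_at_top)
  ultimately have "eventually (\<lambda>x. (\<forall>i\<in>{1..k-1}. \<phi> i x powr \<kappa> < \<phi> (i + 1) x) \<and> (\<forall>i\<in>{1..k}. \<phi> i x \<ge> 1)) at_top"
    by (rule eventually_conj)
  then obtain X where X: "\<And>x. x \<ge> X \<Longrightarrow> (\<forall>i\<in>{1..k-1}. \<phi> i x powr \<kappa> < \<phi> (i + 1) x) \<and> (\<forall>i\<in>{1..k}. \<phi> i x \<ge> 1)"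
    unfolding eventually_at_top_linorder by blast
  show ?thesis
  proof (rule that[of \<kappa> "max X 1"])
    fix i x assume i: "i \<in> {1..k-1}" and x: "x \<ge> max X 1"
    note Xx = X[of x]
    have step: "\<phi> j x \<le> \<phi> (Suc j) x" if "j \<in> {1..k-1}" for j
    proof -
      have "1 \<le> \<phi> j x" using Xx x that k by auto
      then have "\<phi> j x = \<phi> j x powr 1" by simp
      also have "\<dots> \<le> \<phi> j x powr \<kappa>" using Xx x that \<kappa>(1) k by (intro powr_mono) auto
      also have "\<dots> \<le> \<phi> (Suc j) x" using Xx x that by (simp add: Suc_eq_plus1 less_imp_le)
      finally show ?thesis .
    qed
    have "\<phi> (Suc i) x \<le> \<phi> k x"
    proof -
      have "Suc i \<le> k" using i k by auto
      then show ?thesis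
      proof (induction rule: dec_induct)
        case (step j)
        have "\<phi> j x \<le> \<phi> (Suc j) x" using step(1,2) i by (intro \<open>\<And>j. j \<in> {1..k-1} \<Longrightarrow> _\<close>) auto
        with step(3) show ?case by linarith
      qed simp
    qed
    moreover have "\<phi> i x powr \<kappa> \<le> \<phi> (Suc i) x" using Xx x i by (simp add: Suc_eq_plus1 less_imp_le)
    moreover have "\<phi> i x \<ge> 1" using Xx x i by auto
    ultimately show "\<phi> i x \<ge> 1 \<and> \<phi> i x powr \<kappa> \<le> \<phi> k x" by linarith
  qed (use \<kappa> in auto)
qed

text \<open>Uniform integrability: where \<open>\<phi> i\<close> exceeds \<open>R\<close>, it is at most \<open>R powr (1 - \<kappa>) * \<phi> k\<close>.\<close>

lemma tail_domination:
  assumes i: "i \<in> {1..k-1}" and \<theta>: "\<theta> > 0"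
  obtains R where "R > 0" "\<And>x. x > 0 \<Longrightarrow> \<phi> i x \<le> min (\<phi> i x) R + \<theta> * \<phi> k x"
proof -
  obtain \<kappa> X where \<kappa>: "\<kappa> > 1" "X > 0"
    "\<And>i x. i \<in> {1..k-1} \<Longrightarrow> x \<ge> X \<Longrightarrow> \<phi> i x \<ge> 1 \<and> \<phi> i x powr \<kappa> \<le> \<phi> k x"
    using dominated_by_last by blast
  have ik: "i \<in> {1..k}" using i by auto
  have "((\<lambda>R. R powr (1 - \<kappa>)) \<longlongrightarrow> 0) at_top"
    using \<kappa>(1) by (intro tendsto_neg_powr filterlim_ident) auto
  then have "eventually (\<lambda>R. R powr (1 - \<kappa>) < \<theta>) at_top" using \<theta> by (rule order_tendstoD)
  then have "eventually (\<lambda>R. R powr (1 - \<kappa>) < \<theta> \<and> R \<ge> max 1 (\<phi> i X)) at_top"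
    by (rule eventually_conj) (rule eventually_ge_at_top)
  then obtain R where R: "R powr (1 - \<kappa>) < \<theta>" "R \<ge> 1" "R \<ge> \<phi> i X"
    unfolding eventually_at_top_linorder by auto
  show ?thesis
  proof (rule that[of R])
    fix x :: real assume x: "x > 0"
    show "\<phi> i x \<le> min (\<phi> i x) R + \<theta> * \<phi> k x"
    proof (cases "\<phi> i x \<le> R")
      case True
      then show ?thesis using \<theta> pos[OF k_in x] by simp
    next
      case False
      have "x \<ge> X"
      proof (rule ccontr)
        assume "\<not> x \<ge> X"
        then have "\<phi> i x \<le> \<phi> i X" using mono_onD[OF mono[OF ik], of x X] x by auto
        then show False using False R by simp
      qed
      note d = \<kappa>(3)[OF i this]
      have "\<phi> i x = \<phi> i x powr \<kappa> * \<phi> i x powr (1 - \<kappa>)" using d by (simp add: powr_add[symmetric])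
      also have "\<dots> \<le> \<phi> k x * R powr (1 - \<kappa>)"
        using d False R \<kappa>(1) pos[OF k_in x] by (intro mult_mono powr_mono2') auto
      also have "\<dots> \<le> \<phi> k x * \<theta>" using R pos[OF k_in x] by (intro mult_left_mono) auto
      finally show ?thesis using R False by (simp add: mult.commute min_def)
    qed
  qed (use R in auto)
qed

lemma bdd_cont_pos_truncation:
  assumes "i \<in> {1..k}" shows "bdd_cont_pos (\<lambda>x. min (\<phi> i x) R)"
proof -
  have "continuous_on {0<..} (\<lambda>x. min (\<phi> i x) R)" by (intro continuous_intros cont assms)
  moreover have "\<bar>min (\<phi> i x) R\<bar> \<le> \<bar>R\<bar>" if "x > 0" for x using pos[OF assms that] by auto
  ultimately show ?thesis unfolding bdd_cont_pos_def bounded_iff by auto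
qed

lemma truncated_moment_le:
  assumes \<mu>: "\<mu> \<in> prob_measures_pos" and i: "i \<in> {1..k}" and m: "moment (\<phi> i) \<mu> = ereal m"
  shows "(LINT x|\<mu>. min (\<phi> i x) R) \<le> m"
proof -
  note mf = moment_finite[OF \<mu> i m]
  have "(LINT x|\<mu>. min (\<phi> i x) R) \<le> (LINT x|\<mu>. \<phi> i x)"
    by (intro integral_mono bdd_cont_pos_integrable[OF \<mu> bdd_cont_pos_truncation[OF i]] mf) auto
  then show ?thesis using mf by simp
qed

lemma truncated_moment_gt:
  assumes \<mu>: "\<mu> \<in> prob_measures_pos" and i: "i \<in> {1..k}" and m: "moment (\<phi> i) \<mu> > ereal t"
  obtains R where "R > 0" "(LINT x|\<mu>. min (\<phi> i x) R) > t"
proof -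
  have meas[measurable]: "\<phi> i \<in> borel_measurable \<mu>"
    using phi_measurable[OF i] by (simp add: measurable_pos_cong[OF \<mu>])
  have nn: "x \<in> space \<mu> \<Longrightarrow> \<phi> i x \<ge> 0" for x
    using pos[OF i, of x] prob_measures_posD(3)[OF \<mu>] by (auto intro: less_imp_le)
  have int: "ennreal (LINT x|\<mu>. min (\<phi> i x) (real n)) = (\<integral>\<^sup>+x. ennreal (min (\<phi> i x) (real n)) \<partial>\<mu>)" for n :: nat
    using nn by (intro nn_integral_eq_integral[symmetric] bdd_cont_pos_integrable[OF \<mu> bdd_cont_pos_truncation[OF i]]) auto
  show ?thesis
  proof (cases "t < 0")
    case True
    have "0 \<le> (LINT x|\<mu>. min (\<phi> i x) 1)" using nn by (intro integral_nonneg_AE AE_I2) auto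
    then show ?thesis using that[of 1] True by simp
  next
    case False
    have S: "(SUP n. \<integral>\<^sup>+x. ennreal (min (\<phi> i x) (real n)) \<partial>\<mu>) = (\<integral>\<^sup>+x. ennreal (\<phi> i x) \<partial>\<mu>)"
      using nn_integral_truncation_SUP[OF meas] by (simp add: min.commute)
    have "ennreal t < (\<integral>\<^sup>+x. ennreal (\<phi> i x) \<partial>\<mu>)"
      using m False unfolding moment_def less_ennreal.rep_eq by (simp add: enn2ereal_ennreal)
    then obtain n :: nat where n: "ennreal t < (\<integral>\<^sup>+x. ennreal (min (\<phi> i x) (real n)) \<partial>\<mu>)"
      unfolding S[symmetric] less_SUP_iff by auto
    then have lt: "t < (LINT x|\<mu>. min (\<phi> i x) (real n))"
      unfolding int[symmetric] using False by (simp add: ennreal_less_iff)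
    have "n \<noteq> 0"
    proof
      assume "n = 0"
      then have "(LINT x|\<mu>. min (\<phi> i x) (real n)) = (LINT x|\<mu>. 0)"
        using nn by (intro Bochner_Integration.integral_cong) auto
      then show False using lt False by simp
    qed
    then show ?thesis using that[of "real n"] lt by simp
  qed
qed

text \<open>Every violated constraint is visible in the integral of a truncated function, hence in a weak
neighbourhood. A moment of order \<open>i < k\<close> that is too large persists under truncation; one that is too
small contradicts the shell because the part cut off is negligible by \<open>tail_domination\<close>. For the
last moment, truncation changes the largest term by almost all of its size, so the truncated mean is
at most about \<open>a k - z\<close> on the shell.\<close>

lemma infeasible_nbhd:
  assumes p: "(\<mu>, z) \<in> topspace state_topology" and inf: "\<not> feasible a \<mu> z"
  obtains U \<delta>0 N where "openin state_topology U" "(\<mu>, z) \<in> U" "\<delta>0 > 0"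
    "\<And>\<delta> n. \<delta> \<le> \<delta>0 \<Longrightarrow> n \<ge> N \<Longrightarrow> event a U \<delta> n {1..} = {}"
proof -
  have \<mu>: "\<mu> \<in> prob_measures_pos" and z: "z \<ge> 0" using p by auto
  have L: "(LINT x|emp_measure n \<omega>. min (\<phi> i x) R) = emp_mean (\<lambda>x. min (\<phi> i x) R) n \<omega>"
    if "n \<ge> 1" "\<omega> \<in> space (samples {1..})" "i \<in> {1..k}" for n \<omega> i R
  proof -
    have "\<omega> j > 0" if "j \<in> {1..n}" for j using space_samples[OF \<open>\<omega> \<in> space (samples {1..})\<close>, of j] that by auto
    from emp_measure_integral(2)[OF \<open>n \<ge> 1\<close> this bdd_cont_pos_measurable[OF bdd_cont_pos_truncation[OF that(3)]]]
    show ?thesis by simp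
  qed
  have sp: "\<omega> j > 0" if "\<omega> \<in> space (samples {1..})" "j \<in> {1..n}" for \<omega> j n
    using space_samples[OF that(1), of j] that by auto
  have shell: "\<bar>emp_mean (\<phi> i) n \<omega> - a i\<bar> \<le> \<delta>" if "in_shell k \<phi> a \<delta> n \<omega>" "i \<in> {1..k}" for i n \<omega> \<delta>
    using that by (auto simp: in_shell_def)
  consider (gt) i where "i \<in> {1..k-1}" "moment (\<phi> i) \<mu> > ereal (a i)"
    | (lt) i where "i \<in> {1..k-1}" "moment (\<phi> i) \<mu> < ereal (a i)"
    | (last) "moment (\<phi> k) \<mu> > ereal (a k - z)"
    using inf unfolding feasible_def moments_match_def by (metis linorder_cases not_le)
  then show ?thesis
  proof cases
    case (gt i)
    have ik: "i \<in> {1..k}" using gt by auto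
    obtain R where R: "R > 0" "(LINT x|\<mu>. min (\<phi> i x) R) > a i"
      using truncated_moment_gt[OF \<mu> ik gt(2)] by blast
    define \<eta> where "\<eta> = ((LINT x|\<mu>. min (\<phi> i x) R) - a i) / 2"
    have \<eta>: "\<eta> > 0" using R by (simp add: \<eta>_def)
    define U where "U = {\<nu> \<in> prob_measures_pos. (LINT x|\<nu>. min (\<phi> i x) R) \<in> {a i + \<eta><..}} \<times> ({0..} \<inter> (UNIV :: real set))"
    show ?thesis
    proof (rule that[of U \<eta> 1])
      show "openin state_topology U" unfolding U_def by (intro openin_state_box bdd_cont_pos_truncation[OF ik]) auto
      show "(\<mu>, z) \<in> U" using \<mu> z R by (simp add: U_def \<eta>_def field_simps)
      fix \<delta> :: real and n :: nat assume d: "\<delta> \<le> \<eta>" and n: "n \<ge> 1"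
      show "event a U \<delta> n {1..} = {}"
      proof (rule ccontr)
        assume "\<not> ?thesis"
        then obtain \<omega> where w: "\<omega> \<in> space (samples {1..})" "state n \<omega> \<in> U" "in_shell k \<phi> a \<delta> n \<omega>"
          unfolding event_def by auto
        have "a i + \<eta> < emp_mean (\<lambda>x. min (\<phi> i x) R) n \<omega>"
          using w(2) L[OF n w(1) ik] by (simp add: U_def state_def)
        also have "\<dots> \<le> emp_mean (\<phi> i) n \<omega>" by (intro emp_mean_mono) auto
        finally show False using shell[OF w(3) ik] d by simp
      qed
    qed (rule \<eta>)
  next
    case (lt i)
    have ik: "i \<in> {1..k}" using lt by auto
    obtain m where m: "moment (\<phi> i) \<mu> = ereal m"
      using lt(2) by (cases "moment (\<phi> i) \<mu>") (auto simp: moment_def)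
    then have mlt: "m < a i" using lt(2) by simp
    define \<eta> where "\<eta> = min 1 ((a i - m) / 4)"
    have "\<eta> \<le> (a i - m) / 4" unfolding \<eta>_def by (rule min.cobounded2)
    then have \<eta>: "\<eta> > 0" "\<eta> \<le> 1" "4 * \<eta> \<le> a i - m" using mlt by (auto simp: \<eta>_def)
    \<comment> \<open>chosen so that \<open>\<theta>\<close> times the mean of \<open>\<phi> k\<close> on the shell is at most \<open>\<eta>\<close>\<close>
    define \<theta> where "\<theta> = \<eta> / (\<bar>a k\<bar> + 1)"
    have \<theta>: "\<theta> > 0" using \<eta> by (simp add: \<theta>_def)
    obtain R where R: "R > 0" "\<And>x. x > 0 \<Longrightarrow> \<phi> i x \<le> min (\<phi> i x) R + \<theta> * \<phi> k x"
      using tail_domination[OF lt(1) \<theta>] by blast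
    define U where "U = {\<nu> \<in> prob_measures_pos. (LINT x|\<nu>. min (\<phi> i x) R) \<in> {..<m + \<eta>}} \<times> ({0..} \<inter> (UNIV :: real set))"
    show ?thesis
    proof (rule that[of U \<eta> 1])
      show "openin state_topology U" unfolding U_def by (intro openin_state_box bdd_cont_pos_truncation[OF ik]) auto
      show "(\<mu>, z) \<in> U" using \<mu> z \<eta> truncated_moment_le[OF \<mu> ik m, of R] by (simp add: U_def)
      fix \<delta> :: real and n :: nat assume d: "\<delta> \<le> \<eta>" and n: "n \<ge> 1"
      show "event a U \<delta> n {1..} = {}"
      proof (rule ccontr)
        assume "\<not> ?thesis"
        then obtain \<omega> where w: "\<omega> \<in> space (samples {1..})" "state n \<omega> \<in> U" "in_shell k \<phi> a \<delta> n \<omega>"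
          unfolding event_def by auto
        have "emp_mean (\<phi> i) n \<omega> \<le> emp_mean (\<lambda>x. min (\<phi> i x) R + \<theta> * \<phi> k x) n \<omega>"
          by (intro emp_mean_mono R(2) sp[OF w(1)])
        also have "\<dots> = emp_mean (\<lambda>x. min (\<phi> i x) R) n \<omega> + \<theta> * emp_mean (\<phi> k) n \<omega>" by (rule emp_mean_linear)
        also have "\<dots> \<le> (m + \<eta>) + \<theta> * (\<bar>a k\<bar> + 1)"
          using w(2) L[OF n w(1) ik, of R] shell[OF w(3) k_in] d \<eta> \<theta>
          by (intro add_mono mult_left_mono) (auto simp: U_def state_def)
        also have "\<dots> = m + 2 * \<eta>" by (simp add: \<theta>_def)
        finally show False using shell[OF w(3) ik] d \<eta> by simp
      qed
    qed (rule \<eta>)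
  next
    case last
    obtain R where R: "R > 0" "(LINT x|\<mu>. min (\<phi> k x) R) > a k - z"
      using truncated_moment_gt[OF \<mu> k_in last] by blast
    define \<eta> where "\<eta> = ((LINT x|\<mu>. min (\<phi> k x) R) - (a k - z)) / 5"
    have \<eta>: "\<eta> > 0" using R by (simp add: \<eta>_def)
    obtain N :: nat where N: "R / \<eta> < real N" using reals_Archimedean2 by blast
    define U where "U = {\<nu> \<in> prob_measures_pos. (LINT x|\<nu>. min (\<phi> k x) R) \<in> {a k - z + 4 * \<eta><..}} \<times> ({0..} \<inter> {z - \<eta><..})"
    show ?thesis
    proof (rule that[of U \<eta> "max 1 N"])
      show "openin state_topology U" unfolding U_def by (intro openin_state_box bdd_cont_pos_truncation[OF k_in]) auto
      have *: "a k - z + 4 * \<eta> < I" if "\<eta> = (I - (a k - z)) / 5" for I :: real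
      proof -
        have "5 * \<eta> = I - (a k - z)" using that by simp
        then show ?thesis using \<eta> by linarith
      qed
      from *[OF \<eta>_def] show "(\<mu>, z) \<in> U" using \<mu> z \<eta> by (simp add: U_def)
      fix \<delta> :: real and n :: nat assume d: "\<delta> \<le> \<eta>" and nN: "n \<ge> max 1 N"
      then have n: "n \<ge> 1" by simp
      have Rn: "R < \<eta> * real n"
      proof -
        have "R / \<eta> < real n" using N nN by linarith
        then show ?thesis using \<eta> by (simp add: field_simps)
      qed
      show "event a U \<delta> n {1..} = {}"
      proof (rule ccontr)
        assume "\<not> ?thesis"
        then obtain \<omega> where w: "\<omega> \<in> space (samples {1..})" "state n \<omega> \<in> U" "in_shell k \<phi> a \<delta> n \<omega>"
          unfolding event_def by auto
        obtain j where j: "j \<in> {1..n}" "scaled_max (\<phi> k) n \<omega> = \<phi> k (\<omega> j) / real n"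
          using scaled_max_attained[OF n] by blast
        have z1: "z - \<eta> < \<phi> k (\<omega> j) / real n" using w(2) j(2) by (simp add: U_def state_def)
        have z2: "a k - z + 4 * \<eta> < emp_mean (\<lambda>x. min (\<phi> k x) R) n \<omega>"
          using w(2) L[OF n w(1) k_in, of R] by (simp add: U_def state_def)
        have "(\<Sum>i=1..n. min (\<phi> k (\<omega> i)) R) = min (\<phi> k (\<omega> j)) R + (\<Sum>i\<in>{1..n}-{j}. min (\<phi> k (\<omega> i)) R)"
          using j(1) by (intro sum.remove) auto
        also have "\<dots> \<le> R + (\<Sum>i\<in>{1..n}-{j}. \<phi> k (\<omega> i))" by (intro add_mono sum_mono) auto
        also have "(\<Sum>i\<in>{1..n}-{j}. \<phi> k (\<omega> i)) = (\<Sum>i=1..n. \<phi> k (\<omega> i)) - \<phi> k (\<omega> j)"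
          using j(1) by (subst (2) sum.remove[of _ j]) auto
        finally have "(\<Sum>i=1..n. min (\<phi> k (\<omega> i)) R) / real n \<le> (R + ((\<Sum>i=1..n. \<phi> k (\<omega> i)) - \<phi> k (\<omega> j))) / real n"
          by (intro divide_right_mono) auto
        also have "\<dots> = R / real n + emp_mean (\<phi> k) n \<omega> - \<phi> k (\<omega> j) / real n"
          by (simp add: emp_mean_def add_divide_distrib diff_divide_distrib)
        finally have "emp_mean (\<lambda>x. min (\<phi> k x) R) n \<omega> \<le> R / real n + emp_mean (\<phi> k) n \<omega> - \<phi> k (\<omega> j) / real n"
          by (simp add: emp_mean_def)
        moreover have "R / real n < \<eta>" using Rn n by (simp add: field_simps)
        ultimately have "emp_mean (\<phi> k) n \<omega> > a k + \<eta>" using z1 z2 \<eta> by linarith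
        then show False using shell[OF w(3) k_in] d by linarith
      qed
    qed (rule \<eta>)
  qed
qed

text \<open>Chernoff's inequality for a nearly optimal test function of the variational formula.\<close>

lemma feasible_nbhd:
  assumes \<mu>: "\<mu> \<in> prob_measures_pos" and z: "z \<ge> 0" and f: "feasible a \<mu> z"
    and r: "ereal r \<le> - diff_entropy \<mu>" and \<epsilon>: "\<epsilon> > 0"
  obtains U where "openin state_topology U" "(\<mu>, z) \<in> U"
    "\<And>\<delta> n. n \<ge> 1 \<Longrightarrow> joint_prob a U \<delta> n \<le> exp (- real n * (r + (a 1 + ln Z) - \<epsilon>))"
proof -
  have "ereal (r + (a 1 + ln Z) - \<epsilon> / 2) < ereal r + ereal (a 1 + ln Z)" using \<epsilon> by simp
  also have "\<dots> \<le> - diff_entropy \<mu> + ereal (a 1 + ln Z)" by (intro add_mono r) simp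
  finally obtain g where g: "bdd_cont_pos g"
    "(LINT x|\<mu>. g x) - ln (LINT x|gibbs \<phi>. exp (g x)) > r + (a 1 + ln Z) - \<epsilon> / 2"
    using variational_entropy_bound[OF \<mu> feasible_moment1[OF f]] by blast
  define c where "c = (LINT x|gibbs \<phi>. exp (g x))"
  obtain B where B: "B > 0" "\<And>x. x > 0 \<Longrightarrow> \<bar>g x\<bar> \<le> B" using bdd_cont_pos_bound[OF g(1)] by blast
  note gm = bdd_cont_pos_measurable[OF g(1)]
  note ei = exp_bounded_integral(1)[OF gibbs_prob gm B(2)]
  have c: "c > 0" unfolding c_def by (rule exp_bounded_integral(2)[OF gibbs_prob gm B(2)])
  have cn: "(\<integral>\<^sup>+x. ennreal (exp (g x)) \<partial>gibbs \<phi>) \<le> ennreal c"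
    unfolding c_def by (subst nn_integral_eq_integral[OF ei]) auto
  define t where "t = (LINT x|\<mu>. g x) - \<epsilon> / 2"
  define U where "U = {\<nu> \<in> prob_measures_pos. (LINT x|\<nu>. g x) \<in> {t<..}} \<times> ({0..} \<inter> (UNIV :: real set))"
  have U: "openin state_topology U" unfolding U_def by (intro openin_state_box g) auto
  show ?thesis
  proof (rule that[OF U])
    show "(\<mu>, z) \<in> U" using \<mu> z \<epsilon> by (simp add: U_def t_def)
    fix \<delta> :: real and n :: nat assume n: "n \<ge> 1"
    interpret P: prob_space "samples {1..}" by (rule prob_space_samples)
    have "event a U \<delta> n {1..} \<subseteq> {\<omega> \<in> space (samples {1..}). emp_mean g n \<omega> \<ge> t}"
    proof
      fix \<omega> assume "\<omega> \<in> event a U \<delta> n {1..}"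
      then have w: "\<omega> \<in> space (samples {1..})" "state n \<omega> \<in> U" by (auto simp: event_def)
      have "\<omega> j > 0" if "j \<in> {1..n}" for j using space_samples[OF w(1), of j] that by auto
      from emp_measure_integral(2)[OF n this gm] w
      show "\<omega> \<in> {\<omega> \<in> space (samples {1..}). emp_mean g n \<omega> \<ge> t}" by (simp add: U_def state_def)
    qed
    moreover have [measurable]: "emp_mean g n \<in> borel_measurable (samples {1..})"
      by (rule emp_mean_measurable[OF gm]) auto
    ultimately have "joint_prob a U \<delta> n \<le> measure (samples {1..}) {\<omega> \<in> space (samples {1..}). emp_mean g n \<omega> \<ge> t}"
      unfolding joint_prob_def by (intro P.finite_measure_mono) auto
    also have "\<dots> \<le> (exp (- t) * c) ^ n" using c by (intro Chernoff_bound gm cn n) auto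
    also have "\<dots> = exp (- real n * (t - ln c))"
    proof -
      have "exp (- t) * c = exp (- (t - ln c))" using c by (simp add: exp_diff exp_minus field_simps)
      then have "(exp (- t) * c) ^ n = exp (- (t - ln c)) ^ n" by simp
      also have "\<dots> = exp (real n * (- (t - ln c)))" by (rule exp_of_nat_mult[symmetric])
      finally show ?thesis by (simp only: mult_minus_left mult_minus_right)
    qed
    also have "\<dots> \<le> exp (- real n * (r + (a 1 + ln Z) - \<epsilon>))"
      using g(2) n unfolding c_def[symmetric] by (simp add: t_def)
    finally show "joint_prob a U \<delta> n \<le> exp (- real n * (r + (a 1 + ln Z) - \<epsilon>))" .
  qed
qed

section \<open>Exponential tightness and the upper bound\<close>

text \<open>The exponential of this function is \<open>max 1 (x powr (- 1/2))\<close>, which is integrable near zero.\<close>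

definition barrier :: "real \<Rightarrow> real" where
  "barrier x = max 0 (- ln x / 2)"

lemma barrier_measurable: "barrier \<in> borel_measurable borel_pos"
  unfolding barrier_def using ln_measurable_pos by measurable

lemma barrier_exp_finite: "(\<integral>\<^sup>+x. ennreal (exp (barrier x)) \<partial>gibbs \<phi>) < \<infinity>"
proof -
  have "((\<lambda>x::real. x powr (- 1 / 2)) has_integral (1 powr (- 1 / 2 + 1) / (- 1 / 2 + 1))) {0..1}"
    by (rule has_integral_powr_from_0) auto
  then have "((\<lambda>x::real. x powr (- 1 / 2)) has_integral 2) {0..1}" by simp
  then have "((\<lambda>x::real. if x \<in> {0..1} then x powr (- 1 / 2) else 0) has_integral 2) UNIV"
    by (simp only: has_integral_restrict_UNIV)
  then have I: "(\<integral>\<^sup>+x. ennreal (if x \<in> {0..1} then x powr (- 1 / 2) else 0) \<partial>lborel) = ennreal 2"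
    by (intro nn_integral_has_integral_lborel) auto
  have "(\<integral>\<^sup>+x. ennreal (exp (barrier x)) \<partial>gibbs \<phi>)
      \<le> (\<integral>\<^sup>+x. 1 + ennreal (if x \<in> {0..1} then x powr (- 1 / 2) else 0) \<partial>gibbs \<phi>)"
  proof (rule nn_integral_mono)
    fix x assume "x \<in> space (gibbs \<phi>)"
    then have x: "x > 0" by simp
    have "exp (barrier x) \<le> 1 + (if x \<in> {0..1} then x powr (- 1 / 2) else 0)"
    proof (cases "x \<le> 1")
      case True
      then have "barrier x = - 1 / 2 * ln x" using x by (simp add: barrier_def)
      then have "exp (barrier x) = x powr (- 1 / 2)" using x by (simp add: powr_def)
      then show ?thesis using True x by simp
    next
      case False
      then have "barrier x = 0" by (simp add: barrier_def)
      then show ?thesis by simp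
    qed
    then have "ennreal (exp (barrier x)) \<le> ennreal (1 + (if x \<in> {0..1} then x powr (- 1 / 2) else 0))"
      by (rule ennreal_leI)
    also have "\<dots> = 1 + ennreal (if x \<in> {0..1} then x powr (- 1 / 2) else 0)" by simp
    finally show "ennreal (exp (barrier x)) \<le> 1 + ennreal (if x \<in> {0..1} then x powr (- 1 / 2) else 0)" .
  qed
  also have "\<dots> = 1 + (\<integral>\<^sup>+x. ennreal (if x \<in> {0..1} then x powr (- 1 / 2) else 0) \<partial>gibbs \<phi>)"
  proof (subst nn_integral_add)
    show "(\<lambda>x. ennreal (if x \<in> {0..1} then x powr (- 1 / 2) else 0)) \<in> borel_measurable (gibbs \<phi>)"
      unfolding measurable_pos_cong[OF gibbs_prob] borel_pos_def by (intro measurable_restrict_space1) measurable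
  qed (auto simp: G.emeasure_space_1[simplified])
  also have "(\<integral>\<^sup>+x. ennreal (if x \<in> {0..1} then x powr (- 1 / 2) else 0) \<partial>gibbs \<phi>)
      = (\<integral>\<^sup>+x. ennreal (exp (- \<phi> 1 x) / Z) * ennreal (if x \<in> {0..1} then x powr (- 1 / 2) else 0) \<partial>leb_pos)"
    by (rule nn_integral_gibbs) (unfold leb_pos_def, intro measurable_restrict_space1, measurable)
  also have "\<dots> \<le> (\<integral>\<^sup>+x. ennreal (1 / Z) * ennreal (if x \<in> {0..1} then x powr (- 1 / 2) else 0) \<partial>leb_pos)"
    using pos[OF one_in] Z_pos
    by (intro nn_integral_mono mult_right_mono ennreal_leI divide_right_mono) (auto intro: less_imp_le)
  also have "\<dots> = (\<integral>\<^sup>+x. (ennreal (1 / Z) * ennreal (if x \<in> {0..1} then x powr (- 1 / 2) else 0)) * indicator {0<..} x \<partial>lborel)"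
    unfolding leb_pos_def by (subst nn_integral_restrict_space) auto
  also have "\<dots> \<le> (\<integral>\<^sup>+x. ennreal (1 / Z) * ennreal (if x \<in> {0..1} then x powr (- 1 / 2) else 0) \<partial>lborel)"
    by (intro nn_integral_mono) (auto split: split_indicator)
  also have "\<dots> = ennreal (1 / Z) * ennreal 2"
    by (subst nn_integral_cmult) (auto simp only: I, measurable)
  also have "1 + ennreal (1 / Z) * ennreal 2 < \<infinity>"
    by (simp add: ennreal_mult_less_top ennreal_add_less_top)
  finally show ?thesis by (simp add: add_left_mono order_le_less_trans)
qed

lemma coercive_weight: "coercive_pos (\<lambda>x. \<phi> 1 x + barrier x)"
  unfolding coercive_pos_def
proof (intro conjI allI impI)
  show "(\<lambda>x. \<phi> 1 x + barrier x) \<in> borel_measurable borel_pos"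
    using phi_measurable[OF one_in] barrier_measurable by measurable
  show "\<phi> 1 x + barrier x \<ge> 0" if "x > 0" for x
    using pos[OF one_in that] by (simp add: barrier_def)
  fix T :: real
  have "eventually (\<lambda>x. \<phi> 1 x \<ge> T) at_top" using lim[OF one_in] by (simp add: filterlim_at_top)
  then obtain t where t: "\<And>x. x \<ge> t \<Longrightarrow> \<phi> 1 x \<ge> T" unfolding eventually_at_top_linorder by blast
  define s where "s = exp (- (2 * T))"
  show "\<exists>s t. 0 < s \<and> s < t \<and> (\<forall>x>0. x \<le> s \<or> x > t \<longrightarrow> \<phi> 1 x + barrier x \<ge> T)"
  proof (intro exI conjI allI impI)
    show "0 < s" by (simp add: s_def)
    show "s < max t (s + 1)" by simp
    fix x :: real assume x: "x > 0" and d: "x \<le> s \<or> x > max t (s + 1)"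
    show "\<phi> 1 x + barrier x \<ge> T"
    proof (cases "x \<le> s")
      case True
      then have "ln x \<le> - (2 * T)" using x by (simp add: s_def ln_ge_iff[symmetric] ln_le_cancel_iff[symmetric] del: ln_le_cancel_iff)
      then show ?thesis using pos[OF one_in x] by (simp add: barrier_def)
    next
      case False
      then show ?thesis using d t[of x] by (simp add: barrier_def)
    qed
  qed
qed

text \<open>No moment function controls small values of the samples, but the reference law has a bounded density
there, so many small samples are as unlikely as desired.\<close>

lemma exponential_tightness:
  fixes s :: real
  obtains R where "\<And>n. n \<ge> 1 \<Longrightarrow>
    measure (samples {1..}) {\<omega> \<in> space (samples {1..}). emp_mean barrier n \<omega> \<ge> R} \<le> exp (- real n * s)"
proof -
  obtain c where c: "(\<integral>\<^sup>+x. ennreal (exp (barrier x)) \<partial>gibbs \<phi>) = ennreal c" "c \<ge> 0"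
    using barrier_exp_finite by (cases "\<integral>\<^sup>+x. ennreal (exp (barrier x)) \<partial>gibbs \<phi>") auto
  define R where "R = s + ln (c + 1)"
  show ?thesis
  proof (rule that[of R])
    fix n :: nat assume n: "n \<ge> 1"
    have "measure (samples {1..}) {\<omega> \<in> space (samples {1..}). emp_mean barrier n \<omega> \<ge> R} \<le> (exp (- R) * (c + 1)) ^ n"
      using c by (intro Chernoff_bound barrier_measurable n) (auto simp: ennreal_leI simp del: ennreal_plus)
    also have "exp (- R) * (c + 1) = exp (- s)"
      using c by (simp add: R_def exp_diff exp_add field_simps)
    also have "\<dots> ^ n = exp (- real n * s)" by (simp add: exp_of_nat_mult[symmetric])
    finally show "measure (samples {1..}) {\<omega> \<in> space (samples {1..}). emp_mean barrier n \<omega> \<ge> R} \<le> exp (- real n * s)" .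
  qed
qed

lemma scaled_max_le_mean:
  assumes "n \<ge> 1" "\<And>j. j \<in> {1..n} \<Longrightarrow> \<omega> j > 0"
  shows "scaled_max (\<phi> k) n \<omega> \<le> emp_mean (\<phi> k) n \<omega>"
proof -
  obtain j where j: "j \<in> {1..n}" "scaled_max (\<phi> k) n \<omega> = \<phi> k (\<omega> j) / real n"
    using scaled_max_attained[OF assms(1)] by blast
  have "\<phi> k (\<omega> j) \<le> (\<Sum>i=1..n. \<phi> k (\<omega> i))"
    using j(1) pos[OF k_in] assms(2) by (intro member_le_sum) (auto intro: less_imp_le)
  then show ?thesis unfolding j(2) emp_mean_def by (intro divide_right_mono) auto
qed

text \<open>The union bound over a finite subcover by neighbourhoods of the two kinds, with the complement of the
closed set as one more member of the cover. A finite number of terms does not affect the rate.\<close>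

lemma joint_upper_bound:
  assumes F: "closedin state_topology F"
    and r: "\<And>\<mu> z. (\<mu>, z) \<in> F \<Longrightarrow> feasible a \<mu> z \<Longrightarrow> ereal r \<le> - diff_entropy \<mu>"
    and \<epsilon>: "\<epsilon> > 0"
  obtains \<delta>0 where "\<delta>0 > 0" "\<And>\<delta>. \<delta> \<le> \<delta>0 \<Longrightarrow>
    eventually (\<lambda>n. joint_prob a F \<delta> n \<le> exp (- real n * (r + (a 1 + ln Z) - \<epsilon>))) sequentially"
proof -
  define s where "s = r + (a 1 + ln Z) - \<epsilon> / 2"
  interpret P: prob_space "samples {1..}" by (rule prob_space_samples)
  define good where "good U \<longleftrightarrow> openin state_topology U \<and> (\<exists>\<delta>0>0. \<exists>N. \<forall>\<delta> n. \<delta> \<le> \<delta>0 \<longrightarrow> n \<ge> N \<longrightarrow>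
    measure (samples {1..}) (event a U \<delta> n {1..} \<inter> event a F \<delta> n {1..}) \<le> exp (- real n * s))" for U
  have cover: "topspace state_topology \<subseteq> \<Union>(Collect good)"
  proof
    fix p assume p: "p \<in> topspace state_topology"
    obtain \<mu> z where pe: "p = (\<mu>, z)" by (cases p)
    consider "p \<notin> F" | "p \<in> F" "\<not> feasible a \<mu> z" | "p \<in> F" "feasible a \<mu> z" by blast
    then show "p \<in> \<Union>(Collect good)"
    proof cases
      case 1
      have "event a (topspace state_topology - F) \<delta> n {1..} \<inter> event a F \<delta> n {1..} = {}" for \<delta> n
        by (auto simp: event_def)
      then have "good (topspace state_topology - F)"
        using F by (auto simp: good_def closedin_def intro!: exI[of _ 1])
      then show ?thesis using 1 p by blast
    next
      case 2
      obtain U \<delta>0 N where U: "openin state_topology U" "(\<mu>, z) \<in> U" "\<delta>0 > 0"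
        "\<And>\<delta> n. \<delta> \<le> \<delta>0 \<Longrightarrow> n \<ge> N \<Longrightarrow> event a U \<delta> n {1..} = {}"
        using infeasible_nbhd[OF p[unfolded pe] 2(2)] by blast
      then have "good U" unfolding good_def by (auto intro!: exI[of _ \<delta>0] exI[of _ N])
      then show ?thesis using U(2) pe by blast
    next
      case 3
      have \<mu>: "\<mu> \<in> prob_measures_pos" "z \<ge> 0" using p pe by auto
      obtain U where U: "openin state_topology U" "(\<mu>, z) \<in> U"
        "\<And>\<delta> n. n \<ge> 1 \<Longrightarrow> joint_prob a U \<delta> n \<le> exp (- real n * (r + (a 1 + ln Z) - \<epsilon> / 2))"
        using feasible_nbhd[OF \<mu> 3(2) r[OF 3(1)[unfolded pe] 3(2)], of "\<epsilon> / 2"] \<epsilon> by auto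
      have "measure (samples {1..}) (event a U \<delta> n {1..} \<inter> event a F \<delta> n {1..}) \<le> exp (- real n * s)" if "n \<ge> 1" for \<delta> n
      proof -
        have "measure (samples {1..}) (event a U \<delta> n {1..} \<inter> event a F \<delta> n {1..}) \<le> joint_prob a U \<delta> n"
          unfolding joint_prob_def using U(1) that by (intro P.finite_measure_mono event_measurable) auto
        with U(3)[OF that, of \<delta>] show ?thesis by (simp add: s_def)
      qed
      then have "good U" unfolding good_def using U(1) by (auto intro!: exI[of _ "1::real"] exI[of _ "1::nat"])
      then show ?thesis using U(2) pe by blast
    qed
  qed
  obtain R where R: "\<And>n. n \<ge> 1 \<Longrightarrow>
    measure (samples {1..}) {\<omega> \<in> space (samples {1..}). emp_mean barrier n \<omega> \<ge> R} \<le> exp (- real n * s)"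
    using exponential_tightness by blast
  obtain \<F> where \<F>: "finite \<F>" "\<F> \<subseteq> Collect good"
    "\<And>\<nu> z. \<nu> \<in> prob_measures_pos \<Longrightarrow> (\<integral>\<^sup>+x. ennreal (\<phi> 1 x + barrier x) \<partial>\<nu>) \<le> ennreal (a 1 + 1 + R) \<Longrightarrow> 0 \<le> z \<Longrightarrow> z \<le> a k + 1 \<Longrightarrow>
       (\<nu>, z) \<in> \<Union>\<F>"
    using coercive_finite_subcover[OF coercive_weight _ cover, of "a 1 + 1 + R" "a k + 1"]
    unfolding good_def by auto
  have "\<forall>U\<in>\<F>. \<exists>\<delta>0>0. \<exists>N. \<forall>\<delta> n. \<delta> \<le> \<delta>0 \<longrightarrow> n \<ge> N \<longrightarrow>
    measure (samples {1..}) (event a U \<delta> n {1..} \<inter> event a F \<delta> n {1..}) \<le> exp (- real n * s)"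
    using \<F>(2) by (auto simp: good_def)
  then obtain d N where dN: "\<And>U. U \<in> \<F> \<Longrightarrow> d U > (0::real)"
    "\<And>U \<delta> n. U \<in> \<F> \<Longrightarrow> \<delta> \<le> d U \<Longrightarrow> n \<ge> N U \<Longrightarrow>
      measure (samples {1..}) (event a U \<delta> n {1..} \<inter> event a F \<delta> n {1..}) \<le> exp (- real n * s)"
    by metis
  define \<delta>0 where "\<delta>0 = Min (insert 1 (d ` \<F>))"
  show ?thesis
  proof (rule that[of \<delta>0])
    show "\<delta>0 > 0" unfolding \<delta>0_def using \<F>(1) dN(1) by (subst Min_gr_iff) auto
    fix \<delta> assume \<delta>: "\<delta> \<le> \<delta>0"
    have \<delta>1: "\<delta> \<le> 1" using \<delta> \<F>(1) unfolding \<delta>0_def by (subst (asm) Min_ge_iff) auto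
    have \<delta>d: "\<delta> \<le> d U" if "U \<in> \<F>" for U
      using \<delta> \<F>(1) that unfolding \<delta>0_def by (subst (asm) Min_ge_iff) auto
    have "eventually (\<lambda>n. \<forall>U\<in>\<F>. n \<ge> N U) sequentially"
      using \<F>(1) by (intro eventually_ball_finite ballI eventually_ge_at_top)
    moreover have "eventually (\<lambda>n. real (card \<F> + 1) \<le> exp (real n * (\<epsilon> / 2))) sequentially"
    proof -
      have "filterlim (\<lambda>n. exp (real n * (\<epsilon> / 2))) at_top sequentially"
        using \<epsilon> by real_asymp
      then show ?thesis unfolding filterlim_at_top by blast
    qed
    moreover have "eventually (\<lambda>n. n \<ge> (1::nat)) sequentially" by (rule eventually_ge_at_top)
    ultimately show "eventually (\<lambda>n. joint_prob a F \<delta> n \<le> exp (- real n * (r + (a 1 + ln Z) - \<epsilon>))) sequentially"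
    proof eventually_elim
      case (elim n)
      note n = elim(3)
      let ?T = "{\<omega> \<in> space (samples {1..}). emp_mean barrier n \<omega> \<ge> R}"
      let ?E = "\<lambda>U. event a U \<delta> n {1..} \<inter> event a F \<delta> n {1..}"
      have [measurable]: "emp_mean barrier n \<in> borel_measurable (samples {1..})"
        by (rule emp_mean_measurable[OF barrier_measurable]) auto
      have Ts: "?T \<in> sets (samples {1..})" by measurable
      have Es: "?E U \<in> sets (samples {1..})" if "U \<in> \<F>" for U
        using F \<F>(2) that n by (intro sets.Int event_measurable) (auto simp: good_def)
      have Us: "(\<Union>U\<in>\<F>. ?E U) \<in> sets (samples {1..})"
        by (rule sets.finite_UN[OF \<F>(1) Es])
      have sub: "event a F \<delta> n {1..} \<subseteq> (\<Union>U\<in>\<F>. ?E U) \<union> ?T"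
      proof
        fix \<omega> assume wF: "\<omega> \<in> event a F \<delta> n {1..}"
        then have w: "\<omega> \<in> space (samples {1..})" "in_shell k \<phi> a \<delta> n \<omega>" by (auto simp: event_def)
        have wp: "\<omega> j > 0" if "j \<in> {1..n}" for j using space_samples[OF w(1), of j] that by auto
        show "\<omega> \<in> (\<Union>U\<in>\<F>. ?E U) \<union> ?T"
        proof (cases "emp_mean barrier n \<omega> \<ge> R")
          case True
          then show ?thesis using w by auto
        next
          case False
          have sh: "\<bar>emp_mean (\<phi> i) n \<omega> - a i\<bar> \<le> \<delta>" if "i \<in> {1..k}" for i
            using w(2) that by (auto simp: in_shell_def)
          have wm: "(\<lambda>x. \<phi> 1 x + barrier x) \<in> borel_measurable borel_pos"
            using coercive_weight by (simp add: coercive_pos_def)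
          have wn: "x > 0 \<Longrightarrow> \<phi> 1 x + barrier x \<ge> 0" for x
            using coercive_weight by (simp add: coercive_pos_def)
          have "emp_mean (\<lambda>x. \<phi> 1 x + 1 * barrier x) n \<omega> = emp_mean (\<phi> 1) n \<omega> + 1 * emp_mean barrier n \<omega>"
            by (rule emp_mean_linear)
          then have "emp_mean (\<lambda>x. \<phi> 1 x + barrier x) n \<omega> \<le> a 1 + 1 + R"
            using False sh[OF one_in] \<delta>1 by simp
          then have "(\<integral>\<^sup>+x. ennreal (\<phi> 1 x + barrier x) \<partial>emp_measure n \<omega>) \<le> ennreal (a 1 + 1 + R)"
            using emp_measure_integral(3)[OF n wp wm wn] by (simp add: ennreal_leI del: ennreal_plus)
          moreover have "scaled_max (\<phi> k) n \<omega> \<le> a k + 1"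
          proof -
            have "scaled_max (\<phi> k) n \<omega> \<le> emp_mean (\<phi> k) n \<omega>" by (rule scaled_max_le_mean[OF n wp])
            then show ?thesis using sh[OF k_in] \<delta>1 by simp
          qed
          moreover have "state n \<omega> \<in> topspace state_topology" by (rule state_in_topspace[OF n wp])
          ultimately have "state n \<omega> \<in> \<Union>\<F>"
            unfolding state_def by (intro \<F>(3)) (simp_all add: state_def)
          then obtain U where "U \<in> \<F>" "state n \<omega> \<in> U" by auto
          then show ?thesis using w wF by (auto simp: event_def)
        qed
      qed
      have "joint_prob a F \<delta> n \<le> measure (samples {1..}) ((\<Union>U\<in>\<F>. ?E U) \<union> ?T)"
        unfolding joint_prob_def by (rule P.finite_measure_mono[OF sub sets.Un[OF Us Ts]])
      also have "\<dots> \<le> measure (samples {1..}) (\<Union>U\<in>\<F>. ?E U) + measure (samples {1..}) ?T"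
        by (rule measure_Un_le[OF Us Ts])
      also have "\<dots> \<le> (\<Sum>U\<in>\<F>. measure (samples {1..}) (?E U)) + exp (- real n * s)"
        by (intro add_mono measure_UNION_le \<F>(1) Es R[OF n])
      also have "\<dots> \<le> (\<Sum>U\<in>\<F>. exp (- real n * s)) + exp (- real n * s)"
        using dN(2) \<delta>d elim(1) by (intro add_mono sum_mono) auto
      also have "\<dots> = real (card \<F> + 1) * exp (- real n * s)" by (simp add: algebra_simps)
      also have "\<dots> \<le> exp (real n * (\<epsilon> / 2)) * exp (- real n * s)"
        using elim(2) by (intro mult_right_mono) auto
      also have "\<dots> = exp (- real n * (r + (a 1 + ln Z) - \<epsilon>))"
        unfolding exp_add[symmetric] s_def by (simp add: field_simps)
      finally show ?case .
    qed
  qed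
qed

end

section \<open>Product measures under a change of density\<close>

text \<open>Hoeffding's inequality for a block of coordinates with a common law inside a finite product.\<close>

lemma hoeffding_product:
  fixes M :: "nat \<Rightarrow> real measure" and g :: "real \<Rightarrow> real"
  assumes M: "\<And>j. prob_space (M j)" and I: "finite I" and J: "J \<subseteq> I" "J \<noteq> {}"
    and \<nu>: "\<And>j. j \<in> J \<Longrightarrow> M j = \<nu>" and g: "g \<in> borel_measurable \<nu>"
    and R: "AE x in \<nu>. \<bar>g x\<bar> \<le> R" "R > 0" and \<eta>: "\<eta> \<ge> 0"
  shows "measure (PiM I M) {\<omega> \<in> space (PiM I M).
      \<bar>(\<Sum>j\<in>J. g (\<omega> j)) - real (card J) * (LINT x|\<nu>. g x)\<bar> \<ge> real (card J) * \<eta>}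
    \<le> 2 * exp (- (real (card J) * \<eta>\<^sup>2 / (2 * R\<^sup>2)))"
proof -
  let ?P = "PiM I M"
  interpret product_prob_space M by (intro product_prob_spaceI M)
  interpret P: prob_space ?P by (rule prob_space_PiM) (rule M)
  have finJ: "finite J" using I J finite_subset by blast
  obtain j0 where j0: "j0 \<in> J" using J by auto
  have coord: "(\<lambda>\<omega>. \<omega> j) \<in> measurable ?P (M j)" if "j \<in> J" for j
    using that J by (intro measurable_component_singleton) auto
  have dM: "distr ?P (M j) (\<lambda>\<omega>. \<omega> j) = M j" if "j \<in> J" for j
    using that J by (intro distr_PiM_component M) auto
  have indep0: "P.indep_vars M (\<lambda>j \<omega>. \<omega> j) J"
  proof (subst P.indep_vars_iff_distr_eq_PiM'[OF J(2) coord])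
    have "distr ?P (PiM J M) (\<lambda>\<omega>. \<lambda>j\<in>J. \<omega> j) = PiM J M"
      using distr_restrict[OF J(1) I] by simp
    also have "\<dots> = PiM J (\<lambda>j. distr ?P (M j) (\<lambda>\<omega>. \<omega> j))"
      by (intro PiM_cong refl) (simp add: dM)
    finally show "distr ?P (PiM J M) (\<lambda>\<omega>. \<lambda>j\<in>J. \<omega> j) = PiM J (\<lambda>j. distr ?P (M j) (\<lambda>\<omega>. \<omega> j))" .
  qed
  have gM: "g \<in> borel_measurable (M j)" if "j \<in> J" for j using g \<nu>[OF that] by simp
  have rv: "(\<lambda>\<omega>. g (\<omega> j)) \<in> borel_measurable ?P" if "j \<in> J" for j
    by (rule measurable_compose[OF coord[OF that] gM[OF that]])
  have dg: "distr ?P borel (\<lambda>\<omega>. g (\<omega> j)) = distr \<nu> borel g" if "j \<in> J" for j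
  proof -
    have "distr ?P borel (\<lambda>\<omega>. g (\<omega> j)) = distr (distr ?P (M j) (\<lambda>\<omega>. \<omega> j)) borel g"
      using distr_distr[OF gM[OF that] coord[OF that]] by (simp add: comp_def)
    then show ?thesis using dM[OF that] \<nu>[OF that] by simp
  qed
  interpret H: Hoeffding_ineq_iid ?P J "\<lambda>j \<omega>. g (\<omega> j)" "\<lambda>\<omega>. g (\<omega> j0)" "- R" R "LINT x|\<nu>. g x"
  proof (unfold_locales)
    show "finite J" by fact
    show "P.indep_vars (\<lambda>_. borel) (\<lambda>j \<omega>. g (\<omega> j)) J"
      by (rule P.indep_vars_compose2[OF indep0 gM])
    show "distr ?P borel (\<lambda>\<omega>. g (\<omega> j)) = distr ?P borel (\<lambda>\<omega>. g (\<omega> j0))" if "j \<in> J" for j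
      using dg that j0 by simp
    show "(\<lambda>\<omega>. g (\<omega> j0)) \<in> borel_measurable ?P" by (rule rv[OF j0])
    have "AE x in M j0. \<bar>g x\<bar> \<le> R" using R(1) unfolding \<nu>[OF j0] .
    then have "AE \<omega> in ?P. \<bar>g (\<omega> j0)\<bar> \<le> R"
      using J j0 by (intro AE_PiM_component M) auto
    then show "AE \<omega> in ?P. g (\<omega> j0) \<in> {- R..R}" by eventually_elim auto
    have "(LINT x|\<nu>. g x) = (LINT y|distr \<nu> borel g. y)"
      using g by (subst integral_distr) auto
    also have "\<dots> = (LINT \<omega>|?P. g (\<omega> j0))"
      unfolding dg[OF j0, symmetric] using rv[OF j0] by (subst integral_distr) auto
    finally show "(LINT x|\<nu>. g x) \<equiv> P.expectation (\<lambda>\<omega>. g (\<omega> j0))" by simp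
  qed
  have c: "real (card J) > 0" using J finJ by (simp add: card_gt_0_iff)
  have "2 * (real (card J) * \<eta>)\<^sup>2 / (real (card J) * (R - - R)\<^sup>2) = real (card J) * \<eta>\<^sup>2 / (2 * R\<^sup>2)"
    using c R(2) by (simp add: power2_eq_square field_simps)
  then show ?thesis
    using H.Hoeffding_ineq_abs_ge[of "real (card J) * \<eta>"] c \<eta> R(2) J(2) by simp
qed

text \<open>A product of densities is the density of the product, so a bound on it over \<open>E\<close> transfers a lower
bound for the probability of \<open>E\<close> from the tilted to the original measure.\<close>

lemma change_of_measure_product:
  fixes L :: "'a measure" and g :: "nat \<Rightarrow> 'a \<Rightarrow> real"
  assumes L: "prob_space L" and I: "finite I"
    and g: "\<And>j. g j \<in> borel_measurable L" "\<And>j x. g j x \<ge> 0" "\<And>j. prob_space (density L (\<lambda>x. ennreal (g j x)))"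
    and E: "E \<in> sets (PiM I (\<lambda>_. L))" and C: "C \<ge> 0" "\<And>\<omega>. \<omega> \<in> E \<Longrightarrow> (\<Prod>j\<in>I. g j (\<omega> j)) \<le> C"
  shows "measure (PiM I (\<lambda>j. density L (\<lambda>x. ennreal (g j x)))) E \<le> C * measure (PiM I (\<lambda>_. L)) E"
proof -
  let ?P = "PiM I (\<lambda>_. L)"
  let ?M = "\<lambda>j. density L (\<lambda>x. ennreal (g j x))"
  let ?W = "\<lambda>\<omega>. \<Prod>j\<in>I. ennreal (g j (\<omega> j))"
  interpret P: product_prob_space "\<lambda>_. L" I by (intro product_prob_spaceI L)
  interpret M: product_prob_space ?M I by (intro product_prob_spaceI g)
  have fin_P: "emeasure ?P E = ennreal (measure ?P E)" for E
    by (intro finite_measure.emeasure_eq_measure prob_space.finite_measure prob_space_PiM L)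
  have fin_Q: "emeasure (PiM I ?M) E = ennreal (measure (PiM I ?M) E)" for E
    by (intro finite_measure.emeasure_eq_measure prob_space.finite_measure prob_space_PiM g)
  note g(1)[measurable]
  have W[measurable]: "?W \<in> borel_measurable ?P" by measurable
  have "density ?P ?W = PiM I ?M"
  proof (rule M.PiM_eqI[OF I])
    show "sets (density ?P ?W) = sets (PiM I ?M)" unfolding sets_density by (intro sets_PiM_cong) auto
    fix A assume A: "\<And>i. i \<in> I \<Longrightarrow> A i \<in> sets (?M i)"
    then have A': "\<And>i. i \<in> I \<Longrightarrow> A i \<in> sets L" by simp
    then have "PiE I A \<in> sets ?P" using I by (intro sets_PiM_I_finite) auto
    then have "emeasure (density ?P ?W) (PiE I A) = (\<integral>\<^sup>+\<omega>. ?W \<omega> * indicator (PiE I A) \<omega> \<partial>?P)"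
      by (intro emeasure_density W)
    also have "\<dots> = (\<integral>\<^sup>+\<omega>. (\<Prod>j\<in>I. ennreal (g j (\<omega> j)) * indicator (A j) (\<omega> j)) \<partial>?P)"
    proof (rule nn_integral_cong)
      fix \<omega> assume "\<omega> \<in> space ?P"
      then have ext: "\<omega> \<in> extensional I" by (auto simp: space_PiM PiE_def)
      show "?W \<omega> * indicator (PiE I A) \<omega> = (\<Prod>j\<in>I. ennreal (g j (\<omega> j)) * indicator (A j) (\<omega> j))"
      proof (cases "\<forall>j\<in>I. \<omega> j \<in> A j")
        case True
        then have "\<omega> \<in> PiE I A" using ext by (auto simp: PiE_def)
        then show ?thesis using True by (simp cong: prod.cong)
      next
        case False
        then obtain j where "j \<in> I" "\<omega> j \<notin> A j" by auto
        then have "(\<Prod>j\<in>I. ennreal (g j (\<omega> j)) * indicator (A j) (\<omega> j)) = 0" "\<omega> \<notin> PiE I A"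
          using I by (auto intro!: prod_zero bexI[of _ j])
        then show ?thesis by simp
      qed
    qed
    also have "\<dots> = (\<Prod>j\<in>I. \<integral>\<^sup>+x. ennreal (g j x) * indicator (A j) x \<partial>L)"
      using I A' by (intro P.product_nn_integral_prod) auto
    also have "\<dots> = (\<Prod>j\<in>I. emeasure (?M j) (A j))"
      using A' by (intro prod.cong refl emeasure_density[symmetric]) auto
    finally show "emeasure (density ?P ?W) (PiE I A) = (\<Prod>j\<in>I. emeasure (?M j) (A j))" .
  qed
  then have "emeasure (PiM I ?M) E = (\<integral>\<^sup>+\<omega>. ?W \<omega> * indicator E \<omega> \<partial>?P)"
    using E by (subst emeasure_density[OF W, symmetric]) auto
  also have "\<dots> \<le> (\<integral>\<^sup>+\<omega>. ennreal C * indicator E \<omega> \<partial>?P)"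
    using C(2) g(2) by (intro nn_integral_mono) (auto simp: prod_ennreal split: split_indicator intro!: ennreal_leI)
  also have "\<dots> = ennreal C * emeasure ?P E" using E by (rule nn_integral_cmult_indicator)
  finally show ?thesis
    using C(1) by (simp add: fin_P fin_Q ennreal_mult[symmetric])
qed

text \<open>Restricting \<open>\<mu>\<close> to the set where finitely many integrable functions are bounded changes their means
arbitrarily little, by dominated convergence; it replaces the law of large numbers for integrable
functions by the one for bounded functions.\<close>

lemma bounded_truncation:
  assumes \<mu>: "\<mu> \<in> prob_measures_pos" and fin: "finite \<G>"
    and G: "\<And>g. g \<in> \<G> \<Longrightarrow> g \<in> borel_measurable borel_pos" "\<And>g. g \<in> \<G> \<Longrightarrow> integrable \<mu> g"
    and S: "S \<in> sets borel_pos" "AE x in \<mu>. x \<in> S" and \<eta>: "\<eta> > 0"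
  obtains B R where "B \<in> sets borel_pos" "B \<subseteq> S" "R > 0" "measure \<mu> B > 0"
    "\<And>g x. g \<in> \<G> \<Longrightarrow> x \<in> B \<Longrightarrow> \<bar>g x\<bar> \<le> R"
    "\<And>g. g \<in> \<G> \<Longrightarrow> \<bar>(LINT x|\<mu>. indicator B x * g x) / measure \<mu> B - (LINT x|\<mu>. g x)\<bar> \<le> \<eta>"
    "- ln (measure \<mu> B) \<le> \<eta>"
proof -
  interpret prob_space \<mu> using \<mu> prob_measures_posD by auto
  define B where "B n = {x \<in> S. \<forall>g\<in>\<G>. \<bar>g x\<bar> \<le> real n}" for n :: nat
  have Bs: "B n \<in> sets borel_pos" for n
  proof -
    have "S \<subseteq> space borel_pos" using S(1) by (rule sets.sets_into_space)
    then have "B n = S \<inter> {x \<in> space borel_pos. \<forall>g\<in>\<G>. \<bar>g x\<bar> \<le> real n}" by (auto simp: B_def)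
    moreover have "{x \<in> space borel_pos. \<forall>g\<in>\<G>. \<bar>g x\<bar> \<le> real n} \<in> sets borel_pos"
    proof (intro sets.sets_Collect_finite_All fin)
      fix g assume "g \<in> \<G>"
      note G(1)[OF this, measurable]
      show "{x \<in> space borel_pos. \<bar>g x\<bar> \<le> real n} \<in> sets borel_pos" by measurable
    qed
    ultimately show ?thesis using S(1) by simp
  qed
  then have Bs': "B n \<in> sets \<mu>" for n using prob_measures_posD(2)[OF \<mu>] by simp
  have ev: "AE x in \<mu>. eventually (\<lambda>n. x \<in> B n) sequentially"
    using S(2)
  proof eventually_elim
    case (elim x)
    have "eventually (\<lambda>n. \<forall>g\<in>\<G>. \<bar>g x\<bar> \<le> real n) sequentially"
    proof (intro eventually_ball_finite fin ballI)
      fix g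
      obtain n0 :: nat where "\<bar>g x\<bar> \<le> real n0" using real_arch_simple by blast
      then show "eventually (\<lambda>n. \<bar>g x\<bar> \<le> real n) sequentially"
        by (intro eventually_mono[OF eventually_ge_at_top[of n0]]) linarith
    qed
    then show ?case by eventually_elim (use elim in \<open>auto simp: B_def\<close>)
  qed
  have lim: "(\<lambda>n. LINT x|\<mu>. indicator (B n) x * g x) \<longlonglongrightarrow> (LINT x|\<mu>. g x)" if "integrable \<mu> g" for g :: "real \<Rightarrow> real"
  proof (rule integral_dominated_convergence[where w="\<lambda>x. \<bar>g x\<bar>"])
    show "AE x in \<mu>. (\<lambda>n. indicator (B n) x * g x) \<longlonglongrightarrow> g x"
      using ev
    proof eventually_elim
      case (elim x)
      then have "eventually (\<lambda>n. indicator (B n) x * g x = g x) sequentially" by eventually_elim simp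
      then show ?case by (rule tendsto_eventually)
    qed
    show "(\<lambda>x. indicator (B n) x * g x) \<in> borel_measurable \<mu>" for n
      using Bs' borel_measurable_integrable[OF that] by measurable
  qed (use that in \<open>auto split: split_indicator\<close>)
  have m1: "(\<lambda>n. measure \<mu> (B n)) \<longlonglongrightarrow> 1"
    using lim[of "\<lambda>_. 1"] Bs' by (simp add: prob_space)
  have r: "eventually (\<lambda>n. \<forall>g\<in>\<G>. \<bar>(LINT x|\<mu>. indicator (B n) x * g x) / measure \<mu> (B n) - (LINT x|\<mu>. g x)\<bar> < \<eta>) sequentially"
  proof (intro eventually_ball_finite fin ballI)
    fix g assume g: "g \<in> \<G>"
    have "(\<lambda>n. (LINT x|\<mu>. indicator (B n) x * g x) / measure \<mu> (B n)) \<longlonglongrightarrow> (LINT x|\<mu>. g x) / 1"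
      by (intro tendsto_divide lim G(2) g m1) simp
    then show "eventually (\<lambda>n. \<bar>(LINT x|\<mu>. indicator (B n) x * g x) / measure \<mu> (B n) - (LINT x|\<mu>. g x)\<bar> < \<eta>) sequentially"
      using \<eta> by (simp add: tendsto_iff dist_real_def)
  qed
  have "(\<lambda>n. - ln (measure \<mu> (B n))) \<longlonglongrightarrow> - ln 1" by (intro tendsto_intros m1) auto
  then have l: "eventually (\<lambda>n. - ln (measure \<mu> (B n)) < \<eta>) sequentially"
    using \<eta> by (intro order_tendstoD) auto
  have p: "eventually (\<lambda>n. measure \<mu> (B n) > 0) sequentially"
    by (rule order_tendstoD(1)[OF m1]) simp
  have "eventually (\<lambda>n. (\<forall>g\<in>\<G>. \<bar>(LINT x|\<mu>. indicator (B n) x * g x) / measure \<mu> (B n) - (LINT x|\<mu>. g x)\<bar> < \<eta>)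
      \<and> - ln (measure \<mu> (B n)) < \<eta> \<and> measure \<mu> (B n) > 0 \<and> n \<ge> 1) sequentially"
    using r l p eventually_ge_at_top[of "1::nat"] by eventually_elim simp
  then obtain n where n: "\<forall>g\<in>\<G>. \<bar>(LINT x|\<mu>. indicator (B n) x * g x) / measure \<mu> (B n) - (LINT x|\<mu>. g x)\<bar> < \<eta>"
    "- ln (measure \<mu> (B n)) < \<eta>" "measure \<mu> (B n) > 0" "n \<ge> 1"
    unfolding eventually_sequentially by blast
  show ?thesis
  proof (rule that[of "B n" "real n"])
    show "\<bar>g x\<bar> \<le> real n" if "g \<in> \<G>" "x \<in> B n" for g x using that by (simp add: B_def)
    show "\<bar>(LINT x|\<mu>. indicator (B n) x * g x) / measure \<mu> (B n) - (LINT x|\<mu>. g x)\<bar> \<le> \<eta>" if "g \<in> \<G>" for g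
      using n(1) that less_imp_le by blast
    show "B n \<in> sets borel_pos" by (rule Bs)
    show "B n \<subseteq> S" by (auto simp: B_def)
  qed (use n in auto)
qed

context moment_functions
begin

section \<open>Tilting and single large jumps\<close>

lemma density_gibbs_lebd:
  assumes \<mu>: "\<mu> \<in> prob_measures_pos" "absolutely_continuous leb_pos \<mu>"
  shows "density (gibbs \<phi>) (\<lambda>x. ennreal (lebd \<mu> x * Z * exp (\<phi> 1 x))) = \<mu>"
proof -
  have "density (gibbs \<phi>) (\<lambda>x. ennreal (lebd \<mu> x * Z * exp (\<phi> 1 x)))
      = density leb_pos (\<lambda>x. ennreal (exp (- \<phi> 1 x) / Z) * ennreal (lebd \<mu> x * Z * exp (\<phi> 1 x)))"
    unfolding gibbs_eq by (subst density_density_eq) measurable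
  also have "\<dots> = density leb_pos (\<lambda>x. ennreal (lebd \<mu> x))"
    using Z_pos by (intro density_cong) (auto simp: ennreal_mult[symmetric] exp_minus)
  also have "\<dots> = \<mu>" by (rule density_lebd[OF \<mu>])
  finally show ?thesis .
qed

text \<open>The density, with respect to the reference law, of \<open>\<mu>\<close> conditioned on \<open>B\<close>.\<close>

definition tilt :: "real measure \<Rightarrow> real set \<Rightarrow> real \<Rightarrow> real" where
  "tilt \<mu> B x = indicator B x * (lebd \<mu> x * Z * exp (\<phi> 1 x)) / measure \<mu> B"

lemma tilt_nonneg: "tilt \<mu> B x \<ge> 0"
  using Z_pos by (simp add: tilt_def)

lemma tilt_measurable:
  assumes "B \<in> sets borel_pos" shows "tilt \<mu> B \<in> borel_measurable (gibbs \<phi>)"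
proof -
  have [measurable]: "B \<in> sets leb_pos" using assms sets_leb_pos by simp
  have "tilt \<mu> B \<in> borel_measurable leb_pos" unfolding tilt_def by measurable
  then show ?thesis unfolding gibbs_eq by simp
qed

lemma tilted_measure:
  assumes \<mu>: "\<mu> \<in> prob_measures_pos" "absolutely_continuous leb_pos \<mu>"
    and B: "B \<in> sets borel_pos" "measure \<mu> B > 0"
  defines "\<nu> \<equiv> density (gibbs \<phi>) (\<lambda>x. ennreal (tilt \<mu> B x))"
  shows "prob_space \<nu>" "AE x in \<nu>. x \<in> B"
    "g \<in> borel_measurable borel_pos \<Longrightarrow> (LINT x|\<nu>. g x) = (LINT x|\<mu>. indicator B x * g x) / measure \<mu> B"
proof -
  interpret M: prob_space \<mu> using \<mu> prob_measures_posD by auto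
  have Bm[measurable]: "B \<in> sets \<mu>" using B prob_measures_posD(2)[OF \<mu>(1)] by simp
  have BG[measurable]: "B \<in> sets (gibbs \<phi>)" using B sets_gibbs by simp
  have \<nu>: "\<nu> = density \<mu> (\<lambda>x. ennreal (indicator B x / measure \<mu> B))"
  proof -
    have m: "(\<lambda>x. lebd \<mu> x * Z * exp (\<phi> 1 x)) \<in> borel_measurable (gibbs \<phi>)"
      unfolding gibbs_eq by measurable
    have "density \<mu> (\<lambda>x. ennreal (indicator B x / measure \<mu> B))
        = density (density (gibbs \<phi>) (\<lambda>x. ennreal (lebd \<mu> x * Z * exp (\<phi> 1 x)))) (\<lambda>x. ennreal (indicator B x / measure \<mu> B))"
      by (simp add: density_gibbs_lebd[OF \<mu>])
    also have "\<dots> = density (gibbs \<phi>) (\<lambda>x. ennreal (lebd \<mu> x * Z * exp (\<phi> 1 x)) * ennreal (indicator B x / measure \<mu> B))"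
      using m by (intro density_density_eq) auto
    also have "(\<lambda>x. ennreal (lebd \<mu> x * Z * exp (\<phi> 1 x)) * ennreal (indicator B x / measure \<mu> B)) = (\<lambda>x. ennreal (tilt \<mu> B x))"
      using Z_pos by (intro ext) (simp add: ennreal_mult[symmetric] tilt_def mult_ac)
    finally show ?thesis by (simp add: \<nu>_def)
  qed
  have "emeasure \<nu> (space \<nu>) = (\<integral>\<^sup>+x. ennreal (indicator B x / measure \<mu> B) \<partial>\<mu>)"
    unfolding \<nu> by (simp add: emeasure_density cong: nn_integral_cong)
  also have "\<dots> = (\<integral>\<^sup>+x. ennreal (1 / measure \<mu> B) * indicator B x \<partial>\<mu>)"
    by (intro nn_integral_cong) (auto split: split_indicator)
  also have "\<dots> = ennreal (1 / measure \<mu> B) * emeasure \<mu> B" by (rule nn_integral_cmult_indicator[OF Bm])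
  also have "\<dots> = 1" using B(2) by (simp add: M.emeasure_eq_measure ennreal_mult[symmetric])
  finally show "prob_space \<nu>" by (rule prob_spaceI)
  show "AE x in \<nu>. x \<in> B"
    unfolding \<nu> by (subst AE_density) (auto split: split_indicator)
  show "(LINT x|\<nu>. g x) = (LINT x|\<mu>. indicator B x * g x) / measure \<mu> B" if g: "g \<in> borel_measurable borel_pos"
  proof -
    have "g \<in> borel_measurable \<mu>" using g by (simp add: measurable_pos_cong[OF \<mu>(1)])
    then have "(LINT x|\<nu>. g x) = (LINT x|\<mu>. (indicator B x / measure \<mu> B) *\<^sub>R g x)"
      unfolding \<nu> by (intro integral_density) auto
    also have "\<dots> = (LINT x|\<mu>. (indicator B x * g x) / measure \<mu> B)" by simp
    also have "\<dots> = (LINT x|\<mu>. indicator B x * g x) / measure \<mu> B" by simp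
    finally show ?thesis .
  qed
qed

text \<open>Positions at which a single sample contributes between \<open>t + \<tau>\<close> and \<open>t + 2 * \<tau>\<close> to the mean of \<open>\<phi> k\<close>.
The window stays away from \<open>t\<close> so that its left end tends to infinity even for \<open>t = 0\<close>.\<close>

definition jump_set :: "real \<Rightarrow> real \<Rightarrow> nat \<Rightarrow> real set" where
  "jump_set t \<tau> n = {x \<in> {0<..}. real n * (t + \<tau>) \<le> \<phi> k x \<and> \<phi> k x \<le> real n * (t + 2 * \<tau>)}"

lemma jump_set_sets: "jump_set t \<tau> n \<in> sets borel_pos"
proof -
  note phi_measurable[OF k_in, measurable]
  have "{x \<in> space borel_pos. real n * (t + \<tau>) \<le> \<phi> k x \<and> \<phi> k x \<le> real n * (t + 2 * \<tau>)} \<in> sets borel_pos"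
    by measurable
  then show ?thesis by (simp add: jump_set_def)
qed

lemma jump_set_far:
  assumes t: "t \<ge> 0" "\<tau> > 0"
  shows "eventually (\<lambda>n. \<forall>x\<in>jump_set t \<tau> n. x > X) sequentially"
proof -
  \<comment> \<open>positive, so that monotonicity of \<open>\<phi> k\<close> on the half-line applies\<close>
  define X' where "X' = max X 1"
  have "filterlim (\<lambda>n. real n * \<tau>) at_top sequentially" using t by real_asymp
  then have "eventually (\<lambda>n. real n * \<tau> > \<phi> k X') sequentially" by (simp add: filterlim_at_top_dense)
  then show ?thesis
  proof eventually_elim
    case (elim n)
    show ?case
    proof
      fix x assume x: "x \<in> jump_set t \<tau> n"
      have "real n * \<tau> \<le> real n * (t + \<tau>)" using t by (intro mult_left_mono) auto
      then have "\<phi> k X' < \<phi> k x" using elim x by (auto simp: jump_set_def)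
      moreover have "\<phi> k x \<le> \<phi> k X'" if "x \<le> X'"
        using mono_onD[OF mono[OF k_in], of x X'] that x by (auto simp: jump_set_def X'_def)
      ultimately show "x > X" by (force simp: X'_def)
    qed
  qed
qed

text \<open>Far out, \<open>\<phi> i powr \<kappa> \<le> \<phi> k\<close>, which on the jump set is at most of order \<open>n\<close>; since \<open>\<kappa> > 1\<close>, \<open>\<phi> i\<close> is of
smaller order than \<open>n\<close>.\<close>

lemma jump_small_moments:
  assumes t: "t \<ge> 0" "\<tau> > 0" and \<epsilon>: "\<epsilon> > 0" and i: "i \<in> {1..k-1}"
  shows "eventually (\<lambda>n. \<forall>x\<in>jump_set t \<tau> n. \<phi> i x \<le> \<epsilon> * real n) sequentially"
proof -
  obtain \<kappa> X where \<kappa>: "\<kappa> > 1" "X > 0"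
    "\<And>i x. i \<in> {1..k-1} \<Longrightarrow> x \<ge> X \<Longrightarrow> \<phi> i x \<ge> 1 \<and> \<phi> i x powr \<kappa> \<le> \<phi> k x"
    using dominated_by_last by blast
  define T where "T = t + 2 * \<tau>"
  have T: "T > 0" using t by (simp add: T_def)
  have "(\<lambda>n. T * real n powr (1 - \<kappa>)) \<longlonglongrightarrow> T * 0"
    using \<kappa>(1) by (intro tendsto_mult tendsto_const tendsto_neg_powr filterlim_real_sequentially) auto
  then have "eventually (\<lambda>n. T * real n powr (1 - \<kappa>) < \<epsilon> powr \<kappa>) sequentially"
    using \<epsilon> by (intro order_tendstoD(2)[of _ "T * 0"]) auto
  with jump_set_far[OF t, of X] eventually_gt_at_top[of 0] show ?thesis
  proof eventually_elim
    case (elim n)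
    show ?case
    proof (rule ballI, rule ccontr)
      fix x assume x: "x \<in> jump_set t \<tau> n" and no: "\<not> \<phi> i x \<le> \<epsilon> * real n"
      have "x \<ge> X" using elim(1) x by (auto intro: less_imp_le)
      note d = \<kappa>(3)[OF i this]
      have n: "real n > 0" using elim(2) by simp
      have "\<epsilon> powr \<kappa> * real n powr \<kappa> = (\<epsilon> * real n) powr \<kappa>" using \<epsilon> n by (simp add: powr_mult)
      also have "\<dots> \<le> \<phi> i x powr \<kappa>" using no \<epsilon> n \<kappa>(1) by (intro powr_mono2) auto
      also have "\<dots> \<le> real n * T" using d x by (auto simp: jump_set_def T_def)
      finally have "\<epsilon> powr \<kappa> * real n powr \<kappa> * real n powr (- \<kappa>) \<le> real n * T * real n powr (- \<kappa>)"
        by (intro mult_right_mono) auto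
      moreover have "\<epsilon> powr \<kappa> * real n powr \<kappa> * real n powr (- \<kappa>) = \<epsilon> powr \<kappa>"
        using n by (simp add: powr_minus)
      moreover have "real n * T * real n powr (- \<kappa>) = T * real n powr (1 - \<kappa>)"
        using n by (simp add: powr_diff powr_minus field_simps)
      ultimately show False using elim(3) by linarith
    qed
  qed
qed

text \<open>By the mean value theorem and the polynomial bound on the derivative of \<open>\<phi> k\<close>, the jump set contains
an interval whose length is at least a constant times a power of \<open>n\<close>. The reference density on it is at least
\<open>exp (- \<epsilon> n / 2) / Z\<close> because \<open>\<phi> 1\<close> is of smaller order than \<open>n\<close> there.\<close>

lemma jump_probability:
  assumes t: "t \<ge> 0" "\<tau> > 0" and \<epsilon>: "\<epsilon> > 0"
  shows "eventually (\<lambda>n. measure (gibbs \<phi>) (jump_set t \<tau> n) \<ge> exp (- \<epsilon> * real n)) sequentially"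
proof -
  obtain C M where C: "C > 0" "M > 0" "\<And>x. x > C \<Longrightarrow> deriv (\<phi> k) x < C * \<phi> k x powr M"
    using C4 k_in by blast
  define T where "T = t + 2 * \<tau>"
  have T: "T > 0" using t by (simp add: T_def)
  have one: "1 \<in> {1..k-1}" using k by auto
  have "filterlim (\<lambda>n. real n * \<tau>) at_top sequentially" using t by real_asymp
  then have large: "eventually (\<lambda>n. real n * \<tau> > \<phi> k (C + 1)) sequentially" by (simp add: filterlim_at_top_dense)
  have growth: "eventually (\<lambda>n. Z * C * (real n * T) powr M \<le> exp (\<epsilon> / 2 * real n) * (real n * \<tau>)) sequentially"
  proof -
    have *: "eventually (\<lambda>n. A * (real n * T) powr M \<le> exp (c * real n) * (real n * \<tau>)) sequentially"
      if "A > 0" "c > 0" for A c :: real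
      using T C(2) t(2) that by real_asymp
    show ?thesis using *[of "Z * C" "\<epsilon> / 2"] C Z_pos \<epsilon> by simp
  qed
  from jump_small_moments[OF t, of "\<epsilon> / 2" 1] one \<epsilon>
  have small: "eventually (\<lambda>n. \<forall>x\<in>jump_set t \<tau> n. \<phi> 1 x \<le> \<epsilon> / 2 * real n) sequentially" by simp
  from large growth small eventually_gt_at_top[of 0] show ?thesis
  proof eventually_elim
    case (elim n)
    have n: "real n > 0" using elim(4) by simp
    define y1 where "y1 = real n * (t + \<tau>)"
    define y2 where "y2 = real n * T"
    have y1: "\<phi> k (C + 1) < y1"
    proof -
      have "real n * \<tau> \<le> y1" unfolding y1_def using t by (intro mult_left_mono) auto
      then show ?thesis using elim(1) by simp
    qed
    have y12: "y2 - y1 = real n * \<tau>" by (simp add: y1_def y2_def T_def algebra_simps)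
    have "real n * \<tau> > 0" using n t(2) by simp
    then have ylt: "y1 < y2" using y12 by linarith
    have co: "continuous_on {a..b} (\<phi> k)" if "a > 0" for a b
      by (rule continuous_on_subset[OF cont[OF k_in]]) (use that in auto)
    have "eventually (\<lambda>x. \<phi> k x \<ge> y2 \<and> x \<ge> C + 1) at_top"
      using lim[OF k_in] eventually_ge_at_top[of "C + 1"] by (auto simp: filterlim_at_top intro: eventually_conj)
    then obtain b where b: "\<phi> k b \<ge> y2" "b \<ge> C + 1" unfolding eventually_at_top_linorder by blast
    obtain x1 where x1: "C + 1 \<le> x1" "x1 \<le> b" "\<phi> k x1 = y1"
      using IVT'[of "\<phi> k" "C + 1" y1 b] y1 ylt b co[of "C + 1" b] C(1) by auto
    obtain x2 where x2: "x1 \<le> x2" "x2 \<le> b" "\<phi> k x2 = y2"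
      using IVT'[of "\<phi> k" x1 y2 b] x1 ylt b co[of x1 b] C(1) by auto
    have xlt: "x1 < x2" using x1 x2 ylt by (metis order_le_less order_less_irrefl)
    have der: "(\<phi> k has_real_derivative deriv (\<phi> k) x) (at x)" if "x > 0" for x
      using diff[OF k_in that] by (simp add: DERIV_deriv_iff_real_differentiable)
    obtain \<xi> where \<xi>: "x1 < \<xi>" "\<xi> < x2" "\<phi> k x2 - \<phi> k x1 = (x2 - x1) * deriv (\<phi> k) \<xi>"
      using MVT2[OF xlt, of "\<phi> k" "deriv (\<phi> k)"] der x1 C(1) by force
    have "real n * \<tau> = (x2 - x1) * deriv (\<phi> k) \<xi>" using \<xi>(3) x1 x2 y12 by simp
    also have "\<dots> \<le> (x2 - x1) * (C * y2 powr M)"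
    proof (intro mult_left_mono)
      have "deriv (\<phi> k) \<xi> \<le> C * \<phi> k \<xi> powr M" using C(3)[of \<xi>] \<xi> x1 by auto
      also have "\<phi> k \<xi> \<le> y2"
        using mono_onD[OF mono[OF k_in], of \<xi> x2] \<xi> x1 x2 C(1) by auto
      then have "C * \<phi> k \<xi> powr M \<le> C * y2 powr M"
        using C pos[OF k_in, of \<xi>] \<xi> x1 by (intro mult_left_mono powr_mono2) auto
      finally show "deriv (\<phi> k) \<xi> \<le> C * y2 powr M" .
    qed (use xlt in auto)
    finally have len: "real n * \<tau> \<le> (x2 - x1) * (C * y2 powr M)" .
    have sub: "{x1..x2} \<subseteq> jump_set t \<tau> n"
    proof
      fix x assume x: "x \<in> {x1..x2}"
      then have "x > 0" using x1 C(1) by auto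
      moreover have "\<phi> k x1 \<le> \<phi> k x" "\<phi> k x \<le> \<phi> k x2"
        using mono_onD[OF mono[OF k_in], of x1 x] mono_onD[OF mono[OF k_in], of x x2] x x1 x2 C(1) by auto
      ultimately show "x \<in> jump_set t \<tau> n" using x1 x2 by (auto simp: jump_set_def y1_def y2_def T_def)
    qed
    have s12: "{x1..x2} \<in> sets borel_pos" using x1 C(1) by (auto simp: sets_borel_pos)
    have p2: "\<phi> 1 x \<le> \<epsilon> / 2 * real n" if "x \<in> {x1..x2}" for x using elim(3) sub that by blast
    have "ennreal (exp (- (\<epsilon> / 2 * real n)) / Z * (x2 - x1)) = ennreal (exp (- (\<epsilon> / 2 * real n)) / Z) * emeasure leb_pos {x1..x2}"
      using xlt Z_pos by (simp add: emeasure_leb_pos[OF s12] ennreal_mult[symmetric])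
    also have "\<dots> = (\<integral>\<^sup>+x. ennreal (exp (- (\<epsilon> / 2 * real n)) / Z) * indicator {x1..x2} x \<partial>leb_pos)"
      using s12 sets_leb_pos by (intro nn_integral_cmult_indicator[symmetric]) simp
    also have "\<dots> \<le> (\<integral>\<^sup>+x. ennreal (exp (- \<phi> 1 x) / Z) * indicator {x1..x2} x \<partial>leb_pos)"
      using p2 Z_pos by (intro nn_integral_mono) (auto split: split_indicator intro!: ennreal_leI divide_right_mono)
    also have "\<dots> = emeasure (gibbs \<phi>) {x1..x2}"
      unfolding gibbs_eq using s12 sets_leb_pos by (intro emeasure_density[symmetric]) auto
    also have "\<dots> \<le> emeasure (gibbs \<phi>) (jump_set t \<tau> n)"
      using sub jump_set_sets sets_gibbs by (intro emeasure_mono) auto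
    finally have low: "exp (- (\<epsilon> / 2 * real n)) / Z * (x2 - x1) \<le> measure (gibbs \<phi>) (jump_set t \<tau> n)"
      using xlt Z_pos by (simp add: G.emeasure_eq_measure)
    have y2: "y2 powr M > 0" using n T by (simp add: y2_def)
    have "Z * C * y2 powr M \<le> exp (\<epsilon> / 2 * real n) * (real n * \<tau>)"
      using elim(2) by (simp add: y2_def)
    also have "\<dots> \<le> exp (\<epsilon> / 2 * real n) * ((x2 - x1) * (C * y2 powr M))"
      using len by (intro mult_left_mono) auto
    finally have "Z * (C * y2 powr M) \<le> (exp (\<epsilon> / 2 * real n) * (x2 - x1)) * (C * y2 powr M)" by (simp add: mult_ac)
    then have Zle: "Z \<le> exp (\<epsilon> / 2 * real n) * (x2 - x1)"
      using y2 C(1) by (subst (asm) mult_le_cancel_right_pos) auto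
    have "exp (- \<epsilon> * real n) = exp (- (\<epsilon> / 2 * real n)) * exp (- (\<epsilon> / 2 * real n))"
      unfolding exp_add[symmetric] by simp
    also have "\<dots> \<le> exp (- (\<epsilon> / 2 * real n)) * ((x2 - x1) / Z)"
    proof (intro mult_left_mono)
      show "exp (- (\<epsilon> / 2 * real n)) \<le> (x2 - x1) / Z"
        using Zle Z_pos by (simp add: exp_minus field_simps)
    qed simp
    also have "\<dots> = exp (- (\<epsilon> / 2 * real n)) / Z * (x2 - x1)" by simp
    finally show ?case using low by linarith
  qed
qed


section \<open>The lower bound\<close>

text \<open>The tilted product measure below gives probability at least one half to an event \<open>E\<close> on which the
state lies in \<open>U\<close>, the shell condition holds, and the density of the tilted measure is at most
\<open>exp (n (H + 5 \<eta>))\<close>, where \<open>H\<close> is the relative entropy.\<close>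

lemma joint_lower_bound:
  assumes U: "openin state_topology U" and p: "(\<mu>, z) \<in> U" and f: "feasible a \<mu> z"
    and h: "diff_entropy \<mu> = ereal h" and \<delta>: "\<delta> > 0" and \<epsilon>: "\<epsilon> > 0"
  shows "eventually (\<lambda>n. joint_prob a U \<delta> n \<ge> exp (- real n * (- h + (a 1 + ln Z) + \<epsilon>))) sequentially"
proof -
  have \<mu>: "\<mu> \<in> prob_measures_pos" and z: "z \<ge> 0"
    using p openin_subset[OF U] by auto
  obtain F e where F: "finite F" "e > 0" "\<And>f. f \<in> F \<Longrightarrow> bdd_cont_pos f"
    "\<And>\<nu> w. \<nu> \<in> prob_measures_pos \<Longrightarrow> w \<ge> 0 \<Longrightarrow>
       (\<And>f. f \<in> F \<Longrightarrow> \<bar>(LINT x|\<nu>. f x) - (LINT x|\<mu>. f x)\<bar> < e) \<Longrightarrow> \<bar>w - z\<bar> < e \<Longrightarrow> (\<nu>, w) \<in> U"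
    using state_topology_nbhd[OF U p] by blast
  \<comment> \<open>one unit of error; each quantity below is controlled up to at most six of them\<close>
  define \<eta> where "\<eta> = min \<delta> (min e \<epsilon>) / 10"
  have \<eta>: "\<eta> > 0" "10 * \<eta> \<le> \<delta>" "10 * \<eta> \<le> e" "10 * \<eta> \<le> \<epsilon>"
    using \<delta> \<epsilon> F(2) by (auto simp: \<eta>_def min_def)
  note m1 = feasible_moment1[OF f]
  have hfin: "diff_entropy \<mu> \<noteq> - \<infinity>" using h by simp
  note fe = finite_entropy[OF \<mu> m1 hfin]
  note ac = fe(1)
  interpret M: prob_space \<mu> using prob_measures_posD[OF \<mu>] by simp
  have hk: "moment (\<phi> k) \<mu> \<le> ereal (a k - z)" using f by (simp add: feasible_def)
  moreover have "moment (\<phi> k) \<mu> \<ge> 0" by (simp add: moment_def)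
  ultimately obtain mk where mk: "moment (\<phi> k) \<mu> = ereal mk" "mk \<le> a k - z"
    by (cases "moment (\<phi> k) \<mu>") auto
  define v where "v i = (if i = k then mk else a i)" for i
  have mom: "moment (\<phi> i) \<mu> = ereal (v i)" if "i \<in> {1..k}" for i
    using f that mk(1) by (auto simp: v_def feasible_def moments_match_def)
  have imom: "integrable \<mu> (\<phi> i)" "(LINT x|\<mu>. \<phi> i x) = v i" if "i \<in> {1..k}" for i
    using moment_finite[OF \<mu> that mom[OF that]] by auto

  \<comment> \<open>the logarithm of the density of \<open>\<mu>\<close> with respect to the reference law\<close>
  define G where "G x = ln (lebd \<mu> x) + \<phi> 1 x + ln Z" for x
  define H where "H = - h + (a 1 + ln Z)"
  have Gm: "G \<in> borel_measurable borel_pos"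
    unfolding measurable_leb_pos[symmetric] G_def by measurable
  have Gint: "integrable \<mu> G" unfolding G_def using fe(2) imom(1)[OF one_in] by simp
  have GH: "(LINT x|\<mu>. G x) = H"
    unfolding G_def H_def using fe(2,3) h imom[OF one_in] k by (simp add: M.prob_space v_def)

  define \<G> where "\<G> = insert G (\<phi> ` {1..k} \<union> F)"
  have \<G>: "finite \<G>" "\<And>g. g \<in> \<G> \<Longrightarrow> g \<in> borel_measurable borel_pos" "\<And>g. g \<in> \<G> \<Longrightarrow> integrable \<mu> g"
    using F(1) Gm Gint F(3) imom(1) phi_measurable bdd_cont_pos_measurable bdd_cont_pos_integrable[OF \<mu>]
    by (auto simp: \<G>_def)
  have GG: "G \<in> \<G>" and FG: "\<And>f. f \<in> F \<Longrightarrow> f \<in> \<G>" and PG: "\<And>i. i \<in> {1..k} \<Longrightarrow> \<phi> i \<in> \<G>"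
    by (auto simp: \<G>_def)

  define S where "S = {x \<in> space leb_pos. lebd \<mu> x > 0}"
  have Ss: "S \<in> sets borel_pos" unfolding S_def sets_leb_pos[symmetric] by measurable
  have SAE: "AE x in \<mu>. x \<in> S"
    using lebd_pos_AE[OF \<mu> ac] AE_space
    by eventually_elim (simp add: S_def prob_measures_posD(3)[OF \<mu>])
  obtain B R where B: "B \<in> sets borel_pos" "B \<subseteq> S" "R > 0" "measure \<mu> B > 0"
    "\<And>g x. g \<in> \<G> \<Longrightarrow> x \<in> B \<Longrightarrow> \<bar>g x\<bar> \<le> R"
    "\<And>g. g \<in> \<G> \<Longrightarrow> \<bar>(LINT x|\<mu>. indicator B x * g x) / measure \<mu> B - (LINT x|\<mu>. g x)\<bar> \<le> \<eta>"
    "- ln (measure \<mu> B) \<le> \<eta>"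
    using bounded_truncation[OF \<mu> \<G> Ss SAE \<eta>(1)] by blast
  define \<nu> where "\<nu> = density (gibbs \<phi>) (\<lambda>x. ennreal (tilt \<mu> B x))"
  note \<nu> = tilted_measure[OF \<mu> ac B(1,4), folded \<nu>_def]
  have \<nu>\<mu>: "\<bar>(LINT x|\<nu>. g x) - (LINT x|\<mu>. g x)\<bar> \<le> \<eta>" if "g \<in> \<G>" for g
    using B(6)[OF that] \<nu>(3)[OF \<G>(2)[OF that]] by simp

  \<comment> \<open>the part of the last moment that neither \<open>\<mu>\<close> nor the largest jump accounts for; it is shared by
      \<open>N\<close> jumps so small that they do not compete with the largest one\<close>
  define c where "c = a k - z - mk"
  have c: "c \<ge> 0" using mk(2) by (simp add: c_def)
  obtain N :: nat where N: "N \<ge> 1" "c / real N \<le> \<eta>"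
  proof -
    obtain N0 :: nat where N0: "c / \<eta> < real N0" using reals_Archimedean2 by blast
    have "c \<le> \<eta> * real (max N0 1)"
    proof -
      have "c \<le> \<eta> * real N0" using N0 \<eta>(1) by (simp add: field_simps)
      also have "\<dots> \<le> \<eta> * real (max N0 1)" using \<eta>(1) by (intro mult_left_mono) auto
      finally show ?thesis .
    qed
    then have "c / real (max N0 1) \<le> \<eta>" by (simp add: divide_le_eq)
    then show ?thesis using that[of "max N0 1"] by simp
  qed
  \<comment> \<open>the last \<open>m\<close> coordinates jump, the others follow the tilted law\<close>
  define m where "m = N + 1"
  have m: "m \<ge> 1" by (simp add: m_def)
  define \<tau> where "\<tau> = \<eta> / (2 * real m)"
  have \<tau>: "\<tau> > 0" "2 * (real m * \<tau>) = \<eta>" "2 * \<tau> \<le> \<eta>"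
    using \<eta>(1) m by (auto simp: \<tau>_def field_simps)
  \<comment> \<open>the target contribution of coordinate \<open>j\<close> to the mean of \<open>\<phi> k\<close>; coordinate \<open>n\<close> is the largest\<close>
  define tt where "tt n j = (if j = n then z else c / real N)" for n j :: nat
  have tt: "tt n j \<in> {z, c / real N}" "tt n j \<ge> 0" "tt n j \<le> z + \<eta>" for n j
    using z c N \<eta>(1) by (auto simp: tt_def)
  have t0: "t \<ge> 0" if "t \<in> {z, c / real N}" for t using that z c by auto
  define \<pi> where "\<pi> n j = measure (gibbs \<phi>) (jump_set (tt n j) \<tau> n)" for n j
  define w where "w n j x = (if j \<le> n - m then tilt \<mu> B x else indicator (jump_set (tt n j) \<tau> n) x / \<pi> n j)"
    for n j :: nat and x :: real
  have \<eta>m: "\<eta> / real m > 0" using \<eta>(1) m by simp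
  obtain b where b: "\<And>f x. f \<in> F \<Longrightarrow> x > 0 \<Longrightarrow> \<bar>f x\<bar> \<le> b f"
  proof -
    have "\<forall>f\<in>F. \<exists>B. \<forall>x>0. \<bar>f x\<bar> \<le> B" using bdd_cont_pos_bound[OF F(3)] by metis
    then show ?thesis using that by metis
  qed
  have lin: "eventually (\<lambda>n. C \<le> \<eta> * real n) sequentially" for C :: real
  proof -
    have "filterlim (\<lambda>n. \<eta> * real n) at_top sequentially" using \<eta>(1) by real_asymp
    then show ?thesis by (simp add: filterlim_at_top)
  qed

  have e2: "eventually (\<lambda>n. \<forall>t\<in>{z, c / real N}. measure (gibbs \<phi>) (jump_set t \<tau> n) \<ge> exp (- (\<eta> / real m) * real n)) sequentially"
    by (intro eventually_ball_finite ballI jump_probability t0 \<tau>(1) \<eta>m) auto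
  have e3: "eventually (\<lambda>n. \<forall>t\<in>{z, c / real N}. \<forall>i\<in>{1..k-1}. \<forall>x\<in>jump_set t \<tau> n. \<phi> i x \<le> (\<eta> / real m) * real n) sequentially"
    by (intro eventually_ball_finite ballI jump_small_moments t0 \<tau>(1) \<eta>m) auto
  have e4: "eventually (\<lambda>n. \<forall>g\<in>\<G>. real m * \<bar>LINT x|\<mu>. g x\<bar> \<le> \<eta> * real n) sequentially"
    by (intro eventually_ball_finite ballI lin \<G>(1))
  have e5: "eventually (\<lambda>n. \<forall>f\<in>F. real m * b f \<le> \<eta> * real n) sequentially"
    by (intro eventually_ball_finite ballI lin F(1))
  have e7: "eventually (\<lambda>n. real (card \<G>) * (2 * exp (- (real (n - m) * \<eta>\<^sup>2 / (2 * R\<^sup>2)))) \<le> 1 / 2) sequentially"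
  proof -
    have "(\<lambda>n. real A * (2 * exp (- (real n * (\<eta>\<^sup>2 / (2 * R\<^sup>2)))))) \<longlonglongrightarrow> 0" for A :: nat
    proof -
      have q: "\<eta>\<^sup>2 / (2 * R\<^sup>2) > 0" using \<eta>(1) B(3) by simp
      have "(\<lambda>n. real A * (2 * exp (- (real n * q)))) \<longlonglongrightarrow> 0" if "q > 0" for q :: real
        using that by real_asymp
      from this[OF q] show ?thesis .
    qed
    then have "eventually (\<lambda>n. real (card \<G>) * (2 * exp (- (real n * (\<eta>\<^sup>2 / (2 * R\<^sup>2))))) < 1 / 2) sequentially"
      by (rule order_tendstoD) simp
    then obtain n0 where n0: "\<And>n. n \<ge> n0 \<Longrightarrow> real (card \<G>) * (2 * exp (- (real n * (\<eta>\<^sup>2 / (2 * R\<^sup>2))))) < 1 / 2"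
      unfolding eventually_sequentially by blast
    show ?thesis
      using eventually_ge_at_top[of "n0 + m"]
    proof eventually_elim
      case (elim n)
      then have "n0 \<le> n - m" by simp
      from n0[OF this] show ?case by (simp add: less_imp_le)
    qed
  qed
  from eventually_ge_at_top[of "m + 1"] e2 e3 e4 e5 lin[of R] e7 lin[of "real m * \<bar>H + 3 * \<eta>\<bar>"] lin[of "ln 2"]
  show ?thesis
  proof eventually_elim
    case (elim n)
    note n1 = elim(1) and E2 = elim(2) and E3 = elim(3) and E4 = elim(4) and E5 = elim(5)
      and E6 = elim(6) and E7 = elim(7) and E8 = elim(8) and E9 = elim(9)
    define n' where "n' = n - m"
    have n': "n' \<ge> 1" "real n' = real n - real m" "n' \<le> n" "n = n' + m" using n1 by (auto simp: n'_def)
    have npos: "n \<ge> 1" "real n > 0" using n1 by auto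
    define J where "J = {1..n'}"
    define Sp where "Sp = {n'+1..n}"
    have JS: "{1..n} = J \<union> Sp" "J \<inter> Sp = {}" "finite J" "finite Sp" "card J = n'" "card Sp = m" "J \<noteq> {}"
      "J \<subseteq> {1..n}" "Sp \<subseteq> {1..n}" "n \<in> Sp"
      using n' m by (auto simp: J_def Sp_def)
    have split: "(\<Sum>j=1..n. g (\<omega> j)) = (\<Sum>j\<in>J. g (\<omega> j)) + (\<Sum>j\<in>Sp. g (\<omega> j))" for g :: "real \<Rightarrow> real" and \<omega> :: "nat \<Rightarrow> real"
      unfolding JS(1) by (rule sum.union_disjoint[OF JS(3,4,2)])
    have \<pi>: "\<pi> n j \<ge> exp (- (\<eta> / real m) * real n)" for j
      unfolding \<pi>_def using E2 tt(1) by blast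
    have \<pi>0: "\<pi> n j > 0" for j using \<pi>[of j] exp_gt_zero[of "- (\<eta> / real m) * real n"] by linarith
    have wJ: "w n j = tilt \<mu> B" if "j \<in> J" for j using that by (auto simp: w_def J_def n'_def)
    have wS: "w n j = (\<lambda>x. indicator (jump_set (tt n j) \<tau> n) x / \<pi> n j)" if "j \<in> Sp" for j
      using that by (intro ext) (auto simp: w_def Sp_def n'_def)
    define Q where "Q = PiM {1..n} (\<lambda>j. density (gibbs \<phi>) (\<lambda>x. ennreal (w n j x)))"
    have js: "jump_set t \<tau> n \<in> sets (gibbs \<phi>)" for t using jump_set_sets sets_gibbs by simp
    have w_meas: "w n j \<in> borel_measurable (gibbs \<phi>)" for j
    proof (cases "j \<le> n - m")
      case True
      then have "w n j = tilt \<mu> B" by (auto simp: w_def)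
      then show ?thesis using tilt_measurable[OF B(1)] by simp
    next
      case False
      then have "w n j = (\<lambda>x. indicator (jump_set (tt n j) \<tau> n) x / \<pi> n j)" by (auto simp: w_def)
      then show ?thesis using js by simp
    qed
    have w_nn: "w n j x \<ge> 0" for j x
      using tilt_nonneg \<pi>0[of j] by (auto simp: w_def less_imp_le)
    have w_prob: "prob_space (density (gibbs \<phi>) (\<lambda>x. ennreal (w n j x)))" for j
    proof (cases "j \<le> n - m")
      case True
      then show ?thesis using \<nu>(1) by (simp add: \<nu>_def w_def)
    next
      case False
      let ?D = "density (gibbs \<phi>) (\<lambda>x. ennreal (indicator (jump_set (tt n j) \<tau> n) x / \<pi> n j))"
      have "emeasure ?D (space ?D) = (\<integral>\<^sup>+x. 1 \<partial>?D)" by simp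
      also have "\<dots> = (\<integral>\<^sup>+x. ennreal (indicator (jump_set (tt n j) \<tau> n) x / \<pi> n j) \<partial>gibbs \<phi>)"
        using js by (subst nn_integral_density) auto
      also have "\<dots> = (\<integral>\<^sup>+x. ennreal (1 / \<pi> n j) * indicator (jump_set (tt n j) \<tau> n) x \<partial>gibbs \<phi>)"
        by (intro nn_integral_cong) (auto split: split_indicator)
      also have "\<dots> = ennreal (1 / \<pi> n j) * emeasure (gibbs \<phi>) (jump_set (tt n j) \<tau> n)"
        by (rule nn_integral_cmult_indicator[OF js])
      also have "\<dots> = 1"
        using \<pi>0[of j] by (simp add: G.emeasure_eq_measure \<pi>_def ennreal_mult[symmetric])
      finally have "prob_space ?D" by (rule prob_spaceI)
      then show ?thesis using False by (simp add: w_def)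
    qed

    define E where "E = {\<omega> \<in> space (samples {1..n}). (\<forall>j\<in>J. \<omega> j \<in> B) \<and> (\<forall>j\<in>Sp. \<omega> j \<in> jump_set (tt n j) \<tau> n)
        \<and> (\<forall>g\<in>\<G>. \<bar>(\<Sum>j\<in>J. g (\<omega> j)) - real n' * (LINT x|\<nu>. g x)\<bar> < real n' * \<eta>)}"
    have Jsum: "(\<lambda>\<omega>. \<Sum>j\<in>J. g (\<omega> j)) \<in> borel_measurable (samples {1..n})" if "g \<in> \<G>" for g
    proof (intro borel_measurable_sum coordinate_measurable[OF \<G>(2)[OF that]])
      fix j assume "j \<in> J" then show "j \<in> {1..n}" using JS(8) by blast
    qed
    have E_sets: "E \<in> sets (samples {1..n})"
    proof -
      have 1: "{\<omega> \<in> space (samples {1..n}). \<forall>j\<in>J. \<omega> j \<in> B} \<in> sets (samples {1..n})"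
        using JS(8) by (intro sets.sets_Collect_finite_All JS(3) coordinate_event B(1)) auto
      have 2: "{\<omega> \<in> space (samples {1..n}). \<forall>j\<in>Sp. \<omega> j \<in> jump_set (tt n j) \<tau> n} \<in> sets (samples {1..n})"
        using JS(9) by (intro sets.sets_Collect_finite_All JS(4) coordinate_event jump_set_sets) auto
      have 3: "{\<omega> \<in> space (samples {1..n}). \<forall>g\<in>\<G>. \<bar>(\<Sum>j\<in>J. g (\<omega> j)) - real n' * (LINT x|\<nu>. g x)\<bar> < real n' * \<eta>} \<in> sets (samples {1..n})"
      proof (intro sets.sets_Collect_finite_All \<G>(1))
        fix g assume "g \<in> \<G>"
        note Jsum[OF this, measurable]
        show "{\<omega> \<in> space (samples {1..n}). \<bar>(\<Sum>j\<in>J. g (\<omega> j)) - real n' * (LINT x|\<nu>. g x)\<bar> < real n' * \<eta>} \<in> sets (samples {1..n})"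
          by measurable
      qed
      have "E = {\<omega> \<in> space (samples {1..n}). \<forall>j\<in>J. \<omega> j \<in> B}
          \<inter> {\<omega> \<in> space (samples {1..n}). \<forall>j\<in>Sp. \<omega> j \<in> jump_set (tt n j) \<tau> n}
          \<inter> {\<omega> \<in> space (samples {1..n}). \<forall>g\<in>\<G>. \<bar>(\<Sum>j\<in>J. g (\<omega> j)) - real n' * (LINT x|\<nu>. g x)\<bar> < real n' * \<eta>}"
        unfolding E_def by blast
      then show ?thesis using sets.Int[OF sets.Int[OF 1 2] 3] by simp
    qed

    \<comment> \<open>on \<open>E\<close> all the requirements hold deterministically\<close>
    have E_sub: "E \<subseteq> event a U \<delta> n {1..n}"
    proof
      fix \<omega> assume \<omega>: "\<omega> \<in> E"
      then have sp: "\<omega> \<in> space (samples {1..n})" and wB: "\<And>j. j \<in> J \<Longrightarrow> \<omega> j \<in> B"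
        and wS: "\<And>j. j \<in> Sp \<Longrightarrow> \<omega> j \<in> jump_set (tt n j) \<tau> n"
        and wG: "\<And>g. g \<in> \<G> \<Longrightarrow> \<bar>(\<Sum>j\<in>J. g (\<omega> j)) - real n' * (LINT x|\<nu>. g x)\<bar> < real n' * \<eta>"
        by (auto simp: E_def)
      have wp: "\<omega> j > 0" if "j \<in> {1..n}" for j using space_samples[OF sp that] .
      \<comment> \<open>the four errors: fluctuation of the bulk, truncation of \<open>\<mu>\<close>, the \<open>m\<close> coordinates missing from
          the bulk, and the deviation of the jumps from their target \<open>s\<close>\<close>
      have mean: "\<bar>emp_mean g n \<omega> - ((LINT x|\<mu>. g x) + s)\<bar> \<le> 4 * \<eta>"
        if g: "g \<in> \<G>" and s: "\<bar>(\<Sum>j\<in>Sp. g (\<omega> j)) - real n * s\<bar> \<le> \<eta> * real n" for g s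
      proof -
        define A where "A = (\<Sum>j\<in>J. g (\<omega> j))"
        define q where "q = (LINT x|\<mu>. g x)"
        define r where "r = (LINT x|\<nu>. g x)"
        define T where "T = (\<Sum>j\<in>Sp. g (\<omega> j))"
        have nn: "real n = real n' + real m" using n'(2) by simp
        have "\<bar>A - real n' * r\<bar> \<le> real n' * \<eta>" using wG[OF g] by (simp add: A_def r_def)
        moreover have "real n' * \<eta> \<le> real n * \<eta>" using n'(3) \<eta>(1) by (intro mult_right_mono) auto
        moreover have "\<bar>real n' * (r - q)\<bar> \<le> real n' * \<eta>"
          using \<nu>\<mu>[OF g] unfolding abs_mult by (simp add: r_def q_def mult_left_mono)
        moreover have "\<bar>real m * q\<bar> \<le> real n * \<eta>"
          using E4 g by (auto simp: q_def abs_mult mult.commute)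
        moreover have "A + T - real n * (q + s) = (A - real n' * r) + real n' * (r - q) - real m * q + (T - real n * s)"
          unfolding nn by (simp add: algebra_simps)
        moreover have "\<bar>T - real n * s\<bar> \<le> real n * \<eta>" using s by (simp add: T_def mult.commute)
        ultimately have bound: "\<bar>A + T - real n * (q + s)\<bar> \<le> real n * (4 * \<eta>)" by linarith
        have "emp_mean g n \<omega> - (q + s) = (A + T - real n * (q + s)) / real n"
          using npos unfolding emp_mean_def split A_def[symmetric] T_def[symmetric] by (simp add: field_simps)
        then have "\<bar>emp_mean g n \<omega> - (q + s)\<bar> = \<bar>A + T - real n * (q + s)\<bar> / real n" using npos by simp
        also have "\<dots> \<le> 4 * \<eta>" using bound npos by (simp add: divide_le_eq mult.commute)
        finally show ?thesis by (simp add: q_def)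
      qed
      have mean_F: "\<bar>emp_mean f n \<omega> - (LINT x|\<mu>. f x)\<bar> \<le> 4 * \<eta>" if "f \<in> F" for f
      proof -
        have "\<bar>\<Sum>j\<in>Sp. f (\<omega> j)\<bar> \<le> (\<Sum>j\<in>Sp. \<bar>f (\<omega> j)\<bar>)" by (rule sum_abs)
        also have "\<dots> \<le> (\<Sum>j\<in>Sp. b f)" using JS(9) by (intro sum_mono b that wp) auto
        also have "\<dots> \<le> \<eta> * real n" using E5 that by (simp add: JS(6))
        finally show ?thesis using mean[OF FG[OF that], of 0] by simp
      qed
      have shell_i: "\<bar>emp_mean (\<phi> i) n \<omega> - a i\<bar> \<le> 4 * \<eta>" if i: "i \<in> {1..k-1}" for i
      proof -
        have ik: "i \<in> {1..k}" "i \<noteq> k" using i k by auto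
        have "0 \<le> (\<Sum>j\<in>Sp. \<phi> i (\<omega> j))"
        proof (intro sum_nonneg)
          fix j assume "j \<in> Sp"
          then have "\<omega> j > 0" using JS(9) wp by blast
          then show "0 \<le> \<phi> i (\<omega> j)" using pos[OF ik(1)] less_imp_le by blast
        qed
        moreover have "(\<Sum>j\<in>Sp. \<phi> i (\<omega> j)) \<le> (\<Sum>j\<in>Sp. (\<eta> / real m) * real n)"
          using E3 tt(1) wS i by (intro sum_mono) blast
        moreover have "(\<Sum>j\<in>Sp. (\<eta> / real m) * real n) = \<eta> * real n" using m by (simp add: JS(6))
        ultimately have "\<bar>(\<Sum>j\<in>Sp. \<phi> i (\<omega> j)) - real n * 0\<bar> \<le> \<eta> * real n" by simp
        from mean[OF PG[OF ik(1)] this] show ?thesis using imom(2)[OF ik(1)] ik(2) by (simp add: v_def)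
      qed
      have jump: "real n * (tt n j + \<tau>) \<le> \<phi> k (\<omega> j)" "\<phi> k (\<omega> j) \<le> real n * (tt n j + 2 * \<tau>)" if "j \<in> Sp" for j
        using wS[OF that] by (auto simp: jump_set_def)
      have "(\<Sum>j\<in>Sp. tt n j) = tt n n + (\<Sum>j\<in>Sp - {n}. tt n j)" using JS(4,10) by (rule sum.remove)
      also have "(\<Sum>j\<in>Sp - {n}. tt n j) = (\<Sum>j\<in>Sp - {n}. c / real N)" by (intro sum.cong) (auto simp: tt_def)
      also have "\<dots> = real N * (c / real N)" using JS(4,6,10) by (simp add: card_Diff_singleton m_def)
      also have "\<dots> = c" using N(1) by simp
      finally have sumtt: "(\<Sum>j\<in>Sp. tt n j) = z + c" by (simp add: tt_def)
      have shell_k: "\<bar>emp_mean (\<phi> k) n \<omega> - a k\<bar> \<le> 4 * \<eta>"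
      proof -
        have "(\<Sum>j\<in>Sp. real n * (tt n j + \<tau>)) = real n * (z + c) + real n * (real m * \<tau>)"
          by (simp add: sum_distrib_left[symmetric] sum.distrib sumtt JS(6) algebra_simps)
        moreover have "(\<Sum>j\<in>Sp. real n * (tt n j + 2 * \<tau>)) = real n * (z + c) + real n * (2 * (real m * \<tau>))"
          by (simp add: sum_distrib_left[symmetric] sum.distrib sumtt JS(6) algebra_simps)
        moreover have "(\<Sum>j\<in>Sp. real n * (tt n j + \<tau>)) \<le> (\<Sum>j\<in>Sp. \<phi> k (\<omega> j))"
          "(\<Sum>j\<in>Sp. \<phi> k (\<omega> j)) \<le> (\<Sum>j\<in>Sp. real n * (tt n j + 2 * \<tau>))"
          by (intro sum_mono jump, assumption)+
        moreover have "real n * (real m * \<tau>) \<ge> 0" using \<tau>(1) by simp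
        ultimately have "\<bar>(\<Sum>j\<in>Sp. \<phi> k (\<omega> j)) - real n * (z + c)\<bar> \<le> \<eta> * real n"
          unfolding \<tau>(2) by (simp add: mult.commute)
        from mean[OF PG[OF k_in] this] show ?thesis using imom(2)[OF k_in] by (simp add: v_def c_def)
      qed
      have in_sh: "in_shell k \<phi> a \<delta> n \<omega>"
        unfolding in_shell_def
      proof
        fix i assume "i \<in> {1..k}"
        then have "i = k \<or> i \<in> {1..k-1}" by auto
        then show "\<bar>emp_mean (\<phi> i) n \<omega> - a i\<bar> \<le> \<delta>"
          using shell_k shell_i[of i] \<eta>(1,2) by auto
      qed
      have max_le: "scaled_max (\<phi> k) n \<omega> \<le> z + 2 * \<eta>"
        unfolding scaled_max_le_iff[OF npos(1)]
      proof
        fix j assume "j \<in> {1..n}"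
        then consider "j \<in> J" | "j \<in> Sp" using JS(1) by blast
        then have "\<phi> k (\<omega> j) \<le> real n * (z + 2 * \<eta>)"
        proof cases
          case 1
          have "\<phi> k (\<omega> j) \<le> R" using B(5)[OF PG[OF k_in] wB[OF 1]] by simp
          also have "\<dots> \<le> real n * \<eta>" using E6 by (simp add: mult.commute)
          also have "\<dots> \<le> real n * (z + 2 * \<eta>)" using z \<eta>(1) by (intro mult_left_mono) auto
          finally show ?thesis .
        next
          case 2
          have "\<phi> k (\<omega> j) \<le> real n * (tt n j + 2 * \<tau>)" by (rule jump(2)[OF 2])
          also have "\<dots> \<le> real n * (z + 2 * \<eta>)" using tt(3)[of n j] \<tau>(3) by (intro mult_left_mono) auto
          finally show ?thesis .
        qed
        then show "\<phi> k (\<omega> j) / real n \<le> z + 2 * \<eta>" using npos by (simp add: divide_le_eq mult.commute)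
      qed
      have max_ge: "z \<le> scaled_max (\<phi> k) n \<omega>"
      proof -
        have "real n * z \<le> real n * (tt n n + \<tau>)" using \<tau>(1) by (intro mult_left_mono) (auto simp: tt_def)
        also have "\<dots> \<le> \<phi> k (\<omega> n)" by (rule jump(1)[OF JS(10)])
        finally have "z \<le> \<phi> k (\<omega> n) / real n" using npos by (simp add: le_divide_eq mult.commute)
        also have "\<dots> \<le> scaled_max (\<phi> k) n \<omega>" using npos by (intro scaled_max_ge) auto
        finally show ?thesis .
      qed
      have "state n \<omega> \<in> U"
        unfolding state_def
      proof (rule F(4))
        show "emp_measure n \<omega> \<in> prob_measures_pos" by (rule emp_measure_integral(1)[OF npos(1) wp])
        show "0 \<le> scaled_max (\<phi> k) n \<omega>" using max_ge z by linarith
        show "\<bar>scaled_max (\<phi> k) n \<omega> - z\<bar> < e" using max_ge max_le \<eta> by linarith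
        fix f assume f: "f \<in> F"
        have "(LINT x|emp_measure n \<omega>. f x) = emp_mean f n \<omega>"
          by (rule emp_measure_integral(2)[OF npos(1) wp bdd_cont_pos_measurable[OF F(3)[OF f]]])
        then show "\<bar>(LINT x|emp_measure n \<omega>. f x) - (LINT x|\<mu>. f x)\<bar> < e"
          using mean_F[OF f] \<eta> by simp
      qed
      then show "\<omega> \<in> event a U \<delta> n {1..n}" using sp in_sh by (simp add: event_def)
    qed

    \<comment> \<open>each bulk factor is \<open>exp G\<close> divided by the mass of \<open>B\<close>; each jump factor is subexponential\<close>
    have w_bound: "(\<Prod>j\<in>{1..n}. w n j (\<omega> j)) \<le> exp (real n * (H + 5 * \<eta>))" if \<omega>: "\<omega> \<in> E" for \<omega>
    proof -
      have wB: "\<And>j. j \<in> J \<Longrightarrow> \<omega> j \<in> B" using \<omega> by (auto simp: E_def)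
      have beta: "exp (- ln (measure \<mu> B)) = 1 / measure \<mu> B" using B(4) by (simp add: exp_minus inverse_eq_divide)
      have tl: "w n j (\<omega> j) = exp (G (\<omega> j) - ln (measure \<mu> B))" if "j \<in> J" for j
      proof -
        have "lebd \<mu> (\<omega> j) > 0" using wB[OF that] B(2) by (auto simp: S_def)
        then have "exp (G (\<omega> j)) = lebd \<mu> (\<omega> j) * Z * exp (\<phi> 1 (\<omega> j))"
          using Z_pos by (simp add: G_def exp_add)
        then show ?thesis using wB[OF that] B(4) by (simp add: wJ[OF that] tilt_def exp_diff)
      qed
      have "(\<Prod>j\<in>J. w n j (\<omega> j)) = exp (\<Sum>j\<in>J. G (\<omega> j) - ln (measure \<mu> B))"
        using JS(3) by (simp add: tl exp_sum)
      also have "\<dots> \<le> exp (real n' * (H + 3 * \<eta>))"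
      proof -
        have "(\<Sum>j\<in>J. G (\<omega> j)) \<le> real n' * (LINT x|\<nu>. G x) + real n' * \<eta>"
        proof -
          have "\<bar>(\<Sum>j\<in>J. G (\<omega> j)) - real n' * (LINT x|\<nu>. G x)\<bar> < real n' * \<eta>"
            using \<omega> GG by (auto simp: E_def)
          then show ?thesis by linarith
        qed
        moreover have "real n' * (LINT x|\<nu>. G x) \<le> real n' * (H + \<eta>)"
          using \<nu>\<mu>[OF GG] GH by (intro mult_left_mono) auto
        moreover have "real n' * (- ln (measure \<mu> B)) \<le> real n' * \<eta>" using B(7) by (intro mult_left_mono) auto
        moreover have "(\<Sum>j\<in>J. G (\<omega> j) - ln (measure \<mu> B)) = (\<Sum>j\<in>J. G (\<omega> j)) + real n' * (- ln (measure \<mu> B))"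
          by (simp add: sum_subtractf JS(5))
        ultimately have "(\<Sum>j\<in>J. G (\<omega> j) - ln (measure \<mu> B)) \<le> real n' * (H + \<eta>) + real n' * \<eta> + real n' * \<eta>" by linarith
        also have "\<dots> = real n' * (H + 3 * \<eta>)" by (simp add: algebra_simps)
        finally show ?thesis by simp
      qed
      finally have P1: "(\<Prod>j\<in>J. w n j (\<omega> j)) \<le> exp (real n' * (H + 3 * \<eta>))" .
      have "(\<Prod>j\<in>Sp. w n j (\<omega> j)) \<le> (\<Prod>j\<in>Sp. exp ((\<eta> / real m) * real n))"
      proof (intro prod_mono conjI w_nn)
        fix j assume j: "j \<in> Sp"
        have "w n j (\<omega> j) \<le> 1 / \<pi> n j" using \<pi>0[of j] by (simp add: wS[OF j] divide_right_mono indicator_def)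
        also have "\<dots> \<le> 1 / exp (- (\<eta> / real m) * real n)" using \<pi>[of j] by (intro divide_left_mono) (auto intro: \<pi>0 mult_pos_pos)
        also have "\<dots> = exp ((\<eta> / real m) * real n)" by (simp add: exp_minus inverse_eq_divide)
        finally show "w n j (\<omega> j) \<le> exp ((\<eta> / real m) * real n)" .
      qed
      also have "\<dots> = exp (real m * ((\<eta> / real m) * real n))" by (simp only: prod_constant JS(6) exp_of_nat_mult)
      also have "real m * ((\<eta> / real m) * real n) = \<eta> * real n" using m by simp
      finally have P2: "(\<Prod>j\<in>Sp. w n j (\<omega> j)) \<le> exp (\<eta> * real n)" .
      have "(\<Prod>j\<in>{1..n}. w n j (\<omega> j)) = (\<Prod>j\<in>J. w n j (\<omega> j)) * (\<Prod>j\<in>Sp. w n j (\<omega> j))"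
        unfolding JS(1) by (rule prod.union_disjoint[OF JS(3,4,2)])
      also have "\<dots> \<le> exp (real n' * (H + 3 * \<eta>)) * exp (\<eta> * real n)"
        by (intro mult_mono P1 P2 prod_nonneg ballI w_nn) auto
      also have "\<dots> = exp (real n' * (H + 3 * \<eta>) + \<eta> * real n)" by (rule exp_add[symmetric])
      also have "\<dots> \<le> exp (real n * (H + 5 * \<eta>))"
      proof -
        have "real n' * (H + 3 * \<eta>) = real n * (H + 3 * \<eta>) - real m * (H + 3 * \<eta>)"
          unfolding n'(2) by (rule left_diff_distrib)
        also have "- (real m * (H + 3 * \<eta>)) \<le> real m * \<bar>H + 3 * \<eta>\<bar>"
          unfolding mult_minus_right[symmetric] by (intro mult_left_mono) auto
        then have "real n * (H + 3 * \<eta>) - real m * (H + 3 * \<eta>) \<le> real n * (H + 3 * \<eta>) + \<eta> * real n"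
          using E8 by linarith
        finally have "real n' * (H + 3 * \<eta>) + \<eta> * real n \<le> real n * (H + 3 * \<eta>) + \<eta> * real n + \<eta> * real n" by simp
        also have "\<dots> = real n * (H + 5 * \<eta>)" by (simp add: algebra_simps)
        finally show ?thesis by simp
      qed
      finally show ?thesis .
    qed

    \<comment> \<open>Hoeffding's inequality for each of the finitely many functions, with \<open>R\<close> as common bound\<close>
    have QE: "measure Q E \<ge> 1 / 2"
    proof -
      interpret Q: prob_space Q unfolding Q_def by (rule prob_space_PiM) (rule w_prob)
      have setsQ: "sets Q = sets (samples {1..n})"
        unfolding Q_def samples_def by (intro sets_PiM_cong) auto
      have spaceQ: "space Q = space (samples {1..n})" by (rule sets_eq_imp_space_eq[OF setsQ])
      let ?bad = "\<lambda>g. {\<omega> \<in> space Q. \<bar>(\<Sum>j\<in>J. g (\<omega> j)) - real n' * (LINT x|\<nu>. g x)\<bar> \<ge> real n' * \<eta>}"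
      have bad_sets: "?bad g \<in> sets Q" if "g \<in> \<G>" for g
      proof -
        note Jsum[OF that, measurable]
        show ?thesis unfolding setsQ spaceQ by measurable
      qed
      have bad: "measure Q (?bad g) \<le> 2 * exp (- (real n' * \<eta>\<^sup>2 / (2 * R\<^sup>2)))" if g: "g \<in> \<G>" for g
      proof -
        have gm: "g \<in> borel_measurable \<nu>"
          unfolding \<nu>_def using \<G>(2)[OF g] by (simp add: measurable_pos_cong[OF gibbs_prob])
        have gR: "AE x in \<nu>. \<bar>g x\<bar> \<le> R" using \<nu>(2) by eventually_elim (rule B(5)[OF g])
        have MJ: "density (gibbs \<phi>) (\<lambda>x. ennreal (w n j x)) = \<nu>" if "j \<in> J" for j
          by (simp add: wJ[OF that] \<nu>_def)
        show ?thesis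
          using hoeffding_product[where M="\<lambda>j. density (gibbs \<phi>) (\<lambda>x. ennreal (w n j x))" and I="{1..n}" and J=J and \<nu>=\<nu> and g=g and R=R and \<eta>=\<eta>,
              OF w_prob _ JS(8,7) MJ gm gR B(3)] \<eta>(1)
          unfolding Q_def[symmetric] JS(5) by simp
      qed
      have UN: "(\<Union>g\<in>\<G>. ?bad g) \<in> sets Q" by (rule sets.finite_UN[OF \<G>(1) bad_sets])
      have "measure Q (\<Union>g\<in>\<G>. ?bad g) \<le> (\<Sum>g\<in>\<G>. measure Q (?bad g))"
        by (rule measure_UNION_le[OF \<G>(1) bad_sets])
      also have "\<dots> \<le> (\<Sum>g\<in>\<G>. 2 * exp (- (real n' * \<eta>\<^sup>2 / (2 * R\<^sup>2))))" by (intro sum_mono bad)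
      also have "\<dots> \<le> 1 / 2" using E7 by (simp add: n'_def)
      finally have "measure Q (space Q - (\<Union>g\<in>\<G>. ?bad g)) \<ge> 1 / 2"
        using Q.prob_compl[OF UN] by simp
      also have "measure Q (space Q - (\<Union>g\<in>\<G>. ?bad g)) \<le> measure Q E"
      proof (rule Q.finite_measure_mono_AE)
        have AJ: "AE \<omega> in Q. \<omega> j \<in> B" if "j \<in> J" for j
        proof -
          have "AE x in density (gibbs \<phi>) (\<lambda>x. ennreal (w n j x)). x \<in> B"
            using \<nu>(2) unfolding wJ[OF that] \<nu>_def .
          then show ?thesis unfolding Q_def using that JS(8) by (intro AE_PiM_component w_prob) auto
        qed
        have AS: "AE \<omega> in Q. \<omega> j \<in> jump_set (tt n j) \<tau> n" if "j \<in> Sp" for j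
        proof -
          have "AE x in density (gibbs \<phi>) (\<lambda>x. ennreal (w n j x)). x \<in> jump_set (tt n j) \<tau> n"
            using w_meas[of j] by (subst AE_density) (auto simp: wS[OF that] split: split_indicator)
          then show ?thesis unfolding Q_def using that JS(9) by (intro AE_PiM_component w_prob) auto
        qed
        have "AE \<omega> in Q. (\<forall>j\<in>J. \<omega> j \<in> B) \<and> (\<forall>j\<in>Sp. \<omega> j \<in> jump_set (tt n j) \<tau> n)"
          using AJ AS JS(3,4) by (intro AE_conjI AE_finite_allI)
        then show "AE \<omega> in Q. \<omega> \<in> space Q - (\<Union>g\<in>\<G>. ?bad g) \<longrightarrow> \<omega> \<in> E"
        proof eventually_elim
          case (elim \<omega>)
          show ?case unfolding E_def spaceQ[symmetric] using elim by (auto simp: not_le)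
        qed
        show "E \<in> sets Q" using E_sets setsQ by simp
      qed
      finally show ?thesis .
    qed

    have "1 / 2 \<le> exp (real n * (H + 5 * \<eta>)) * measure (samples {1..n}) E"
    proof -
      have "measure Q E \<le> exp (real n * (H + 5 * \<eta>)) * measure (samples {1..n}) E"
        unfolding Q_def samples_def
      proof (rule change_of_measure_product)
        show "prob_space (gibbs \<phi>)" by (rule G.prob_space_axioms)
        show "E \<in> sets (PiM {1..n} (\<lambda>_. gibbs \<phi>))" using E_sets by (simp add: samples_def)
      qed (use w_meas w_nn w_prob w_bound in auto)
      with QE show ?thesis by linarith
    qed
    also have "measure (samples {1..n}) E \<le> joint_prob a U \<delta> n"
    proof -
      interpret P: prob_space "samples {1..n}" by (rule prob_space_samples)
      have "joint_prob a U \<delta> n = measure (samples {1..n}) (event a U \<delta> n {1..n})"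
        using U npos(1) by (intro joint_prob_finite) auto
      then show ?thesis
        using P.finite_measure_mono[OF E_sub event_measurable] U npos(1) by auto
    qed
    finally have half: "1 / 2 \<le> exp (real n * (H + 5 * \<eta>)) * joint_prob a U \<delta> n"
      by (simp add: mult_left_mono)
    have "exp (- real n * (H + \<epsilon>)) \<le> exp (- (real n * (H + 5 * \<eta>)) - \<eta> * real n)"
    proof -
      have "real n * (H + 5 * \<eta>) + \<eta> * real n = real n * (H + 6 * \<eta>)" by (simp add: algebra_simps)
      also have "\<dots> \<le> real n * (H + \<epsilon>)" using \<eta> by (intro mult_left_mono) auto
      finally show ?thesis by simp
    qed
    also have "\<dots> = exp (- (real n * (H + 5 * \<eta>))) * exp (- (\<eta> * real n))"
      unfolding exp_add[symmetric] by simp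
    also have "\<dots> \<le> exp (- (real n * (H + 5 * \<eta>))) * (1 / 2)"
    proof (intro mult_left_mono)
      have "exp (- (\<eta> * real n)) \<le> exp (- ln 2)" using E9 by simp
      then show "exp (- (\<eta> * real n)) \<le> 1 / 2" by (simp add: exp_minus)
    qed simp
    also have "\<dots> \<le> exp (- (real n * (H + 5 * \<eta>))) * (exp (real n * (H + 5 * \<eta>)) * joint_prob a U \<delta> n)"
      using half by (intro mult_left_mono) auto
    also have "\<dots> = joint_prob a U \<delta> n" by (simp add: mult.assoc[symmetric] exp_add[symmetric])
    finally show ?case by (simp add: H_def)
  qed
qed

end

section \<open>The large deviation principle\<close>

text \<open>The next two lemmas turn a comparison of probabilities up to an exponential factor into one of
normalised logarithms; a vanishing probability has logarithm \<open>- \<infinity>\<close>.\<close>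

lemma scaled_log_le:
  assumes n: "n \<ge> 1" and q: "q > 0" and p: "p \<le> exp (- real n * s) * q"
  shows "ereal (1 / real n) * ereal_log (p / q) \<le> ereal (- s)"
proof (cases "p / q \<le> 0")
  case True
  then show ?thesis using n by (simp add: ereal_log_def)
next
  case False
  then have pq: "p / q > 0" by simp
  have "p / q \<le> exp (- real n * s)" using p q by (simp add: divide_le_eq)
  then have "ln (p / q) \<le> - real n * s" using pq by (metis ln_exp ln_le_cancel_iff exp_gt_zero)
  then have "ln (p / q) / real n \<le> - s" using n by (simp add: divide_le_eq mult.commute)
  then show ?thesis using False by (simp add: ereal_log_def)
qed

lemma scaled_log_ge:
  assumes n: "n \<ge> 1" and q: "q > 0" and p: "p \<ge> exp (- real n * s) * q"
  shows "ereal (1 / real n) * ereal_log (p / q) \<ge> ereal (- s)"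
proof -
  have e: "exp (- real n * s) \<le> p / q" using p q by (simp add: le_divide_eq)
  then have pq: "p / q > 0" using exp_gt_zero[of "- real n * s"] by linarith
  then have "- real n * s \<le> ln (p / q)" using e by (metis ln_exp ln_le_cancel_iff exp_gt_zero)
  then have "- s \<le> ln (p / q) / real n" using n by (simp add: le_divide_eq mult.commute)
  then show ?thesis using pq by (simp add: ereal_log_def)
qed

context moment_functions
begin

lemma J_max_eq: "J_max k \<phi> a \<mu> z = (if feasible a \<mu> z then - diff_entropy \<mu> - K_val k \<phi> a else \<infinity>)"
  by (simp add: J_max_def feasible_def)

lemma feasible_mono: "feasible a \<mu> z \<Longrightarrow> z' \<le> z \<Longrightarrow> feasible a \<mu> z'"
  unfolding feasible_def using order_trans[of "moment (\<phi> k) \<mu>" "ereal (a k - z)" "ereal (a k - z')"] by auto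

lemma admissible_witness:
  assumes a: "a \<in> admissible k \<phi>"
  obtains \<mu> where "\<mu> \<in> prob_measures_pos" "feasible a \<mu> 0" "diff_entropy \<mu> \<noteq> - \<infinity>"
proof -
  have "g1 k \<phi> (restrict a {1..k-1}) < ereal (a k)" using a by (simp add: admissible_def)
  then obtain \<mu> where "\<mu> \<in> prob_measures_pos" "diff_entropy \<mu> \<noteq> - \<infinity>"
    "moments_match k \<phi> (restrict a {1..k-1}) \<mu>" "moment (\<phi> k) \<mu> < ereal (a k)"
    unfolding g1_def by (auto simp: INF_less_iff)
  then show ?thesis
    using that by (simp add: feasible_def moments_match_def less_imp_le)
qed

lemma K_val_le:
  assumes "\<mu> \<in> prob_measures_pos" "feasible a \<mu> z" "z \<ge> 0"
  shows "K_val k \<phi> a \<le> - diff_entropy \<mu>"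
  unfolding K_val_def using assms feasible_mono[OF assms(2,3)]
  by (intro INF_lower) (simp add: feasible_def)

text \<open>Admissibility provides a feasible measure of finite entropy, and entropy is bounded above on measures
with prescribed first moment.\<close>

lemma K_val_finite:
  assumes a: "a \<in> admissible k \<phi>"
  obtains K where "K_val k \<phi> a = ereal K"
proof -
  obtain \<mu> where \<mu>: "\<mu> \<in> prob_measures_pos" "feasible a \<mu> 0" "diff_entropy \<mu> \<noteq> - \<infinity>"
    using admissible_witness[OF a] by blast
  have "K_val k \<phi> a \<le> - diff_entropy \<mu>" by (rule K_val_le[OF \<mu>(1,2)]) simp
  then have up: "K_val k \<phi> a \<noteq> \<infinity>"
    using \<mu>(3) by (cases "diff_entropy \<mu>") auto
  have "ereal (- (a 1 + Z)) \<le> K_val k \<phi> a"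
    unfolding K_val_def
  proof (rule INF_greatest)
    fix \<nu> assume "\<nu> \<in> {\<mu> \<in> prob_measures_pos. moments_match k \<phi> a \<mu> \<and> moment (\<phi> k) \<mu> \<le> ereal (a k)}"
    then have \<nu>: "\<nu> \<in> prob_measures_pos" "feasible a \<nu> 0" by (auto simp: feasible_def)
    show "ereal (- (a 1 + Z)) \<le> - diff_entropy \<nu>"
    proof (cases "diff_entropy \<nu> = - \<infinity>")
      case False
      have "diff_entropy \<nu> \<le> ereal (a 1 + Z)"
        by (rule finite_entropy(4)[OF \<nu>(1) feasible_moment1[OF \<nu>(2)] False])
      then show ?thesis by (metis ereal_uminus_le_reorder uminus_ereal.simps(1) ereal_minus_le_minus)
    qed simp
  qed
  then have "K_val k \<phi> a \<noteq> - \<infinity>" by auto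
  with up that show ?thesis by (cases "K_val k \<phi> a") auto
qed

text \<open>In particular the shell has positive probability eventually, so conditioning on it is meaningful.\<close>

lemma shell_lower_bound:
  assumes K: "K_val k \<phi> a = ereal K" and \<delta>: "\<delta> > 0" and \<epsilon>: "\<epsilon> > 0"
  shows "eventually (\<lambda>n. joint_prob a (topspace state_topology) \<delta> n \<ge> exp (- real n * (K + (a 1 + ln Z) + \<epsilon>))) sequentially"
proof -
  have "K_val k \<phi> a < ereal (K + \<epsilon> / 2)" using K \<epsilon> by simp
  then obtain \<mu> where \<mu>: "\<mu> \<in> prob_measures_pos" "feasible a \<mu> 0" "- diff_entropy \<mu> < ereal (K + \<epsilon> / 2)"
    unfolding K_val_def by (auto simp: INF_less_iff feasible_def)
  then have "diff_entropy \<mu> \<noteq> - \<infinity>" by auto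
  from finite_entropy(3)[OF \<mu>(1) feasible_moment1[OF \<mu>(2)] this] obtain h where h: "diff_entropy \<mu> = ereal h" by blast
  have hK: "- h < K + \<epsilon> / 2" using \<mu>(3) by (simp add: h)
  have "eventually (\<lambda>n. joint_prob a (topspace state_topology) \<delta> n \<ge> exp (- real n * (- h + (a 1 + ln Z) + \<epsilon> / 2))) sequentially"
    using \<mu> \<delta> \<epsilon> h by (intro joint_lower_bound[where \<mu>=\<mu> and z=0]) (auto simp del: topspace_state_topology simp: topspace_state_topology[THEN eqset_imp_iff])
  then show ?thesis
  proof eventually_elim
    case (elim n)
    have "exp (- real n * (K + (a 1 + ln Z) + \<epsilon>)) \<le> exp (- real n * (- h + (a 1 + ln Z) + \<epsilon> / 2))"
      using hK by (simp add: mult_left_mono)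
    with elim show ?case by linarith
  qed
qed

lemma LDP_lower:
  assumes a: "a \<in> admissible k \<phi>" and U: "openin state_topology U"
  shows "- (INF (\<mu>, z) \<in> U. J_max k \<phi> a \<mu> z) \<le> Liminf (at_right 0) (\<lambda>\<delta>. liminf (log_cond_prob k \<phi> a U \<delta>))"
proof -
  obtain K where K: "K_val k \<phi> a = ereal K" using K_val_finite[OF a] by blast
  let ?L = "Liminf (at_right 0) (\<lambda>\<delta>. liminf (log_cond_prob k \<phi> a U \<delta>))"
  have "- ?L \<le> (INF (\<mu>, z) \<in> U. J_max k \<phi> a \<mu> z)"
  proof (rule INF_greatest)
    fix p assume pU: "p \<in> U"
    obtain \<mu> z where p: "p = (\<mu>, z)" by (cases p)
    have \<mu>: "\<mu> \<in> prob_measures_pos" "z \<ge> 0" using pU p openin_subset[OF U] by auto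
    have "- ?L \<le> J_max k \<phi> a \<mu> z"
    proof (cases "feasible a \<mu> z \<and> diff_entropy \<mu> \<noteq> - \<infinity>")
      case False
      then have "J_max k \<phi> a \<mu> z = \<infinity>" by (auto simp: J_max_eq K)
      then show ?thesis by simp
    next
      case True
      then have f: "feasible a \<mu> z" and "diff_entropy \<mu> \<noteq> - \<infinity>" by auto
      from finite_entropy(3)[OF \<mu>(1) feasible_moment1[OF f] this(2)] obtain h where h: "diff_entropy \<mu> = ereal h" by blast
      have J: "J_max k \<phi> a \<mu> z = ereal (- h - K)" using f by (simp add: J_max_eq K h)
      have "- J_max k \<phi> a \<mu> z \<le> ?L"
      proof (rule ereal_le_epsilon2)
        fix e :: real assume "e > 0"
        define \<epsilon> where "\<epsilon> = e / 2"
        have \<epsilon>: "\<epsilon> > 0" using \<open>e > 0\<close> by (simp add: \<epsilon>_def)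
        obtain \<delta>0 where \<delta>0: "\<delta>0 > 0" "\<And>\<delta>. \<delta> \<le> \<delta>0 \<Longrightarrow>
          eventually (\<lambda>n. joint_prob a (topspace state_topology) \<delta> n \<le> exp (- real n * (K + (a 1 + ln Z) - \<epsilon>))) sequentially"
        proof (rule joint_upper_bound[of "topspace state_topology" a K \<epsilon>])
          fix \<nu> y assume "(\<nu>, y) \<in> topspace state_topology" "feasible a \<nu> y"
          then show "ereal K \<le> - diff_entropy \<nu>" using K_val_le[of \<nu> a y] by (simp add: K)
        next
          show "closedin state_topology (topspace state_topology)" by (rule closedin_topspace)
          show "\<epsilon> > 0" by (rule \<epsilon>)
        qed (rule that)
        have "eventually (\<lambda>\<delta>. \<delta> > 0 \<and> \<delta> \<le> \<delta>0) (at_right (0::real))"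
          using \<delta>0(1) eventually_at_right_field[of "\<lambda>\<delta>. \<delta> > 0 \<and> \<delta> \<le> \<delta>0" "0::real"] by (auto intro!: exI[of _ \<delta>0])
        then have "eventually (\<lambda>\<delta>. ereal (- (- h - K + 2 * \<epsilon>)) \<le> liminf (log_cond_prob k \<phi> a U \<delta>)) (at_right 0)"
        proof eventually_elim
          case (elim \<delta>)
          have \<delta>: "\<delta> > 0" "\<delta> \<le> \<delta>0" using elim by auto
          show ?case
          proof (rule Liminf_bounded)
            from joint_lower_bound[OF U pU[unfolded p] f h \<delta>(1) \<epsilon>] \<delta>0(2)[OF \<delta>(2)]
              shell_lower_bound[OF K \<delta>(1) \<epsilon>] eventually_ge_at_top[of 1]
            show "eventually (\<lambda>n. ereal (- (- h - K + 2 * \<epsilon>)) \<le> log_cond_prob k \<phi> a U \<delta> n) sequentially"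
            proof eventually_elim
              case (elim n)
              let ?D = "joint_prob a (topspace state_topology) \<delta> n"
              have D: "?D > 0" using elim(3) exp_gt_zero order_less_le_trans by blast
              have "exp (- real n * (- h - K + 2 * \<epsilon>)) * ?D \<le> exp (- real n * (- h - K + 2 * \<epsilon>)) * exp (- real n * (K + (a 1 + ln Z) - \<epsilon>))"
                using elim(2) by (intro mult_left_mono) auto
              also have "\<dots> = exp (- real n * (- h + (a 1 + ln Z) + \<epsilon>))"
                unfolding exp_add[symmetric] by (simp add: algebra_simps)
              also have "\<dots> \<le> joint_prob a U \<delta> n" by (rule elim(1))
              finally show ?case
                unfolding log_cond_prob_eq[OF elim(4)] by (intro scaled_log_ge elim(4) D)
            qed
          qed
        qed
        then have "ereal (- (- h - K + 2 * \<epsilon>)) \<le> ?L" by (rule Liminf_bounded)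
        then have "ereal (- (- h - K + 2 * \<epsilon>)) + ereal e \<le> ?L + ereal e" by (rule add_right_mono)
        then show "- J_max k \<phi> a \<mu> z \<le> ?L + ereal e" by (simp add: J \<epsilon>_def)
      qed
      then show ?thesis by (simp add: ereal_uminus_le_reorder)
    qed
    then show "- ?L \<le> (case p of (\<mu>, z) \<Rightarrow> J_max k \<phi> a \<mu> z)" by (simp add: p)
  qed
  then show ?thesis by (simp add: ereal_uminus_le_reorder)
qed

lemma LDP_upper:
  assumes a: "a \<in> admissible k \<phi>" and F: "closedin state_topology F"
  shows "Limsup (at_right 0) (\<lambda>\<delta>. limsup (log_cond_prob k \<phi> a F \<delta>)) \<le> - (INF (\<mu>, z) \<in> F. J_max k \<phi> a \<mu> z)"
proof (rule ccontr)
  obtain K where K: "K_val k \<phi> a = ereal K" using K_val_finite[OF a] by blast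
  let ?L = "Limsup (at_right 0) (\<lambda>\<delta>. limsup (log_cond_prob k \<phi> a F \<delta>))"
  let ?I = "INF (\<mu>, z) \<in> F. J_max k \<phi> a \<mu> z"
  assume "\<not> ?thesis"
  then have "- ?I < ?L" by simp
  \<comment> \<open>two reals in the gap: \<open>- x'\<close> is the rate used in the upper bound, and \<open>x - x'\<close> is the room for
    the errors of the numerator and of the shell probability\<close>
  then obtain x where x: "- ?I < ereal x" "ereal x < ?L" using ereal_dense2 by blast
  then obtain x' where x': "- ?I < ereal x'" "ereal x' < ereal x" using ereal_dense2 by blast
  define \<epsilon> where "\<epsilon> = (x - x') / 2"
  have \<epsilon>: "\<epsilon> > 0" using x'(2) by (simp add: \<epsilon>_def)
  have r: "ereal (- x') < ?I" using x'(1) by (metis ereal_uminus_less_reorder uminus_ereal.simps(1))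
  obtain \<delta>0 where \<delta>0: "\<delta>0 > 0" "\<And>\<delta>. \<delta> \<le> \<delta>0 \<Longrightarrow>
    eventually (\<lambda>n. joint_prob a F \<delta> n \<le> exp (- real n * ((K - x') + (a 1 + ln Z) - \<epsilon>))) sequentially"
  proof (rule joint_upper_bound[OF F _ \<epsilon>, of a "K - x'"])
    fix \<mu> z assume p: "(\<mu>, z) \<in> F" and f: "feasible a \<mu> z"
    have "?I \<le> J_max k \<phi> a \<mu> z" using INF_lower[OF p, of "\<lambda>(\<mu>, z). J_max k \<phi> a \<mu> z"] by simp
    with r have "ereal (- x') \<le> - diff_entropy \<mu> - ereal K" using f by (simp add: J_max_eq K)
    then show "ereal (K - x') \<le> - diff_entropy \<mu>" by (cases "diff_entropy \<mu>") auto
  qed (rule that)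
  have "eventually (\<lambda>\<delta>. \<delta> > 0 \<and> \<delta> \<le> \<delta>0) (at_right (0::real))"
    using \<delta>0(1) eventually_at_right_field[of "\<lambda>\<delta>. \<delta> > 0 \<and> \<delta> \<le> \<delta>0" "0::real"] by (auto intro!: exI[of _ \<delta>0])
  then have "eventually (\<lambda>\<delta>. limsup (log_cond_prob k \<phi> a F \<delta>) \<le> ereal (- (- x' - 2 * \<epsilon>))) (at_right 0)"
  proof eventually_elim
    case (elim \<delta>)
    have \<delta>: "\<delta> > 0" "\<delta> \<le> \<delta>0" using elim by auto
    show ?case
    proof (rule Limsup_bounded)
      from \<delta>0(2)[OF \<delta>(2)] shell_lower_bound[OF K \<delta>(1) \<epsilon>] eventually_ge_at_top[of 1]
      show "eventually (\<lambda>n. log_cond_prob k \<phi> a F \<delta> n \<le> ereal (- (- x' - 2 * \<epsilon>))) sequentially"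
      proof eventually_elim
        case (elim n)
        let ?D = "joint_prob a (topspace state_topology) \<delta> n"
        have D: "?D > 0" using elim(2) exp_gt_zero order_less_le_trans by blast
        have "joint_prob a F \<delta> n \<le> exp (- real n * ((K - x') + (a 1 + ln Z) - \<epsilon>))" by (rule elim(1))
        also have "\<dots> = exp (- real n * (- x' - 2 * \<epsilon>)) * exp (- real n * (K + (a 1 + ln Z) + \<epsilon>))"
          unfolding exp_add[symmetric] by (simp add: algebra_simps)
        also have "\<dots> \<le> exp (- real n * (- x' - 2 * \<epsilon>)) * ?D"
          using elim(2) by (intro mult_left_mono) auto
        finally show ?case
          unfolding log_cond_prob_eq[OF elim(3)] by (intro scaled_log_le elim(3) D)
      qed
    qed
  qed
  then have "?L \<le> ereal (- (- x' - 2 * \<epsilon>))" by (rule Limsup_bounded)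
  moreover have "- (- x' - 2 * \<epsilon>) = x" by (simp add: \<epsilon>_def field_simps)
  ultimately have "?L \<le> ereal x" by simp
  with x(2) show False by simp
qed

lemma log_cond_prob_mono:
  assumes "openin state_topology F \<or> closedin state_topology F" "n \<ge> 1" "E \<subseteq> F"
  shows "log_cond_prob k \<phi> a E \<delta> n \<le> log_cond_prob k \<phi> a F \<delta> n"
proof -
  let ?D = "joint_prob a (topspace state_topology) \<delta> n"
  have "joint_prob a E \<delta> n / ?D \<le> joint_prob a F \<delta> n / ?D"
    by (intro divide_right_mono joint_prob_mono assms) (simp add: joint_prob_def)
  then have "ereal_log (joint_prob a E \<delta> n / ?D) \<le> ereal_log (joint_prob a F \<delta> n / ?D)"
    by (auto simp: ereal_log_def)
  then show ?thesis
    unfolding log_cond_prob_eq[OF assms(2)] by (intro ereal_mult_left_mono) auto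
qed

end

theorem theorem2p4:
  fixes k :: nat and \<phi> :: "nat \<Rightarrow> real \<Rightarrow> real" and a :: "nat \<Rightarrow> real"
    and A :: "(real measure \<times> real) set"
  assumes k: "k \<ge> 2"
    and pos: "\<And>i x. i \<in> {1..k} \<Longrightarrow> x > 0 \<Longrightarrow> \<phi> i x > 0"
    and C1_diff: "\<And>i x. i \<in> {1..k} \<Longrightarrow> x > 0 \<Longrightarrow> \<phi> i differentiable (at x)"
    and C1_cont: "\<And>i. i \<in> {1..k} \<Longrightarrow> continuous_on {0<..} (deriv (\<phi> i))"
    and C1_mono: "\<And>i. i \<in> {1..k} \<Longrightarrow> mono_on {0<..} (\<phi> i)"
    and C1_lim: "\<And>i. i \<in> {1..k} \<Longrightarrow> filterlim (\<phi> i) at_top at_top"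
    and C2: "\<And>i c. i \<in> {1..k} \<Longrightarrow> c > 0 \<Longrightarrow>
      set_integrable lborel {0<..} (\<lambda>x. exp (- c * \<phi> i x))"
    and C3: "\<exists>\<kappa>>1. \<forall>i\<in>{1..k-1}. eventually (\<lambda>x. \<phi> i x powr \<kappa> < \<phi> (i + 1) x) at_top"
    and C4: "\<exists>C>0. \<exists>M>0. \<forall>x>C. \<forall>i\<in>{1..k}.
      1 / C * \<phi> i x powr (- M) < deriv (\<phi> i) x \<and> deriv (\<phi> i) x < C * \<phi> i x powr M"
    and g1_cont: "continuous_map (subtopology (tuple_topology (k - 1)) (adm1 k \<phi>)) euclideanreal
      (\<lambda>v. real_of_ereal (g1 k \<phi> v))"
    and a: "a \<in> admissible k \<phi>"
    and A: "A \<in> borel_sets_of state_topology"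
  shows "- (INF (\<mu>, z) \<in> state_topology interior_of A. J_max k \<phi> a \<mu> z)
      \<le> Liminf (at_right 0) (\<lambda>\<delta>. liminf (log_cond_prob k \<phi> a (state_topology interior_of A) \<delta>))
    \<and> Liminf (at_right 0) (\<lambda>\<delta>. liminf (log_cond_prob k \<phi> a (state_topology interior_of A) \<delta>))
      \<le> Limsup (at_right 0) (\<lambda>\<delta>. limsup (log_cond_prob k \<phi> a (state_topology closure_of A) \<delta>))
    \<and> Limsup (at_right 0) (\<lambda>\<delta>. limsup (log_cond_prob k \<phi> a (state_topology closure_of A) \<delta>))
      \<le> - (INF (\<mu>, z) \<in> state_topology closure_of A. J_max k \<phi> a \<mu> z)"
proof -
  interpret moment_functions k \<phi>
    by unfold_locales (fact k, fact pos, fact C1_diff, fact C1_mono, fact C1_lim, fact C2, fact C3, fact C4)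
  let ?f = "log_cond_prob k \<phi> a (state_topology interior_of A)"
  let ?g = "log_cond_prob k \<phi> a (state_topology closure_of A)"
  have le: "liminf (?f \<delta>) \<le> limsup (?g \<delta>)" for \<delta>
  proof -
    have "liminf (?f \<delta>) \<le> limsup (?f \<delta>)" by (rule Liminf_le_Limsup) simp
    also have "\<dots> \<le> limsup (?g \<delta>)"
    proof (rule Limsup_mono)
      show "eventually (\<lambda>n. ?f \<delta> n \<le> ?g \<delta> n) sequentially"
        using eventually_ge_at_top[of 1]
        by eventually_elim (intro log_cond_prob_mono disjI2 closedin_closure_of interior_of_subset_closure_of)
    qed
    finally show ?thesis .
  qed
  have "Liminf (at_right 0) (\<lambda>\<delta>. liminf (?f \<delta>)) \<le> Liminf (at_right 0) (\<lambda>\<delta>. limsup (?g \<delta>))"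
    by (intro Liminf_mono always_eventually allI le)
  also have "\<dots> \<le> Limsup (at_right 0) (\<lambda>\<delta>. limsup (?g \<delta>))"
    by (rule Liminf_le_Limsup) simp
  finally show ?thesis
    using LDP_lower[OF a openin_interior_of] LDP_upper[OF a closedin_closure_of] by blast
qed

end
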